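(* Let $3\le K\le L$ be integers. On the rectangular torus $C_L\square C_K$, under every endpoint-local monotone rule and every initial law, for all $t\ge L^2$, $$\mathbb{E}\,\operatorname{Gap}(X_t)\ge c_2\sqrt{L/K+\log K}$$ and $$\mathbb{P}\bigl(\operatorname{Gap}(X_t)\ge c_2\sqrt{L/K+\log K}\bigr)\ge\tfrac18,$$ where $$c_2=\frac{1}{1280\pi\sqrt{42}}.$$ The same conclusions hold under every invariant normalized law: if $\pi$ is an invariant normalized law, then $\mathbb{E}_\pi\operatorname{Gap}\ge c_2\sqrt{L/K+\log K}$ and $\pi\bigl(\operatorname{Gap}\ge c_2\sqrt{L/K+\log K}\bigr)\ge\frac18$.
   Context: $C_n$ is the cycle on $n$ vertices and $\square$ is the Cartesian product of graphs; $\log$ is the natural logarithm. For a finite simple graph $G=(V,E)$, load vectors (profiles) are elements $x\in\mathbb{Z}^V$, and $\operatorname{Gap}(x)=\max_{v}x_v-\min_v x_v$. An endpoint-local monotone rule on $G$ is given by, for each edge $e\in E$, a fixed orientation $(u,v)$ of $e$ and a nonincreasing function $p_e:\mathbb{Z}\to[0,1]$ (the functions may differ between edges; constants allowed). The edges ring according to independent rate-one Poisson processes. When $e$ with orientation $(u,v)$ rings and the current load vector is $x$, a fresh independent $U$ uniform on $(0,1)$ is drawn, and one ball is added to $u$ if $U\le p_e(x_u-x_v)$ and to $v$ otherwise. $X_t$ is the load vector at time $t$; an initial law is any law on $\mathbb{Z}^V$, with $X_0$ independent of the future clocks and marks. The process is invariant under common integer translations of the load vector; the normalized process is the induced Markov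 process on $\mathbb{Z}^V/\mathbb{Z}\mathbf{1}$, and an invariant normalized law is an invariant probability measure of it. $\operatorname{Gap}$ is well defined on this quotient. *)

theory Defs
  imports "HOL-Probability.Probability"
begin

section \<open>Graphs\<close>

text \<open>A finite simple graph is a pair of a vertex set and a set of two-element vertex sets.\<close>

type_synonym 'a ugraph = "'a set \<times> 'a set set"

abbreviation verts :: "'a ugraph \<Rightarrow> 'a set" where "verts \<equiv> fst"
abbreviation edges :: "'a ugraph \<Rightarrow> 'a set set" where "edges \<equiv> snd"

definition finite_simple_graph :: "'a ugraph \<Rightarrow> bool" where
  "finite_simple_graph G \<longleftrightarrow>
     finite (verts G) \<and> (\<forall>e\<in>edges G. e \<subseteq> verts G \<and> card e = 2)"

definition cycle_graph :: "nat \<Rightarrow> nat ugraph" where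
  "cycle_graph n = ({..<n}, {{i, Suc i mod n} | i. i < n})"

definition cartesian_product :: "'a ugraph \<Rightarrow> 'b ugraph \<Rightarrow> ('a \<times> 'b) ugraph"
    (infixr \<open>\<box>\<close> 70) where
  "G \<box> H = (verts G \<times> verts H,
     {{(a, b), (a', b)} | a a' b. {a, a'} \<in> edges G \<and> b \<in> verts H} \<union>
     {{(a, b), (a, b')} | a b b'. a \<in> verts G \<and> {b, b'} \<in> edges H})"

lemma finite_simple_graph_torus:
  assumes "3 \<le> L" "3 \<le> K"
  shows "finite_simple_graph (cycle_graph L \<box> cycle_graph K)"
proof -
  have c: "finite_simple_graph (cycle_graph n)" if "3 \<le> n" for n
  proof -
    have "Suc i mod n \<noteq> i" if "i < n" for i
      using that \<open>3 \<le> n\<close> by (cases "Suc i = n") auto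
    then show ?thesis
      using that by (auto simp: finite_simple_graph_def cycle_graph_def card_insert_if) (metis)
  qed
  have "card {(a::nat, b::nat), (a', b)} = 2" if "card {a, a'} = 2" for a a' b
    using that by (auto simp: card_insert_if split: if_splits)
  moreover have "card {(b::nat, a::nat), (b, a')} = 2" if "card {a, a'} = 2" for a a' b
    using that by (auto simp: card_insert_if split: if_splits)
  ultimately show ?thesis
    using c[OF assms(1)] c[OF assms(2)]
    unfolding finite_simple_graph_def cartesian_product_def by fastforce
qed


section \<open>Load vectors\<close>

text \<open>Load vectors on \<open>V\<close> are functions that are \<open>undefined\<close> outside \<open>V\<close>, so that
  \<open>loads V\<close> is a copy of $\mathbb{Z}^V$ and is countable when \<open>V\<close> is finite.\<close>

abbreviation loads :: "'a set \<Rightarrow> ('a \<Rightarrow> int) set" where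
  "loads V \<equiv> V \<rightarrow>\<^sub>E UNIV"

definition gap :: "'a set \<Rightarrow> ('a \<Rightarrow> int) \<Rightarrow> int" where
  "gap V x = Max (x ` V) - Min (x ` V)"

definition translation_rel :: "'a set \<Rightarrow> (('a \<Rightarrow> int) \<times> ('a \<Rightarrow> int)) set" where
  "translation_rel V =
     {(x, y). x \<in> loads V \<and> y \<in> loads V \<and> (\<exists>c. \<forall>v\<in>V. y v = x v + c)}"

text \<open>The quotient $\mathbb{Z}^V/\mathbb{Z}\mathbf{1}$ and the gap on it.\<close>

definition normalized_loads :: "'a set \<Rightarrow> ('a \<Rightarrow> int) set set" where
  "normalized_loads V = loads V // translation_rel V"

definition normalized_gap :: "'a set \<Rightarrow> ('a \<Rightarrow> int) set \<Rightarrow> int" where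
  "normalized_gap V C = the_elem (gap V ` C)"

text \<open>A law on a (countable) set \<open>S\<close>: a probability measure on all subsets of \<open>S\<close>.\<close>

definition law_on :: "'b set \<Rightarrow> 'b measure \<Rightarrow> bool" where
  "law_on S \<mu> \<longleftrightarrow> prob_space \<mu> \<and> sets \<mu> = Pow S"


section \<open>Endpoint-local monotone rules\<close>

text \<open>\<open>ori e\<close> is the orientation \<open>(u, v)\<close> of the edge \<open>e\<close>; \<open>p e d\<close> is the probability of
  choosing \<open>u\<close> when the load difference \<open>x u - x v\<close> is \<open>d\<close>.\<close>

definition endpoint_local_monotone_rule ::
    "'a ugraph \<Rightarrow> ('a set \<Rightarrow> 'a \<times> 'a) \<Rightarrow> ('a set \<Rightarrow> int \<Rightarrow> real) \<Rightarrow> bool" where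
  "endpoint_local_monotone_rule G ori p \<longleftrightarrow>
     (\<forall>e\<in>edges G. e = {fst (ori e), snd (ori e)} \<and>
        antimono (p e) \<and> (\<forall>d. 0 \<le> p e d \<and> p e d \<le> 1))"

definition add_ball ::
    "('a set \<Rightarrow> 'a \<times> 'a) \<Rightarrow> ('a set \<Rightarrow> int \<Rightarrow> real) \<Rightarrow> 'a set \<Rightarrow> real \<Rightarrow> ('a \<Rightarrow> int) \<Rightarrow> ('a \<Rightarrow> int)" where
  "add_ball ori p e U x =
     (let (u, v) = ori e in
      if U \<le> p e (x u - x v) then x(u := x u + 1) else x(v := x v + 1))"


section \<open>The clocks and marks\<close>

text \<open>An outcome \<open>\<omega>\<close> of the driving randomness assigns to the \<open>k\<close>-th ring (counting from
  \<open>0\<close>) of the edge \<open>e\<close> the pair \<open>\<omega> (e, k)\<close> of the waiting time since the previous ring of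
  \<open>e\<close> and the mark \<open>U\<close> used at that ring. All these are independent; the waiting times are
  exponential of rate one, that is, the edges ring according to independent rate-one Poisson
  processes, and the marks are uniform on \<open>(0, 1)\<close>.\<close>

definition clocks_marks :: "'a ugraph \<Rightarrow> ('a set \<times> nat \<Rightarrow> real \<times> real) measure" where
  "clocks_marks G =
     (\<Pi>\<^sub>M i \<in> edges G \<times> UNIV.
        density lborel (exponential_density 1) \<Otimes>\<^sub>M uniform_measure lborel {0<..<1})"

definition ring_time :: "('a set \<times> nat \<Rightarrow> real \<times> real) \<Rightarrow> 'a set \<times> nat \<Rightarrow> real" where
  "ring_time \<omega> = (\<lambda>(e, k). \<Sum>j\<le>k. fst (\<omega> (e, j)))"

definition rings_upto ::
    "'a ugraph \<Rightarrow> ('a set \<times> nat \<Rightarrow> real \<times> real) \<Rightarrow> real \<Rightarrow> ('a set \<times> nat) set" where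
  "rings_upto G \<omega> t = {i \<in> edges G \<times> UNIV. ring_time \<omega> i \<le> t}"

text \<open>The load vector at time \<open>t\<close> when the initial one is \<open>x\<close>: the rings up to time \<open>t\<close> are
  carried out in order of time. On the null event that there are infinitely many of them, or
  that two of them are simultaneous, the value is set to \<open>x\<close> by convention, so that it is a
  random variable on the whole space.\<close>

definition load_at ::
    "'a ugraph \<Rightarrow> ('a set \<Rightarrow> 'a \<times> 'a) \<Rightarrow> ('a set \<Rightarrow> int \<Rightarrow> real) \<Rightarrow> real \<Rightarrow>
     ('a \<Rightarrow> int) \<times> ('a set \<times> nat \<Rightarrow> real \<times> real) \<Rightarrow> ('a \<Rightarrow> int)" where
  "load_at G ori p t = (\<lambda>(x, \<omega>).
     if finite (rings_upto G \<omega> t) \<and> inj_on (ring_time \<omega>) (rings_upto G \<omega> t)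
     then fold (\<lambda>i. add_ball ori p (fst i) (snd (\<omega> i)))
            (sorted_key_list_of_set (ring_time \<omega>) (rings_upto G \<omega> t)) x
     else x)"

text \<open>The process with initial law \<open>\<mu>\<close> is \<open>load_at G ori p t\<close> on the following space, whose
  first coordinate is $X_0$, independent of the clocks and marks. The same space serves for the
  normalized process, with \<open>\<mu>\<close> a law on the quotient.\<close>

abbreviation process_space ::
    "'a ugraph \<Rightarrow> 'b measure \<Rightarrow> ('b \<times> ('a set \<times> nat \<Rightarrow> real \<times> real)) measure" where
  "process_space G \<mu> \<equiv> \<mu> \<Otimes>\<^sub>M clocks_marks G"

text \<open>The dynamics commutes with translations, so the image of a class of load vectors under it
  is again a class; this is the normalized process started from the class \<open>C\<close>.\<close>

definition normalized_load_at ::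
    "'a ugraph \<Rightarrow> ('a set \<Rightarrow> 'a \<times> 'a) \<Rightarrow> ('a set \<Rightarrow> int \<Rightarrow> real) \<Rightarrow> real \<Rightarrow>
     ('a \<Rightarrow> int) set \<times> ('a set \<times> nat \<Rightarrow> real \<times> real) \<Rightarrow> ('a \<Rightarrow> int) set" where
  "normalized_load_at G ori p t = (\<lambda>(C, \<omega>). (\<lambda>x. load_at G ori p t (x, \<omega>)) ` C)"

definition invariant_normalized_law ::
    "'a ugraph \<Rightarrow> ('a set \<Rightarrow> 'a \<times> 'a) \<Rightarrow> ('a set \<Rightarrow> int \<Rightarrow> real) \<Rightarrow> ('a \<Rightarrow> int) set measure \<Rightarrow> bool" where
  "invariant_normalized_law G ori p \<nu> \<longleftrightarrow>
     law_on (normalized_loads (verts G)) \<nu> \<and>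
     (\<forall>t\<ge>0. distr (process_space G \<nu>) \<nu> (normalized_load_at G ori p t) = \<nu>)"


section \<open>The constant\<close>

definition c2 :: real where
  "c2 = 1 / (1280 * pi * sqrt 42)"

end

theory Submission
  imports Defs
begin

text \<open>Observed at its successive rings, the process is a Markov chain \<open>Q\<close> in which an additional ball
  at \<open>w\<close> makes every site other than \<open>w\<close> more likely to receive the next ball. Therefore two copies
  that differ by one ball can be coupled so that they always do, gradients are transported by a
  positive kernel, and the energy of $Q^j F$ decreases in \<open>j\<close>. For a slowly varying statistic
  $F(x) = \sum_v f(v) x_v$ the pairing of the gradient of $Q^j F$ with weights that are nearly a multiple of
  the rates is almost conserved, up to a multiple of the energy that has been lost; this keeps the
  energy bounded below, so that the variance of \<open>F\<close> grows linearly for about $L^3 K$ steps. With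
  \<open>f\<close> the lowest cosine mode in the direction of length \<open>L\<close>, a bound for the fourth moment and the
  Paley--Zygmund inequality show that \<open>F\<close> has size of order $LK\sqrt{L/K}$ with a fixed
  probability from every starting point, which forces a gap of order $\sqrt{L/K}$. For
  $\log K > L/K$ the gap comes instead from a site that receives no ball during about
  $\sqrt{\log K}$ rounds of $LK$ steps.

  The number of rings up to time \<open>t\<close> is a Poisson variable of mean $2LKt$ independent of the chain,
  and for $t \ge L^2$ it exceeds the number of steps needed above with probability at
  least $49/50$. All estimates are uniform in the starting point, so they hold for every initial
  law, and, the gap being invariant under translations, at time $L^2$ for an invariant normalized law.\<close>

section \<open>The chain of successive balls\<close>

text \<open>The rule is arbitrary: no reversibility, no known stationary law, no spectral gap. Three
  facts remain: a ball lands on an endpoint of the ringing edge, the rates sum to one, and they are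
  monotone. The natural pairing of the gradient with \<open>f w * \<pi> x w\<close> is unsuitable
  because the mass of these weights, the drift of \<open>F\<close>, depends on the state. Weighting
  each edge by the mean of \<open>f\<close> over its two endpoints gives weights \<Phi> of mass zero
  in every state, as every ring deposits exactly one ball; this is what makes the commutator consist
  of oscillations only. The scales are forced. One step costs \<eta> times (s times the largest
  rate, plus dissipation / s), with \<eta> of order 1/L and rates of order 1/(LK), while the total
  dissipation is bounded. Taking s of order 1/L keeps both costs small up to n of order L^3 K, and
  this is the n for which sqrt n / (LK) has the order of sqrt (L/K). The decimals leave a
  probability 14/100, and 14/100 times 49/50 still exceeds 1/8; the gap is shown to reach 8 times
  the target, so that the mean survives the loss of this factor.\<close>

definition inc :: "('a \<Rightarrow> int) \<Rightarrow> 'a \<Rightarrow> ('a \<Rightarrow> int)" where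
  "inc x w = x(w := x w + 1)"

definition diff :: "(('a \<Rightarrow> int) \<Rightarrow> real) \<Rightarrow> ('a \<Rightarrow> int) \<Rightarrow> 'a \<Rightarrow> real" where
  "diff g x w = g (inc x w) - g x"

lemma inc_commute: "inc (inc x v) w = inc (inc x w) v"
  by (auto simp: inc_def fun_eq_iff)

locale birth_chain =
  fixes V :: "'a set" and \<pi> :: "('a \<Rightarrow> int) \<Rightarrow> 'a \<Rightarrow> real"
  assumes finite_V: "finite V"
    and rate_nonneg: "w \<in> V \<Longrightarrow> 0 \<le> \<pi> x w"
    and rate_sum: "(\<Sum>w\<in>V. \<pi> x w) = 1"
    and rate_mono: "w \<in> V \<Longrightarrow> z \<in> V \<Longrightarrow> z \<noteq> w \<Longrightarrow> \<pi> x z \<le> \<pi> (inc x w) z"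
begin

definition Q :: "(('a \<Rightarrow> int) \<Rightarrow> real) \<Rightarrow> ('a \<Rightarrow> int) \<Rightarrow> real" where
  "Q g x = (\<Sum>w\<in>V. \<pi> x w * g (inc x w))"

lemma Q_const [simp]: "Q (\<lambda>_. c) x = c"
  by (simp add: Q_def rate_sum flip: sum_distrib_right)

lemma Q_add: "Q (\<lambda>x. g x + h x) x = Q g x + Q h x"
  by (simp add: Q_def algebra_simps sum.distrib)

lemma Q_diff: "Q (\<lambda>x. g x - h x) x = Q g x - Q h x"
  by (simp add: Q_def algebra_simps sum_subtractf)

lemma Q_cmult: "Q (\<lambda>x. c * g x) x = c * Q g x"
  by (simp add: Q_def algebra_simps sum_distrib_left)

lemma Q_mono: "(\<And>y. g y \<le> h y) \<Longrightarrow> Q g x \<le> Q h x"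
  by (auto simp: Q_def intro!: sum_mono mult_left_mono rate_nonneg)

lemma Qn_const [simp]: "(Q ^^ n) (\<lambda>_. c) = (\<lambda>_. c)"
  by (induction n) (auto intro!: ext)

lemma Qn_mono: "(\<And>y. g y \<le> h y) \<Longrightarrow> (Q ^^ n) g x \<le> (Q ^^ n) h x"
  by (induction n arbitrary: x) (auto intro!: Q_mono)

lemma Qn_add: "(Q ^^ n) (\<lambda>x. g x + h x) = (\<lambda>x. (Q ^^ n) g x + (Q ^^ n) h x)"
  by (induction n) (auto intro!: ext simp: Q_add)

lemma Qn_diff: "(Q ^^ n) (\<lambda>x. g x - h x) = (\<lambda>x. (Q ^^ n) g x - (Q ^^ n) h x)"
  by (induction n) (auto intro!: ext simp: Q_diff)

lemma Qn_cmult: "(Q ^^ n) (\<lambda>x. c * g x) = (\<lambda>x. c * (Q ^^ n) g x)"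
  by (induction n) (auto intro!: ext simp: Q_cmult)

text \<open>Markov property: run \<open>m - n\<close> steps first and use the bound from wherever
  the chain is then. Because of this, only the lower tail of the number of rings matters
  later.\<close>

lemma Qn_lower:
  assumes "\<And>y. q \<le> (Q ^^ n) g y" "n \<le> m" shows "q \<le> (Q ^^ m) g x"
proof -
  have "(Q ^^ m) g = (Q ^^ (m - n)) ((Q ^^ n) g)"
    using assms(2) by (simp flip: funpow_add[unfolded o_def, THEN fun_cong] comp_apply[of "Q ^^ (m - n)"] add: funpow_add[symmetric])
  then show ?thesis
    using Qn_mono[of "\<lambda>_. q" "(Q ^^ n) g" "m - n" x] assms(1) by simp
qed

text \<open>One step of the pair formed by the chain and a second-class particle at \<open>v\<close>: the chain
  with an additional ball at \<open>v\<close> is coupled to the chain itself so that they differ by one ball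
  at all times. All weights in \<open>P\<close> are nonnegative after cancellation of the terms with
  \<open>w = v\<close>.\<close>

definition P :: "(('a \<Rightarrow> int) \<Rightarrow> 'a \<Rightarrow> real) \<Rightarrow> ('a \<Rightarrow> int) \<Rightarrow> 'a \<Rightarrow> real" where
  "P \<phi> x v = (\<Sum>w\<in>V. \<pi> x w * \<phi> (inc x w) v) + (\<Sum>w\<in>V. (\<pi> (inc x v) w - \<pi> x w) * \<phi> (inc x v) w)"

lemma P_eq:
  assumes "v \<in> V"
  shows "P \<phi> x v = (\<Sum>w\<in>V-{v}. \<pi> x w * \<phi> (inc x w) v) + \<pi> (inc x v) v * \<phi> (inc x v) v
    + (\<Sum>w\<in>V-{v}. (\<pi> (inc x v) w - \<pi> x w) * \<phi> (inc x v) w)"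
  using assms finite_V by (simp add: P_def sum.remove[of V v] algebra_simps)

lemma P_mono: "v \<in> V \<Longrightarrow> (\<And>y w. w \<in> V \<Longrightarrow> \<phi> y w \<le> \<psi> y w) \<Longrightarrow> P \<phi> x v \<le> P \<psi> x v"
  unfolding P_eq
  by (intro add_mono sum_mono mult_left_mono) (auto intro: rate_nonneg rate_mono)

lemma P_const [simp]: "P (\<lambda>_ _. c) x v = c"
  by (simp add: P_def sum_subtractf rate_sum flip: sum_distrib_right)

lemma P_add: "P (\<lambda>y w. \<phi> y w + \<psi> y w) x v = P \<phi> x v + P \<psi> x v"
  by (simp add: P_def distrib_left sum.distrib)

lemma P_cmult: "P (\<lambda>y w. c * \<phi> y w) x v = c * P \<phi> x v"
  by (simp add: P_def algebra_simps sum_distrib_left)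

lemma P_variance: "P (\<lambda>y w. (\<phi> y w - P \<phi> x v)\<^sup>2) x v = P (\<lambda>y w. (\<phi> y w)\<^sup>2) x v - (P \<phi> x v)\<^sup>2"
proof -
  have "P (\<lambda>y w. (\<phi> y w - c)\<^sup>2) x v = P (\<lambda>y w. (\<phi> y w)\<^sup>2) x v + (- 2 * c) * P \<phi> x v + c\<^sup>2" for c
  proof -
    have "(\<lambda>y w. (\<phi> y w - c)\<^sup>2) = (\<lambda>y w. ((\<phi> y w)\<^sup>2 + (- 2 * c) * \<phi> y w) + c\<^sup>2)"
      by (auto simp: fun_eq_iff power2_eq_square algebra_simps)
    then show ?thesis
      by (simp only: P_add P_cmult P_const)
  qed
  from this[of "P \<phi> x v"] show ?thesis
    by (simp add: power2_eq_square algebra_simps)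
qed

text \<open>Add and subtract the value of the chain with both balls, the second one drawn with the
  rates of \<open>x\<close>. The leftover multiple of \<open>g (inc x v)\<close> vanishes because
  both rate vectors have total mass one.\<close>

lemma diff_Q: "diff (Q g) x v = P (diff g) x v"
proof -
  have "(\<Sum>w\<in>V. (\<pi> (inc x v) w - \<pi> x w) * g (inc x v)) = 0"
    by (simp add: sum_subtractf rate_sum flip: sum_distrib_right)
  then show ?thesis
    by (simp add: diff_def P_def Q_def algebra_simps sum_subtractf sum.distrib inc_commute[of x v])
qed

text \<open>If the particle is placed where the next ball of the chain lands, then the pair consists of
  consecutive states of the chain, and its law is transported by the coupling.\<close>

lemma P_landing:
  "(\<Sum>v\<in>V. \<pi> x v * P \<phi> x v) = Q (\<lambda>y. \<Sum>v\<in>V. \<pi> y v * \<phi> y v) x"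
proof -
  have "(\<Sum>v\<in>V. \<Sum>w\<in>V. \<pi> x v * (\<pi> x w * \<phi> (inc x w) v)) = (\<Sum>v\<in>V. \<Sum>w\<in>V. \<pi> x v * (\<pi> x w * \<phi> (inc x v) w))"
    by (subst sum.swap) (simp add: mult.left_commute)
  then show ?thesis
    by (simp add: P_def Q_def algebra_simps sum_distrib_left sum.distrib sum_subtractf)
qed

section \<open>Energy of the gradient and its dissipation\<close>

definition energy :: "(('a \<Rightarrow> int) \<Rightarrow> real) \<Rightarrow> ('a \<Rightarrow> int) \<Rightarrow> real" where
  "energy g x = (\<Sum>v\<in>V. \<pi> x v * (diff g x v)\<^sup>2)"

definition dissipation :: "(('a \<Rightarrow> int) \<Rightarrow> real) \<Rightarrow> ('a \<Rightarrow> int) \<Rightarrow> real" where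
  "dissipation g x = (\<Sum>v\<in>V. \<pi> x v * P (\<lambda>y w. (diff g y w - diff (Q g) x v)\<^sup>2) x v)"

text \<open>This is the law of total variance: the gradient of \<open>Q g\<close> is the mean of the
  gradient of \<open>g\<close> under \<open>P\<close>, so the loss is the mean conditional variance,
  and \<open>P_landing\<close> identifies the averaged second moment.\<close>

lemma energy_Q: "energy (Q g) x = Q (energy g) x - dissipation g x"
proof -
  have "dissipation g x = (\<Sum>v\<in>V. \<pi> x v * P (\<lambda>y w. (diff g y w)\<^sup>2) x v) - energy (Q g) x"
    unfolding dissipation_def energy_def diff_Q P_variance by (simp add: algebra_simps sum_subtractf)
  also have "(\<Sum>v\<in>V. \<pi> x v * P (\<lambda>y w. (diff g y w)\<^sup>2) x v) = Q (energy g) x"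
    unfolding P_landing energy_def ..
  finally show ?thesis by simp
qed

lemma energy_nonneg: "0 \<le> energy g x"
  unfolding energy_def by (intro sum_nonneg mult_nonneg_nonneg rate_nonneg) auto

lemma dissipation_nonneg: "0 \<le> dissipation g x"
  unfolding dissipation_def
proof (intro sum_nonneg mult_nonneg_nonneg rate_nonneg)
  fix v assume "v \<in> V"
  then show "0 \<le> P (\<lambda>y w. (diff g y w - diff (Q g) x v)\<^sup>2) x v"
    using P_mono[of v "\<lambda>_ _. 0" "\<lambda>y w. (diff g y w - diff (Q g) x v)\<^sup>2"] by simp
qed auto

lemma energy_Qn_le: "energy ((Q ^^ n) g) x \<le> (Q ^^ n) (energy g) x"
proof (induction n arbitrary: x)
  case (Suc n)
  have "energy ((Q ^^ Suc n) g) x \<le> Q (energy ((Q ^^ n) g)) x"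
    using energy_Q[of "(Q ^^ n) g" x] dissipation_nonneg[of "(Q ^^ n) g" x] by simp
  also have "\<dots> \<le> (Q ^^ Suc n) (energy g) x"
    using Suc by (auto intro: Q_mono)
  finally show ?case .
qed auto

text \<open>Maximum principle: gradients are averaged by \<open>P\<close>, which is positive and
  preserves constants.\<close>

lemma diff_Qn_bound:
  assumes "\<And>x w. w \<in> V \<Longrightarrow> \<bar>diff g x w\<bar> \<le> c" "w \<in> V"
  shows "\<bar>diff ((Q ^^ n) g) x w\<bar> \<le> c"
  using assms(2)
proof (induction n arbitrary: x w)
  case (Suc n)
  have "diff ((Q ^^ n) g) y v \<le> c" "- c \<le> diff ((Q ^^ n) g) y v" if "v \<in> V" for y v
    using Suc.IH[OF that, of y] by auto
  then show ?case
    using P_mono[of w "diff ((Q ^^ n) g)" "\<lambda>_ _. c" x] P_mono[of w "\<lambda>_ _. - c" "diff ((Q ^^ n) g)" x] Suc.prems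
    by (simp add: diff_Q abs_le_iff minus_le_iff)
qed (use assms in auto)

text \<open>The key estimate. With \<open>\<Phi>\<close> in place of \<open>\<pi>\<close> the pairing of \<open>\<Phi>\<close> with the gradient of \<open>g\<close>
  is preserved up to a commutator. Since \<open>\<Phi>\<close> is nearly the multiple \<open>f\<close> of \<open>\<pi>\<close>, the
  coefficients of the commutator are small, and its entries are oscillations of the gradient which
  are controlled by the dissipation of the energy.\<close>

definition pairing :: "(('a \<Rightarrow> int) \<Rightarrow> 'a \<Rightarrow> real) \<Rightarrow> (('a \<Rightarrow> int) \<Rightarrow> real) \<Rightarrow> ('a \<Rightarrow> int) \<Rightarrow> real" where
  "pairing \<Phi> g x = (\<Sum>w\<in>V. \<Phi> x w * diff g x w)"

text \<open>The terms in which the particle keeps its place cancel after exchanging the two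
  summations. The coefficients sum to zero over \<open>z\<close>, since the masses of \<Phi> and
  \<pi> do not depend on the state, so an arbitrary \<open>m w\<close> can be subtracted. For \<Phi>
  = \<pi> all coefficients are zero.\<close>

lemma commutator:
  assumes "\<And>x. (\<Sum>w\<in>V. \<Phi> x w) = c"
  shows "Q (pairing \<Phi> g) x - pairing \<Phi> (Q g) x =
    (\<Sum>w\<in>V. \<Sum>z\<in>V. (\<pi> x w * (\<Phi> (inc x w) z - \<Phi> x z) - \<Phi> x w * (\<pi> (inc x w) z - \<pi> x z))
       * (diff g (inc x w) z - m w))"
proof -
  let ?u = "diff g" and ?k = "\<lambda>w z. \<pi> x w * (\<Phi> (inc x w) z - \<Phi> x z) - \<Phi> x w * (\<pi> (inc x w) z - \<pi> x z)"
  have k0: "(\<Sum>z\<in>V. ?k w z) = 0" for w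
    by (simp add: sum_subtractf assms rate_sum flip: sum_distrib_left)
  have "(\<Sum>w\<in>V. \<Sum>z\<in>V. \<Phi> x w * (\<pi> x z * ?u (inc x z) w)) = (\<Sum>w\<in>V. \<Sum>z\<in>V. \<Phi> x z * (\<pi> x w * ?u (inc x w) z))"
    by (rule sum.swap)
  moreover have "Q (pairing \<Phi> g) x = (\<Sum>w\<in>V. \<Sum>z\<in>V. \<pi> x w * (\<Phi> (inc x w) z * ?u (inc x w) z))"
    by (simp add: Q_def pairing_def sum_distrib_left)
  ultimately have "Q (pairing \<Phi> g) x - pairing \<Phi> (Q g) x = (\<Sum>w\<in>V. \<Sum>z\<in>V. ?k w z * ?u (inc x w) z)"
    by (simp add: pairing_def[of _ "Q g"] diff_Q P_def algebra_simps sum_distrib_left sum.distrib sum_subtractf)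
  also have "\<dots> = (\<Sum>w\<in>V. \<Sum>z\<in>V. ?k w z * (?u (inc x w) z - m w))"
    using k0 by (simp add: right_diff_distrib sum_subtractf flip: sum_distrib_right)
  finally show ?thesis .
qed

text \<open>The coefficients are at most 2 \<eta> times weights that \<open>P\<close> also assigns,
  so the squared oscillations are paid for by the dissipation. The first-order part keeps a factor
  \<open>pm\<close>, the maximal rate, and this small factor determines how many steps can be
  afforded.\<close>

lemma commutator_bound:
  assumes \<Phi>_sum: "\<And>x. (\<Sum>w\<in>V. \<Phi> x w) = c"
    and \<Phi>: "\<And>x w. w \<in> V \<Longrightarrow> \<bar>\<Phi> x w - f w * \<pi> x w\<bar> \<le> \<eta> * \<pi> x w"
    and d\<Phi>: "\<And>x w z. w \<in> V \<Longrightarrow> z \<in> V \<Longrightarrow> z \<noteq> w \<Longrightarrow>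
       \<bar>(\<Phi> (inc x w) z - \<Phi> x z) - f w * (\<pi> (inc x w) z - \<pi> x z)\<bar> \<le> \<eta> * (\<pi> (inc x w) z - \<pi> x z)"
    and pm: "\<And>x w. w \<in> V \<Longrightarrow> \<pi> x w \<le> pm" and \<eta>: "0 \<le> \<eta>" and s: "0 < s"
  shows "\<bar>Q (pairing \<Phi> g) x - pairing \<Phi> (Q g) x\<bar> \<le> \<eta> * (s * pm + dissipation g x / s)"
proof -
  let ?m = "\<lambda>w. diff (Q g) x w"
  let ?k = "\<lambda>w z. \<pi> x w * (\<Phi> (inc x w) z - \<Phi> x z) - \<Phi> x w * (\<pi> (inc x w) z - \<pi> x z)"
  let ?d = "\<lambda>w z. diff g (inc x w) z - ?m w"
  \<comment> \<open>These are the weights of \<open>P\<close> at \<open>x\<close>, \<open>w\<close>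
    that lead to the state \<open>inc x w\<close>. At \<open>z = w\<close> no difference is taken:
    there the terms with \<open>\<Phi> x w * \<pi> x w\<close> cancel in \<open>?k\<close>. The
    total weight is only \<open>\<pi> x w\<close>, which is the source of the factor
    \<open>pm\<close>.\<close>
  define wt where "wt w z = (if z = w then \<pi> (inc x w) w else \<pi> (inc x w) z - \<pi> x z)" for w z
  have wt_nonneg: "0 \<le> wt w z" if "w \<in> V" "z \<in> V" for w z
    using that by (auto simp: wt_def rate_nonneg rate_mono)
  have k_bound: "\<bar>?k w z\<bar> \<le> 2 * \<eta> * \<pi> x w * wt w z" if wz: "w \<in> V" "z \<in> V" for w z
  proof -
    define A where "A = (if z = w then \<Phi> (inc x w) w else \<Phi> (inc x w) z - \<Phi> x z)"
    have k: "?k w z = \<pi> x w * A - \<Phi> x w * wt w z"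
      by (auto simp: A_def wt_def algebra_simps)
    have A: "\<bar>A - f w * wt w z\<bar> \<le> \<eta> * wt w z"
      using \<Phi>[of w "inc x w"] d\<Phi>[of w z x] wz by (auto simp: A_def wt_def)
    have "?k w z = \<pi> x w * (A - f w * wt w z) - wt w z * (\<Phi> x w - f w * \<pi> x w)"
      unfolding k by (simp add: algebra_simps)
    also have "\<bar>\<dots>\<bar> \<le> \<pi> x w * (\<eta> * wt w z) + wt w z * (\<eta> * \<pi> x w)"
      using A \<Phi>[of w x] wz wt_nonneg[of w z] rate_nonneg[of w x]
      by (intro order.trans[OF abs_triangle_ineq4] add_mono)
         (auto simp: abs_mult intro!: mult_left_mono)
    finally show ?thesis by (simp add: algebra_simps)
  qed
  have wt_sum: "(\<Sum>z\<in>V. wt w z) = \<pi> x w" if "w \<in> V" for w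
  proof -
    have "(\<Sum>z\<in>V. wt w z) = \<pi> (inc x w) w + (\<Sum>z\<in>V-{w}. \<pi> (inc x w) z) - (\<Sum>z\<in>V-{w}. \<pi> x z)"
      using that finite_V by (simp add: sum.remove[of V w] wt_def sum_subtractf)
    also have "\<dots> = \<pi> x w"
      using sum.remove[OF finite_V that, of "\<pi> (inc x w)"] sum.remove[OF finite_V that, of "\<pi> x"]
      by (simp add: rate_sum)
    finally show ?thesis .
  qed
  have wt_P: "(\<Sum>z\<in>V. wt w z * (?d w z)\<^sup>2) \<le> P (\<lambda>y v. (diff g y v - ?m w)\<^sup>2) x w" if "w \<in> V" for w
  proof -
    have "(\<Sum>z\<in>V. wt w z * (?d w z)\<^sup>2) =
        \<pi> (inc x w) w * (?d w w)\<^sup>2 + (\<Sum>z\<in>V-{w}. (\<pi> (inc x w) z - \<pi> x z) * (?d w z)\<^sup>2)"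
      using that finite_V by (simp add: sum.remove[of V w] wt_def)
    moreover have "0 \<le> (\<Sum>v\<in>V-{w}. \<pi> x v * (diff g (inc x v) w - ?m w)\<^sup>2)"
      by (intro sum_nonneg mult_nonneg_nonneg rate_nonneg) auto
    ultimately show ?thesis
      using that by (simp add: P_eq)
  qed
  have amgm: "\<bar>d\<bar> \<le> (s + d\<^sup>2 / s) / 2" for d :: real
  proof -
    have "0 \<le> (\<bar>d\<bar> - s)\<^sup>2" by simp
    then have "2 * \<bar>d\<bar> * s \<le> s\<^sup>2 + d\<^sup>2" by (simp add: power2_diff algebra_simps)
    then show ?thesis using s by (simp add: field_simps power2_eq_square)
  qed
  have "\<bar>Q (pairing \<Phi> g) x - pairing \<Phi> (Q g) x\<bar> \<le> (\<Sum>w\<in>V. \<Sum>z\<in>V. \<bar>?k w z * ?d w z\<bar>)"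
    unfolding commutator[OF \<Phi>_sum, where m = ?m]
    by (rule order.trans[OF sum_abs]) (intro sum_mono sum_abs)
  also have "\<dots> \<le> (\<Sum>w\<in>V. \<Sum>z\<in>V. (2 * \<eta> * \<pi> x w * wt w z) * ((s + (?d w z)\<^sup>2 / s) / 2))"
    unfolding abs_mult using amgm k_bound
    by (intro sum_mono mult_mono) (auto intro!: mult_nonneg_nonneg \<eta> rate_nonneg wt_nonneg)
  also have "\<dots> = (\<Sum>w\<in>V. \<eta> * \<pi> x w * (s * (\<Sum>z\<in>V. wt w z) + (\<Sum>z\<in>V. wt w z * (?d w z)\<^sup>2) / s))"
    unfolding sum_distrib_left sum_divide_distrib sum.distrib[symmetric]
    by (intro sum.cong refl) (simp add: field_simps)
  also have "\<dots> \<le> (\<Sum>w\<in>V. \<eta> * \<pi> x w * (s * pm + P (\<lambda>y v. (diff g y v - ?m w)\<^sup>2) x w / s))"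
    using s pm wt_P wt_sum \<eta>
    by (intro sum_mono mult_left_mono add_mono divide_right_mono) (auto intro: mult_nonneg_nonneg rate_nonneg)
  also have "\<dots> = \<eta> * (s * pm * (\<Sum>w\<in>V. \<pi> x w) + dissipation g x / s)"
    by (simp add: dissipation_def algebra_simps sum.distrib sum_distrib_left sum_divide_distrib)
  finally show ?thesis by (simp add: rate_sum)
qed

text \<open>Summing the one-step bounds along the chain, the dissipations telescope by
  \<open>energy_Q\<close> to the total loss of energy, so they contribute once and not
  \<open>n\<close> times.\<close>

lemma pairing_Qn_lower:
  assumes \<Phi>_sum: "\<And>x. (\<Sum>w\<in>V. \<Phi> x w) = c"
    and \<Phi>: "\<And>x w. w \<in> V \<Longrightarrow> \<bar>\<Phi> x w - f w * \<pi> x w\<bar> \<le> \<eta> * \<pi> x w"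
    and d\<Phi>: "\<And>x w z. w \<in> V \<Longrightarrow> z \<in> V \<Longrightarrow> z \<noteq> w \<Longrightarrow>
       \<bar>(\<Phi> (inc x w) z - \<Phi> x z) - f w * (\<pi> (inc x w) z - \<pi> x z)\<bar> \<le> \<eta> * (\<pi> (inc x w) z - \<pi> x z)"
    and pm: "\<And>x w. w \<in> V \<Longrightarrow> \<pi> x w \<le> pm" and \<eta>: "0 \<le> \<eta>" and s: "0 < s"
  shows "(Q ^^ n) (pairing \<Phi> g) x - \<eta> * (n * s * pm + ((Q ^^ n) (energy g) x - energy ((Q ^^ n) g) x) / s)
    \<le> pairing \<Phi> ((Q ^^ n) g) x"
proof (induction n arbitrary: x)
  case (Suc n)
  let ?g = "(Q ^^ n) g"
  have *: "pairing \<Phi> (Q ?g) x \<ge> Q (pairing \<Phi> ?g) x - \<eta> * (s * pm + dissipation ?g x / s)"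
    using commutator_bound[OF \<Phi>_sum \<Phi> d\<Phi> pm \<eta> s, of ?g x] by linarith
  have lin: "(\<lambda>x. (Q ^^ n) (pairing \<Phi> g) x - \<eta> * (n * s * pm + ((Q ^^ n) (energy g) x - energy ?g x) / s))
     = (\<lambda>x. ((Q ^^ n) (pairing \<Phi> g) x - \<eta> * (n * s * pm)) - (\<eta> / s) * ((Q ^^ n) (energy g) x - energy ?g x))"
    by (simp add: algebra_simps add_divide_distrib diff_divide_distrib)
  have "Q (\<lambda>x. (Q ^^ n) (pairing \<Phi> g) x - \<eta> * (n * s * pm + ((Q ^^ n) (energy g) x - energy ?g x) / s)) x
      \<le> Q (pairing \<Phi> ?g) x"
    by (intro Q_mono Suc)
  then have "(Q ^^ Suc n) (pairing \<Phi> g) x - \<eta> * (n * s * pm) - (\<eta> / s) * ((Q ^^ Suc n) (energy g) x - Q (energy ?g) x)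
      \<le> Q (pairing \<Phi> ?g) x"
    unfolding lin Q_diff Q_cmult Q_const by simp
  moreover have "dissipation ?g x = Q (energy ?g) x - energy (Q ?g) x"
    using energy_Q[of ?g x] by simp
  note *[unfolded this]
  ultimately show ?case
    by (simp add: algebra_simps add_divide_distrib diff_divide_distrib)
qed simp

end

section \<open>Moments of the chain\<close>

context birth_chain
begin

text \<open>\<open>d\<close> is the martingale increment of \<open>h\<close> in one step; its
  variance is the energy minus the squared drift.\<close>

lemma Q_centred:
  assumes "\<And>w. w \<in> V \<Longrightarrow> \<bar>diff h x w\<bar> \<le> 1"
  defines "d \<equiv> \<lambda>w. h (inc x w) - Q h x"
  shows "(\<Sum>w\<in>V. \<pi> x w * d w) = 0"
    and "(\<Sum>w\<in>V. \<pi> x w * (d w)\<^sup>2) = energy h x - (Q h x - h x)\<^sup>2"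
    and "w \<in> V \<Longrightarrow> \<bar>d w\<bar> \<le> 2"
proof -
  have h: "h (inc x w) = h x + diff h x w" for w by (simp add: diff_def)
  have \<beta>: "(\<Sum>w\<in>V. \<pi> x w * diff h x w) = Q h x - h x"
    by (simp add: Q_def h distrib_left sum.distrib rate_sum flip: sum_distrib_right)
  have d: "d w = diff h x w - (Q h x - h x)" for w by (simp add: d_def h)
  show "(\<Sum>w\<in>V. \<pi> x w * d w) = 0"
    by (simp add: d_def right_diff_distrib sum_subtractf rate_sum Q_def flip: sum_distrib_right)
  have "(\<Sum>w\<in>V. \<pi> x w * (d w)\<^sup>2) = (\<Sum>w\<in>V. \<pi> x w * (diff h x w)\<^sup>2
      + (- 2 * (Q h x - h x)) * (\<pi> x w * diff h x w) + \<pi> x w * (Q h x - h x)\<^sup>2)"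
    unfolding d by (intro sum.cong refl) (simp add: power2_eq_square algebra_simps)
  also have "\<dots> = energy h x - 2 * (Q h x - h x) * (Q h x - h x) + (Q h x - h x)\<^sup>2"
    by (simp add: sum.distrib rate_sum \<beta> energy_def flip: sum_distrib_left sum_distrib_right)
       (simp add: algebra_simps)
  finally show "(\<Sum>w\<in>V. \<pi> x w * (d w)\<^sup>2) = energy h x - (Q h x - h x)\<^sup>2"
    by (simp add: power2_eq_square algebra_simps)
  have "\<bar>Q h x - h x\<bar> \<le> (\<Sum>w\<in>V. \<pi> x w * 1)"
    unfolding \<beta>[symmetric] using assms(1)
    by (intro order.trans[OF sum_abs] sum_mono) (auto simp: abs_mult rate_nonneg intro!: mult_left_le)
  then show "\<bar>d w\<bar> \<le> 2" if "w \<in> V"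
    using assms(1)[OF that] unfolding d by (simp add: rate_sum)
qed

lemma Q_square:
  assumes "\<And>w. w \<in> V \<Longrightarrow> \<bar>diff h x w\<bar> \<le> 1"
  shows "Q (\<lambda>y. (h y)\<^sup>2) x = (Q h x)\<^sup>2 + (energy h x - (Q h x - h x)\<^sup>2)"
proof -
  let ?d = "\<lambda>w. h (inc x w) - Q h x"
  have "Q (\<lambda>y. (h y)\<^sup>2) x = (\<Sum>w\<in>V. \<pi> x w * (Q h x)\<^sup>2 + 2 * Q h x * (\<pi> x w * ?d w) + \<pi> x w * (?d w)\<^sup>2)"
    unfolding Q_def[of "\<lambda>y. (h y)\<^sup>2"] by (intro sum.cong refl) (simp add: power2_eq_square algebra_simps)
  then show ?thesis
    using Q_centred[OF assms] by (simp add: sum.distrib rate_sum flip: sum_distrib_left sum_distrib_right)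
qed

text \<open>Expanding around the mean \<open>Q h x\<close>, the linear term vanishes and the
  quadratic one has coefficient 6. The cubic and quartic terms raise 6 only to 61/10, at the price
  of the constant 164, whose contribution is linear in the number of steps.\<close>

lemma Q_fourth:
  assumes "\<And>w. w \<in> V \<Longrightarrow> \<bar>diff h x w\<bar> \<le> 1"
  shows "Q (\<lambda>y. (h y) ^ 4) x \<le> (Q h x) ^ 4 + (61/10 * (Q h x)\<^sup>2 + 164) * (energy h x - (Q h x - h x)\<^sup>2)"
proof -
  let ?d = "\<lambda>w. h (inc x w) - Q h x"
  have pw: "(a + d) ^ 4 \<le> a ^ 4 + 4 * a ^ 3 * d + (61/10 * a\<^sup>2 + 164) * d\<^sup>2" if "\<bar>d\<bar> \<le> 2" for a d :: real
  proof -
    have d2: "d\<^sup>2 \<le> 4" using power_mono[OF that, of 2] by simp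
    have "a * d \<le> \<bar>a\<bar> * \<bar>d\<bar>" by (simp flip: abs_mult)
    also have "\<dots> \<le> \<bar>a\<bar> * 2" using that by (intro mult_left_mono) auto
    \<comment> \<open>Multiplied by 4 this gives 1/10 and 160; the bound 4 for the square of
      \<open>d\<close> completes 164.\<close>
    also have "\<dots> \<le> 1/40 * a\<^sup>2 + 40"
      using zero_le_power2[of "\<bar>a\<bar> - 40"] by (simp add: power2_diff)
    finally have "4 * (a * d) + d\<^sup>2 \<le> 1/10 * a\<^sup>2 + 164" using d2 by simp
    then have "(4 * (a * d) + d\<^sup>2) * d\<^sup>2 \<le> (1/10 * a\<^sup>2 + 164) * d\<^sup>2"
      by (rule mult_right_mono) simp
    moreover have "(a + d) ^ 4 = a ^ 4 + 4 * a ^ 3 * d + 6 * a\<^sup>2 * d\<^sup>2 + (4 * (a * d) + d\<^sup>2) * d\<^sup>2"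
      by (simp add: eval_nat_numeral algebra_simps)
    ultimately show ?thesis by (simp add: algebra_simps)
  qed
  have "Q (\<lambda>y. (h y) ^ 4) x = (\<Sum>w\<in>V. \<pi> x w * (Q h x + ?d w) ^ 4)"
    unfolding Q_def[of "\<lambda>y. (h y) ^ 4"] by simp
  also have "\<dots> \<le> (\<Sum>w\<in>V. \<pi> x w * ((Q h x) ^ 4 + 4 * (Q h x) ^ 3 * ?d w + (61/10 * (Q h x)\<^sup>2 + 164) * (?d w)\<^sup>2))"
    using Q_centred(3)[OF assms] by (intro sum_mono mult_left_mono pw rate_nonneg) auto
  also have "\<dots> = (\<Sum>w\<in>V. \<pi> x w * (Q h x) ^ 4 + 4 * (Q h x) ^ 3 * (\<pi> x w * ?d w)
      + (61/10 * (Q h x)\<^sup>2 + 164) * (\<pi> x w * (?d w)\<^sup>2))"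
    by (intro sum.cong refl) (simp add: distrib_left mult.left_commute)
  also have "\<dots> = (\<Sum>w\<in>V. \<pi> x w) * (Q h x) ^ 4 + 4 * (Q h x) ^ 3 * (\<Sum>w\<in>V. \<pi> x w * ?d w)
      + (61/10 * (Q h x)\<^sup>2 + 164) * (\<Sum>w\<in>V. \<pi> x w * (?d w)\<^sup>2)"
    by (simp only: sum.distrib sum_distrib_left sum_distrib_right)
  finally show ?thesis
    using Q_centred[OF assms] by (simp add: rate_sum)
qed

context
  fixes F :: "('a \<Rightarrow> int) \<Rightarrow> real" and n :: nat and g v :: real
  assumes F: "\<And>x w. w \<in> V \<Longrightarrow> \<bar>diff F x w\<bar> \<le> 1"
    and v_le: "\<And>j x. j < n \<Longrightarrow> v \<le> energy ((Q ^^ j) F) x - (Q ((Q ^^ j) F) x - (Q ^^ j) F x)\<^sup>2"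
    and le_g: "\<And>j x. j < n \<Longrightarrow> energy ((Q ^^ j) F) x \<le> g"
begin

text \<open>The functions \<open>(Q ^^ (j + k - i)) F\<close> evaluated along the chain form a
  martingale from \<open>(Q ^^ (j + k)) F x\<close> to \<open>(Q ^^ j) F\<close>, whose
  \<open>k\<close> conditional variances lie between \<open>v\<close> and \<open>g\<close>.\<close>

lemma second_moment:
  assumes "j + k \<le> n"
  shows "((Q ^^ (j + k)) F x)\<^sup>2 + k * v \<le> (Q ^^ k) (\<lambda>y. ((Q ^^ j) F y)\<^sup>2) x
    \<and> (Q ^^ k) (\<lambda>y. ((Q ^^ j) F y)\<^sup>2) x \<le> ((Q ^^ (j + k)) F x)\<^sup>2 + k * g"
  using assms
proof (induction k arbitrary: j)
  case (Suc k)
  let ?h = "(Q ^^ j) F"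
  let ?var = "\<lambda>y. energy ?h y - (Q ?h y - ?h y)\<^sup>2"
  have *: "j < n" "Suc j + k \<le> n" using Suc.prems by auto
  have sq: "Q (\<lambda>y. (?h y)\<^sup>2) y = ((Q ^^ Suc j) F y)\<^sup>2 + ?var y" for y
    using Q_square[of ?h y] diff_Qn_bound[of F 1] F by auto
  have var: "v \<le> ?var y" "?var y \<le> g" for y
    using v_le[OF *(1), of y] le_g[OF *(1), of y] zero_le_power2[of "Q ?h y - ?h y"] by linarith+
  have "(Q ^^ k) (\<lambda>y. ((Q ^^ Suc j) F y)\<^sup>2 + v) x \<le> (Q ^^ k) (Q (\<lambda>y. (?h y)\<^sup>2)) x"
    unfolding sq using var by (intro Qn_mono) auto
  moreover have "(Q ^^ k) (Q (\<lambda>y. (?h y)\<^sup>2)) x \<le> (Q ^^ k) (\<lambda>y. ((Q ^^ Suc j) F y)\<^sup>2 + g) x"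
    unfolding sq using var by (intro Qn_mono) auto
  ultimately show ?case
    using Suc.IH[OF *(2)] by (simp add: Qn_add funpow_swap1 algebra_simps)
qed auto

text \<open>Each step adds at most 61/10 times \<open>g\<close> times the current second moment,
  which itself grows linearly by \<open>second_moment\<close>; summing yields the term quadratic in
  \<open>k\<close>.\<close>

lemma fourth_moment:
  assumes "j + k \<le> n"
  shows "(Q ^^ k) (\<lambda>y. ((Q ^^ j) F y) ^ 4) x
    \<le> ((Q ^^ (j + k)) F x) ^ 4 + 61/10 * g * (k * ((Q ^^ (j + k)) F x)\<^sup>2 + g * k\<^sup>2 / 2) + 164 * g * k"
  using assms
proof (induction k arbitrary: j)
  case (Suc k)
  let ?h = "(Q ^^ j) F" and ?b = "(Q ^^ (j + Suc k)) F x"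
  have *: "j < n" "Suc j + k \<le> n" using Suc.prems by auto
  have g: "0 \<le> g" using le_g[OF *(1), of x] energy_nonneg[of ?h x] by linarith
  have "Q (\<lambda>y. (?h y) ^ 4) y \<le> ((Q ^^ Suc j) F y) ^ 4 + (61/10 * g * ((Q ^^ Suc j) F y)\<^sup>2 + 164 * g)" for y
  proof -
    have "Q (\<lambda>y. (?h y) ^ 4) y \<le> (Q ?h y) ^ 4 + (61/10 * (Q ?h y)\<^sup>2 + 164) * (energy ?h y - (Q ?h y - ?h y)\<^sup>2)"
      using Q_fourth[of ?h y] diff_Qn_bound[of F 1] F by auto
    also have "\<dots> \<le> (Q ?h y) ^ 4 + (61/10 * (Q ?h y)\<^sup>2 + 164) * g"
    proof (intro add_left_mono mult_left_mono)
      show "energy ?h y - (Q ?h y - ?h y)\<^sup>2 \<le> g"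
        using le_g[OF *(1), of y] zero_le_power2[of "Q ?h y - ?h y"] by linarith
    qed auto
    finally show ?thesis by (simp add: algebra_simps)
  qed
  then have "(Q ^^ k) (Q (\<lambda>y. (?h y) ^ 4)) x
      \<le> (Q ^^ k) (\<lambda>y. ((Q ^^ Suc j) F y) ^ 4 + (61/10 * g * ((Q ^^ Suc j) F y)\<^sup>2 + 164 * g)) x"
    by (intro Qn_mono)
  also have "\<dots> = (Q ^^ k) (\<lambda>y. ((Q ^^ Suc j) F y) ^ 4) x
      + 61/10 * g * (Q ^^ k) (\<lambda>y. ((Q ^^ Suc j) F y)\<^sup>2) x + 164 * g"
    by (simp only: Qn_add Qn_cmult Qn_const add.assoc)
  also have "\<dots> \<le> (?b ^ 4 + 61/10 * g * (k * ?b\<^sup>2 + g * k\<^sup>2 / 2) + 164 * g * k)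
      + 61/10 * g * (?b\<^sup>2 + k * g) + 164 * g"
    using Suc.IH[OF *(2)] second_moment[OF *(2), of x] g
    by (intro add_mono mult_left_mono) auto
  also have "\<dots> \<le> ?b ^ 4 + 61/10 * g * (Suc k * ?b\<^sup>2 + g * (Suc k)\<^sup>2 / 2) + 164 * g * Suc k"
    using g by (simp add: power2_eq_square algebra_simps add_divide_distrib)
  finally show ?case by (simp add: funpow_swap1)
qed simp

end

text \<open>The indicator has the quadratic minorant
  \<open>2 * r * (Y y - t) - r\<^sup>2 * (Y y)\<^sup>2\<close>, so positivity and linearity of the
  operator suffice.\<close>

lemma paley_zygmund:
  assumes Y: "\<And>y. 0 \<le> Y y" and "0 \<le> t" "t \<le> m" "m \<le> (Q ^^ n) Y x" "0 < m4" "(Q ^^ n) (\<lambda>y. (Y y)\<^sup>2) x \<le> m4"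
  shows "(m - t)\<^sup>2 / m4 \<le> (Q ^^ n) (\<lambda>y. of_bool (t \<le> Y y)) x"
proof -
  \<comment> \<open>The maximiser of \<open>2 * r * (m - t) - r\<^sup>2 * m4\<close>.\<close>
  define r where "r = (m - t) / m4"
  have r: "0 \<le> r" using assms by (simp add: r_def)
  have pw: "2 * r * (Y y - t) - r\<^sup>2 * (Y y)\<^sup>2 \<le> of_bool (t \<le> Y y)" for y
  proof (cases "t \<le> Y y")
    case True
    have "0 \<le> (1 - r * Y y)\<^sup>2" by simp
    then have "2 * r * Y y - r\<^sup>2 * (Y y)\<^sup>2 \<le> 1" by (simp add: power2_eq_square algebra_simps)
    moreover have "0 \<le> 2 * r * t" using r assms by simp
    ultimately have "2 * r * (Y y - t) - r\<^sup>2 * (Y y)\<^sup>2 \<le> 1" by (simp add: right_diff_distrib)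
    with True show ?thesis by simp
  next
    case False
    then have "2 * r * (Y y - t) \<le> 0" using r by (intro mult_nonneg_nonpos) auto
    moreover have "0 \<le> r\<^sup>2 * (Y y)\<^sup>2" by simp
    ultimately have "2 * r * (Y y - t) - r\<^sup>2 * (Y y)\<^sup>2 \<le> 0" by linarith
    then show ?thesis by (simp only: False of_bool_eq)
  qed
  have "(m - t)\<^sup>2 / m4 = 2 * r * (m - t) - r\<^sup>2 * m4"
    using assms by (simp add: r_def power2_eq_square field_simps)
  also have "\<dots> \<le> 2 * r * ((Q ^^ n) Y x - t) - r\<^sup>2 * (Q ^^ n) (\<lambda>y. (Y y)\<^sup>2) x"
    using assms r by (intro diff_mono mult_left_mono) auto
  also have "\<dots> = (Q ^^ n) (\<lambda>y. 2 * r * (Y y - t) - r\<^sup>2 * (Y y)\<^sup>2) x"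
    by (simp add: Qn_diff Qn_cmult)
  also have "\<dots> \<le> (Q ^^ n) (\<lambda>y. of_bool (t \<le> Y y)) x"
    by (intro Qn_mono pw)
  finally show ?thesis .
qed

text \<open>Paley-Zygmund for the square of \<open>F\<close>. Including the squared mean
  \<open>b\<^sup>2\<close> in \<open>m\<close> makes the bound uniform over starting states. The
  threshold is a quarter of 46/100 times \<open>n\<close>, hence at most \<open>m / 4\<close>, and
  (3/4)^2 / 4 = 9/64 exceeds 14/100.\<close>

lemma small_ball:
  fixes F :: "('a \<Rightarrow> int) \<Rightarrow> real"
  assumes F: "\<And>x w. w \<in> V \<Longrightarrow> \<bar>diff F x w\<bar> \<le> 1"
    and v_le: "\<And>j x. j < n \<Longrightarrow> 46/100 \<le> energy ((Q ^^ j) F) x - (Q ((Q ^^ j) F) x - (Q ^^ j) F x)\<^sup>2"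
    and le_g: "\<And>j x. j < n \<Longrightarrow> energy ((Q ^^ j) F) x \<le> 51/100"
    and n: "2000 \<le> n"
  shows "14/100 \<le> (Q ^^ n) (\<lambda>y. of_bool (115/1000 * n \<le> (F y)\<^sup>2)) x"
proof -
  define b where "b = (Q ^^ n) F x"
  define m where "m = b\<^sup>2 + 46/100 * n"
  have "m \<le> (Q ^^ n) (\<lambda>y. (F y)\<^sup>2) x"
    using second_moment[OF F v_le le_g, where n = n and j = 0 and k = n and x = x] by (simp add: m_def b_def)
  \<comment> \<open>The linear term 164 * 51/100 * n is absorbed into the square of \<open>n\<close>
    by \<open>2000 \<le> n\<close>; all coefficients then lie below those of
    \<open>4 * m\<^sup>2\<close>.\<close>
  moreover have "(Q ^^ n) (\<lambda>y. ((F y)\<^sup>2)\<^sup>2) x \<le> 4 * m\<^sup>2"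
  proof -
    have "(Q ^^ n) (\<lambda>y. (F y) ^ 4) x
        \<le> b ^ 4 + 61/10 * (51/100) * (n * b\<^sup>2 + (51/100) * (real n)\<^sup>2 / 2) + 164 * (51/100) * n"
      using fourth_moment[OF F v_le le_g, where n = n and j = 0 and k = n and x = x] by (simp add: b_def)
    moreover have "61/10 * (51/100) * (n * b\<^sup>2 + (51/100) * (real n)\<^sup>2 / 2)
        = 3111/1000 * (n * b\<^sup>2) + 158661/200000 * (real n)\<^sup>2"
      by (simp add: algebra_simps)
    moreover have "2000 * real n \<le> (real n)\<^sup>2"
      using n by (simp add: power2_eq_square)
    moreover have "0 \<le> b ^ 4" "0 \<le> n * b\<^sup>2" by auto
    moreover have "4 * m\<^sup>2 = 4 * b ^ 4 + 368/100 * (n * b\<^sup>2) + 8464/10000 * (real n)\<^sup>2"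
      by (simp add: m_def power2_eq_square eval_nat_numeral algebra_simps)
    ultimately have "(Q ^^ n) (\<lambda>y. (F y) ^ 4) x \<le> 4 * m\<^sup>2" by linarith
    then show ?thesis by (simp flip: power_mult)
  qed
  moreover have m: "0 < m" "115/1000 * n \<le> 1/4 * m"
    using n by (auto simp: m_def intro!: add_nonneg_pos)
  ultimately have "(m - 115/1000 * n)\<^sup>2 / (4 * m\<^sup>2) \<le> (Q ^^ n) (\<lambda>y. of_bool (115/1000 * n \<le> (F y)\<^sup>2)) x"
    by (intro paley_zygmund) auto
  moreover have "(3/4 * m)\<^sup>2 \<le> (m - 115/1000 * n)\<^sup>2"
    using m by (intro power_mono) auto
  then have "(3/4 * m)\<^sup>2 / (4 * m\<^sup>2) \<le> (m - 115/1000 * n)\<^sup>2 / (4 * m\<^sup>2)"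
    by (intro divide_right_mono) auto
  moreover have "(3/4 * m)\<^sup>2 / (4 * m\<^sup>2) = 9/64"
    using m by (simp add: power2_eq_square)
  ultimately show ?thesis by simp
qed

end

section \<open>The gap of the chain\<close>

lemma gap_ge: "finite V \<Longrightarrow> v \<in> V \<Longrightarrow> w \<in> V \<Longrightarrow> x w - x v \<le> gap V x"
  unfolding gap_def by (intro diff_mono Max_ge Min_le) auto

lemma gap_nonneg: "finite V \<Longrightarrow> V \<noteq> {} \<Longrightarrow> 0 \<le> gap V x"
  using gap_ge[of V _ _ x] by fastforce

lemma gap_ge_mean:
  assumes "finite V" "v \<in> V"
  shows "(\<Sum>w\<in>V. real_of_int (x w)) / card V - x v \<le> gap V x"
proof -
  have c: "0 < card V" using assms by (auto simp: card_gt_0_iff)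
  have "real_of_int (x w) \<le> x v + gap V x" if "w \<in> V" for w
    using gap_ge[OF assms(1,2) that, of x] by linarith
  then have "(\<Sum>w\<in>V. real_of_int (x w)) \<le> (\<Sum>w\<in>V. x v + real_of_int (gap V x))"
    by (intro sum_mono) auto
  also have "\<dots> = card V * (x v + real_of_int (gap V x))" by simp
  finally show ?thesis using c by (simp add: field_simps)
qed

lemma linear_statistic_le_gap:
  assumes "finite V" "V \<noteq> {}" "(\<Sum>v\<in>V. f v) = 0" "\<And>v. v \<in> V \<Longrightarrow> \<bar>f v\<bar> \<le> 1"
  shows "\<bar>\<Sum>v\<in>V. f v * real_of_int (x v)\<bar> \<le> card V * gap V x / 2"
proof -
  \<comment> \<open>The midrange is the centre that leaves deviations of at most half the gap;
    recentring is free since \<open>f\<close> sums to zero.\<close>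
  define c where "c = (real_of_int (Max (x ` V)) + Min (x ` V)) / 2"
  have "(\<Sum>v\<in>V. f v * real_of_int (x v)) = (\<Sum>v\<in>V. f v * (x v - c))"
    using assms(3) by (simp add: right_diff_distrib sum_subtractf flip: sum_distrib_right)
  also have "\<bar>\<dots>\<bar> \<le> (\<Sum>v\<in>V. \<bar>f v * (x v - c)\<bar>)" by (rule sum_abs)
  also have "\<dots> \<le> (\<Sum>v\<in>V. 1 * (gap V x / 2))"
    unfolding abs_mult
  proof (intro sum_mono mult_mono assms)
    fix v assume v: "v \<in> V"
    have "Min (x ` V) \<le> x v" "x v \<le> Max (x ` V)"
      using v assms(1) by auto
    then have "real_of_int (Min (x ` V)) \<le> x v" "real_of_int (x v) \<le> Max (x ` V)"
      by (simp_all only: of_int_le_iff)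
    then show "\<bar>x v - c\<bar> \<le> gap V x / 2"
      unfolding c_def gap_def of_int_diff by (simp add: abs_le_iff field_simps)
  qed auto
  finally show ?thesis by simp
qed

context birth_chain
begin

lemma V_nonempty: "V \<noteq> {}"
  using rate_sum by auto

lemma sum_inc: "w \<in> V \<Longrightarrow> (\<Sum>v\<in>V. inc x w v) = (\<Sum>v\<in>V. x v) + 1"
  using finite_V by (simp add: sum.remove[of V w] inc_def)

text \<open>Balls are only added, and one per step. Restricting a pointwise comparison to such
  states makes the mean height after \<open>n\<close> steps deterministic.\<close>

lemma Qn_mono_reachable:
  assumes "\<And>y. (\<Sum>v\<in>V. y v) = (\<Sum>v\<in>V. x v) + int n \<Longrightarrow> (\<And>v. x v \<le> y v) \<Longrightarrow> g y \<le> h y"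
  shows "(Q ^^ n) g x \<le> (Q ^^ n) h x"
  using assms
proof (induction n arbitrary: x)
  case (Suc n)
  have "(Q ^^ n) g (inc x w) \<le> (Q ^^ n) h (inc x w)" if w: "w \<in> V" for w
  proof (rule Suc.IH)
    fix y assume y: "(\<Sum>v\<in>V. y v) = (\<Sum>v\<in>V. inc x w v) + int n" "\<And>v. inc x w v \<le> y v"
    have "x v \<le> y v" for v using y(2)[of v] by (auto simp: inc_def split: if_splits)
    with y(1) show "g y \<le> h y" by (intro Suc.prems) (auto simp: sum_inc w)
  qed
  then have "Q ((Q ^^ n) g) x \<le> Q ((Q ^^ n) h) x"
    unfolding Q_def[of "(Q ^^ n) g"] Q_def[of "(Q ^^ n) h"]
    by (intro sum_mono mult_left_mono rate_nonneg)
  then show ?case by simp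
qed auto

text \<open>At most one landing site can flatten the profile: for two different sites, the height
  differences produced by the two landings add up to 2, so one of them is at least 1.\<close>

lemma Q_gap_positive:
  assumes pm: "\<And>w. w \<in> V \<Longrightarrow> \<pi> x w \<le> pm" and "0 \<le> pm"
  shows "1 - pm \<le> Q (\<lambda>y. of_bool (1 \<le> gap V y)) x"
proof -
  define Z where "Z = {w \<in> V. \<not> 1 \<le> gap V (inc x w)}"
  have Z: "w = w'" if "w \<in> Z" "w' \<in> Z" for w w'
  proof (rule ccontr)
    assume ne: "w \<noteq> w'"
    have "inc x w w - inc x w w' \<le> gap V (inc x w)" "inc x w' w' - inc x w' w \<le> gap V (inc x w')"
      using that finite_V by (auto intro!: gap_ge simp: Z_def)
    then show False using that ne by (auto simp: Z_def inc_def split: if_splits)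
  qed
  have "(\<Sum>w\<in>Z. \<pi> x w) \<le> pm"
  proof (cases "Z = {}")
    case False
    then obtain w where "w \<in> Z" by auto
    with Z have "Z = {w}" by auto
    with pm show ?thesis by (auto simp: Z_def)
  qed (use assms in auto)
  moreover have "Q (\<lambda>y. of_bool (1 \<le> gap V y)) x = (\<Sum>w\<in>V - Z. \<pi> x w)"
    unfolding Q_def using finite_V by (intro sum.mono_neutral_cong_right) (auto simp: Z_def)
  moreover have "(\<Sum>w\<in>V - Z. \<pi> x w) = 1 - (\<Sum>w\<in>Z. \<pi> x w)"
    using finite_V by (subst sum_diff) (auto simp: Z_def rate_sum)
  ultimately show ?thesis by linarith
qed

lemma Qn_height_le:
  assumes "v \<in> V" "\<And>x. \<pi> x v \<le> pm"
  shows "(Q ^^ n) (\<lambda>x. real_of_int (x v)) x \<le> x v + n * pm"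
proof (induction n)
  case (Suc n)
  have "Q (\<lambda>x. real_of_int (x v)) y \<le> y v + pm" for y
  proof -
    have "Q (\<lambda>x. real_of_int (x v)) y = (\<Sum>w\<in>V. \<pi> y w * y v + (if w = v then \<pi> y v else 0))"
      unfolding Q_def by (intro sum.cong) (auto simp: inc_def distrib_left)
    also have "\<dots> = y v + \<pi> y v"
      using assms(1) finite_V by (simp add: sum.distrib rate_sum flip: sum_distrib_right)
    finally show ?thesis using assms(2)[of y] by simp
  qed
  then have "(Q ^^ n) (Q (\<lambda>x. real_of_int (x v))) x \<le> (Q ^^ n) (\<lambda>y. y v + pm) x"
    by (intro Qn_mono)
  also have "\<dots> \<le> x v + n * pm + pm"
    using Suc by (simp add: Qn_add)
  finally show ?case by (simp add: funpow_swap1 algebra_simps)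
qed simp

text \<open>Among many sites whose height is not far above the mean, one is likely not to receive any
  ball while the mean increases by \<open>T\<close>; the reciprocal of the number of such sites is nearly a
  supermartingale.\<close>

lemma Qn_gap_large_of_untouched:
  fixes T M :: nat
  assumes pm: "\<And>x w. w \<in> V \<Longrightarrow> \<pi> x w \<le> 2 / card V"
    and T: "1 \<le> T" and M: "40 * M \<le> card V" "5 * exp (2 * real T) \<le> M"
  shows "8/10 \<le> (Q ^^ (T * card V)) (\<lambda>x. of_bool (T / 2 \<le> gap V x)) y"
proof -
  let ?N = "real (card V)" and ?n = "T * card V"
  have N: "0 < ?N" using finite_V V_nonempty by (simp add: card_gt_0_iff)
  define \<mu> where "\<mu> = (\<Sum>v\<in>V. real_of_int (y v)) / ?N"
  \<comment> \<open>A site of \<open>S\<close> that receives no ball ends at least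
    \<open>T / 2\<close> below the mean, which rises by exactly \<open>T\<close>.\<close>
  define S where "S = {v \<in> V. y v \<le> \<mu> + T / 2}"
  have gap_of: "\<mu> + T - x v \<le> gap V x"
    if "(\<Sum>v\<in>V. x v) = (\<Sum>v\<in>V. y v) + int ?n" "v \<in> V" for x v
  proof -
    have "(\<Sum>v\<in>V. real_of_int (x v)) = (\<Sum>v\<in>V. real_of_int (y v)) + T * ?N"
      using arg_cong[OF that(1), of real_of_int] by simp
    then have "(\<Sum>v\<in>V. real_of_int (x v)) / ?N = \<mu> + T"
      using N by (simp add: \<mu>_def add_divide_distrib)
    then show ?thesis using gap_ge_mean[OF finite_V that(2), of x] by simp
  qed
  have finS: "finite S" using finite_V by (simp add: S_def)
  show ?thesis
  proof (cases "M \<le> card S")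
    case True
    define U where "U x = {v \<in> S. x v \<le> y v}" for x
    \<comment> \<open>The added 1 keeps \<Lambda> finite and makes it equal to 1 exactly when no
      site of \<open>S\<close> is untouched, so \<open>1 - \<Lambda>\<close> is a minorant of the
      event that one remains.\<close>
    define \<Lambda> where "\<Lambda> x = 1 / (1 + real (card (U x)))" for x
    have finU: "finite (U x)" for x using finS by (simp add: U_def)
    have step: "Q \<Lambda> x \<le> (1 + 2 / ?N) * \<Lambda> x" for x
    proof -
      \<comment> \<open>With \<open>c\<close> untouched sites, losing one turns
        \<open>1 / (1 + c)\<close> into \<open>1 / c\<close>, a relative increase of
        \<open>1 / c\<close>, and this happens with probability at most 2c/N. The count cancels,
        leaving the growth factor 1 + 2/N for every state.\<close>
      have \<Lambda>_inc: "\<Lambda> (inc x w) \<le> \<Lambda> x + of_bool (w \<in> U x) * (\<Lambda> x / card (U x))" if "w \<in> V" for w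
      proof (cases "w \<in> U x")
        case True
        have "U x - {w} \<subseteq> U (inc x w)" by (auto simp: U_def inc_def)
        then have "card (U x - {w}) \<le> card (U (inc x w))" by (intro card_mono finU)
        then have c: "card (U x) \<le> 1 + card (U (inc x w))"
          using True finU by simp
        have pos: "0 < card (U x)" using True finU by (auto simp: card_gt_0_iff)
        have "\<Lambda> (inc x w) \<le> 1 / card (U x)"
          unfolding \<Lambda>_def using c pos by (intro divide_left_mono) (auto simp: of_nat_le_iff[symmetric] simp del: of_nat_le_iff)
        also have "\<dots> = \<Lambda> x + \<Lambda> x / card (U x)"
        proof -
          have frac: "1 / r = 1 / (1 + r) + 1 / (1 + r) / r" if "0 < r" for r :: real
            using that by (simp add: divide_simps)
          then show ?thesis unfolding \<Lambda>_def using pos by (intro frac) simp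
        qed
        finally show ?thesis using True by simp
      next
        case False
        have "U x \<subseteq> U (inc x w)" using False by (auto simp: U_def inc_def)
        then have "card (U x) \<le> card (U (inc x w))" by (intro card_mono finU)
        then show ?thesis using False by (simp add: \<Lambda>_def frac_le)
      qed
      have "Q \<Lambda> x \<le> (\<Sum>w\<in>V. \<pi> x w * \<Lambda> x + \<pi> x w * (of_bool (w \<in> U x) * (\<Lambda> x / card (U x))))"
        unfolding Q_def distrib_left[symmetric]
        by (intro sum_mono mult_left_mono \<Lambda>_inc rate_nonneg)
      also have "\<dots> = \<Lambda> x + (\<Sum>w\<in>U x. \<pi> x w) * (\<Lambda> x / card (U x))"
      proof -
        have "(\<Sum>w\<in>V. \<pi> x w * (of_bool (w \<in> U x) * (\<Lambda> x / card (U x)))) = (\<Sum>w\<in>U x. \<pi> x w) * (\<Lambda> x / card (U x))"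
          unfolding sum_distrib_right
          using finite_V by (intro sum.mono_neutral_cong_right) (auto simp: U_def S_def)
        moreover have "(\<Sum>w\<in>V. \<pi> x w * \<Lambda> x) = \<Lambda> x"
          by (simp add: rate_sum flip: sum_distrib_right)
        ultimately show ?thesis by (simp only: sum.distrib)
      qed
      also have "(\<Sum>w\<in>U x. \<pi> x w) \<le> card (U x) * (2 / ?N)"
        using pm by (intro sum_bounded_above[THEN order.trans] order.refl) (auto simp: U_def S_def)
      then have "\<Lambda> x + (\<Sum>w\<in>U x. \<pi> x w) * (\<Lambda> x / card (U x))
          \<le> \<Lambda> x + (card (U x) * (2 / ?N)) * (\<Lambda> x / card (U x))"
        by (intro add_left_mono mult_right_mono) (auto simp: \<Lambda>_def)
      also have "\<dots> \<le> \<Lambda> x + 2 / ?N * \<Lambda> x"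
        by (cases "card (U x) = 0") (auto simp: \<Lambda>_def)
      finally show ?thesis by (simp add: algebra_simps)
    qed
    have "(Q ^^ n) \<Lambda> y \<le> (1 + 2 / ?N) ^ n * \<Lambda> y" for n
    proof (induction n)
      case (Suc n)
      have "(Q ^^ n) (Q \<Lambda>) y \<le> (Q ^^ n) (\<lambda>x. (1 + 2 / ?N) * \<Lambda> x) y"
        by (intro Qn_mono step)
      also have "\<dots> \<le> (1 + 2 / ?N) * ((1 + 2 / ?N) ^ n * \<Lambda> y)"
        unfolding Qn_cmult using Suc by (intro mult_left_mono) auto
      finally show ?case by (simp add: funpow_swap1 algebra_simps)
    qed simp
    then have "(Q ^^ ?n) \<Lambda> y \<le> (1 + 2 / ?N) ^ ?n * \<Lambda> y" .
    also have "\<dots> \<le> exp (2 / ?N) ^ ?n * (1 / M)"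
    proof (intro mult_mono power_mono)
      have "U y = S" by (auto simp: U_def)
      moreover have "0 < real M" using M(2) by (smt (verit) exp_gt_zero)
      ultimately show "\<Lambda> y \<le> 1 / M"
        unfolding \<Lambda>_def using True by (auto intro!: divide_left_mono)
    qed (use N in \<open>auto simp: \<Lambda>_def exp_ge_add_one_self add.commute\<close>)
    also have "exp (2 / ?N) ^ ?n = exp (2 * real T)"
      using N by (simp flip: exp_of_nat_mult)
    also have "exp (2 * real T) * (1 / M) \<le> 1/5"
      using M(2) by (cases "M = 0") (auto simp: field_simps)
    finally have "8/10 \<le> (Q ^^ ?n) (\<lambda>x. 1 - \<Lambda> x) y"
      by (simp add: Qn_diff)
    also have "\<dots> \<le> (Q ^^ ?n) (\<lambda>x. of_bool (T / 2 \<le> gap V x)) y"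
    proof (rule Qn_mono_reachable)
      fix x assume x: "(\<Sum>v\<in>V. x v) = (\<Sum>v\<in>V. y v) + int ?n"
      show "1 - \<Lambda> x \<le> of_bool (T / 2 \<le> gap V x)"
      proof (cases "U x = {}")
        case False
        then obtain v where "v \<in> V" "x v \<le> y v" "y v \<le> \<mu> + T / 2" by (auto simp: U_def S_def)
        then have "T / 2 \<le> gap V x" using gap_of[OF x, of v] by simp
        then show ?thesis by (simp add: \<Lambda>_def)
      qed (simp add: \<Lambda>_def)
    qed
    finally show ?thesis .
  next
    case False
    \<comment> \<open>Fewer than one site in 40 lies in \<open>S\<close>, so more than 39 times as
      many lie at least \<open>T / 2\<close> above the mean. Balancing them needs an average deficit
      above 19 T over \<open>S\<close>.\<close>
    obtain v where v: "v \<in> V" "19 * T \<le> \<mu> - y v"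
    proof (rule ccontr)
      assume "\<not> thesis"
      with that have low: "\<mu> - y v < 19 * real T" if "v \<in> V" for v using \<open>v \<in> V\<close> by force
      have "0 = (\<Sum>v\<in>V. \<mu> - y v)"
        using N by (simp add: sum_subtractf \<mu>_def)
      also have "\<dots> = (\<Sum>v\<in>S. \<mu> - y v) + (\<Sum>v\<in>V-S. \<mu> - y v)"
        using finite_V by (subst sum.subset_diff[of S V]) (auto simp: S_def)
      also have "\<dots> \<le> card S * (19 * real T) + card (V - S) * (- (real T / 2))"
        using low by (intro add_mono sum_bounded_above) (force simp: S_def intro: less_imp_le)+
      also have "card (V - S) = card V - card S"
        using finite_V by (intro card_Diff_subset) (auto simp: S_def)
      finally have "real (card V - card S) * (T / 2) \<le> card S * (19 * real T)" by simp
      moreover have "card S < M" using False by simp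
      then have "39 * card S < card V - card S" using M(1) by linarith
      then have "39 * real (card S) < real (card V - card S)" by linarith
      then have "39 * real (card S) * (T / 2) < real (card V - card S) * (T / 2)"
        using T by (intro mult_strict_right_mono) auto
      moreover have "card S * (19 * real T) \<le> 39 * real (card S) * (T / 2)" by simp
      ultimately show False by linarith
    qed
    have "(Q ^^ ?n) (\<lambda>x. real_of_int (x v)) y \<le> y v + 2 * T"
      using Qn_height_le[of v "2 / ?N" ?n y] pm v(1) N by simp
    \<comment> \<open>Markov's inequality: the mean gain at \<open>v\<close> is at most 2 T, so it
      stays below 10 T with probability at least 8/10, and then \<open>v\<close> is still more than
      10 T below the new mean.\<close>
    then have "8/10 \<le> (Q ^^ ?n) (\<lambda>x. 1 - 1 / (10 * T) * (real_of_int (x v) - y v)) y"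
      unfolding Qn_diff Qn_cmult Qn_const using T by (simp add: field_simps)
    also have "\<dots> \<le> (Q ^^ ?n) (\<lambda>x. of_bool (T / 2 \<le> gap V x)) y"
    proof (rule Qn_mono_reachable)
      fix x assume x: "(\<Sum>v\<in>V. x v) = (\<Sum>v\<in>V. y v) + int ?n" "\<And>v. y v \<le> x v"
      show "1 - 1 / (10 * T) * (real_of_int (x v) - y v) \<le> of_bool (T / 2 \<le> gap V x)"
      proof (cases "real_of_int (x v) - y v < 10 * T")
        case True
        then have "T / 2 \<le> gap V x" using gap_of[OF x(1) v(1)] v(2) by linarith
        moreover have "0 \<le> 1 / (10 * T) * (real_of_int (x v) - y v)"
          using x(2)[of v] by (intro mult_nonneg_nonneg) auto
        ultimately show ?thesis by simp
      next
        case False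
        then have "1 - 1 / (10 * T) * (real_of_int (x v) - y v) \<le> 0" using T by (simp add: field_simps)
        then show ?thesis by (rule order.trans) simp
      qed
    qed
    finally show ?thesis .
  qed
qed

end

section \<open>Rules on graphs\<close>

definition landing ::
    "('a set \<Rightarrow> 'a \<times> 'a) \<Rightarrow> ('a set \<Rightarrow> int \<Rightarrow> real) \<Rightarrow> 'a set \<Rightarrow> ('a \<Rightarrow> int) \<Rightarrow> 'a \<Rightarrow> real" where
  "landing ori p e x w = (let (u, v) = ori e; q = p e (x u - x v) in
     if w = u then q else if w = v then 1 - q else 0)"

text \<open>The next edge to ring is uniform among all edges, so the weight 1 gives the law of the
  next landing site. Edge weights \<phi> give the perturbed rates \<Phi> of the pairing.\<close>

definition weighted_rate where
  "weighted_rate G ori p \<phi> x w = (\<Sum>e\<in>edges G. \<phi> e * landing ori p e x w) / card (edges G)"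

definition rate where
  "rate G ori p = weighted_rate G ori p (\<lambda>_. 1)"

locale rule_on_graph =
  fixes G :: "'a ugraph" and ori :: "'a set \<Rightarrow> 'a \<times> 'a" and p :: "'a set \<Rightarrow> int \<Rightarrow> real"
  assumes graph: "finite_simple_graph G" and nonempty: "edges G \<noteq> {}"
    and rule: "endpoint_local_monotone_rule G ori p"
begin

abbreviation "V \<equiv> verts G"
abbreviation "E \<equiv> edges G"

lemma finite_verts: "finite V"
  using graph by (simp add: finite_simple_graph_def)

lemma finite_edges: "finite E"
proof (rule finite_subset)
  show "E \<subseteq> Pow V" using graph by (auto simp: finite_simple_graph_def)
qed (use finite_verts in simp)

lemma card_edges_pos: "0 < card E"
  using finite_edges nonempty by (simp add: card_gt_0_iff)

lemma edge_cases:
  assumes "e \<in> E"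
  obtains u v where "ori e = (u, v)" "e = {u, v}" "u \<noteq> v" "u \<in> V" "v \<in> V"
proof -
  obtain u v where uv: "ori e = (u, v)" by (cases "ori e")
  have "e = {u, v}" using rule assms uv by (auto simp: endpoint_local_monotone_rule_def)
  moreover have "card e = 2" "e \<subseteq> V" using graph assms by (auto simp: finite_simple_graph_def)
  ultimately show ?thesis using that[of u v] uv by (cases "u = v") auto
qed

lemma p_bounds: "e \<in> E \<Longrightarrow> 0 \<le> p e d" "e \<in> E \<Longrightarrow> p e d \<le> 1"
  and p_antimono: "e \<in> E \<Longrightarrow> d \<le> d' \<Longrightarrow> p e d' \<le> p e d"
  using rule by (auto simp: endpoint_local_monotone_rule_def antimono_def)

lemma landing_nonneg: "e \<in> E \<Longrightarrow> 0 \<le> landing ori p e x w"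
  by (auto simp: landing_def p_bounds Let_def split: prod.split)

lemma landing_le_1: "e \<in> E \<Longrightarrow> landing ori p e x w \<le> 1"
  by (auto simp: landing_def p_bounds Let_def split: prod.split)

lemma landing_outside: "e \<in> E \<Longrightarrow> w \<notin> e \<Longrightarrow> landing ori p e x w = 0"
  by (erule edge_cases) (auto simp: landing_def)

lemma sum_landing:
  assumes "e \<in> E" "ori e = (u, v)"
  shows "(\<Sum>w\<in>V. landing ori p e x w * h w) = p e (x u - x v) * h u + (1 - p e (x u - x v)) * h v"
proof -
  obtain u' v' where "ori e = (u', v')" "e = {u', v'}" "u' \<noteq> v'" "u' \<in> V" "v' \<in> V"
    by (rule edge_cases[OF assms(1)])
  with assms(2) have uv: "e = {u, v}" "u \<noteq> v" "u \<in> V" "v \<in> V" by auto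
  have "(\<Sum>w\<in>V. landing ori p e x w * h w) = (\<Sum>w\<in>{u, v}. landing ori p e x w * h w)"
    using uv assms finite_verts by (intro sum.mono_neutral_right) (auto simp: landing_outside)
  then show ?thesis
    using uv assms by (simp add: landing_def)
qed

lemma sum_landing_1: "e \<in> E \<Longrightarrow> (\<Sum>w\<in>V. landing ori p e x w) = 1"
  using sum_landing[of e _ _ x "\<lambda>_. 1"] by (cases "ori e") auto

text \<open>An extra ball at one endpoint moves the load difference in the direction that favours
  the other endpoint. Here the monotonicity of the rule enters.\<close>

lemma landing_mono:
  assumes "e \<in> E" "z \<noteq> w"
  shows "landing ori p e x z \<le> landing ori p e (inc x w) z"
proof -
  obtain u v where uv: "ori e = (u, v)" by (cases "ori e")
  have "p e (x u - x v) \<le> p e (x u - (x v + 1))" "p e (x u + 1 - x v) \<le> p e (x u - x v)"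
    using assms(1) by (auto intro: p_antimono)
  then show ?thesis
    using assms(2) by (auto simp: landing_def uv inc_def Let_def)
qed

lemma landing_mono_inside:
  "e \<in> E \<Longrightarrow> z \<noteq> w \<Longrightarrow> w \<notin> e \<Longrightarrow> landing ori p e (inc x w) z = landing ori p e x z"
  by (erule edge_cases) (auto simp: landing_def inc_def)

text \<open>Every ring places exactly one ball, so the mass is the same in all states, which is what
  \<open>commutator\<close> asks of \<Phi>.\<close>

lemma weighted_rate_sum: "(\<Sum>w\<in>V. weighted_rate G ori p \<phi> x w) = (\<Sum>e\<in>E. \<phi> e) / card E"
proof -
  have "(\<Sum>w\<in>V. \<Sum>e\<in>E. \<phi> e * landing ori p e x w) = (\<Sum>e\<in>E. \<Sum>w\<in>V. \<phi> e * landing ori p e x w)"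
    by (rule sum.swap)
  then show ?thesis
    by (simp add: weighted_rate_def sum_landing_1 flip: sum_divide_distrib sum_distrib_left)
qed

sublocale birth_chain V "rate G ori p"
proof
  show "finite V" by (rule finite_verts)
  show "0 \<le> rate G ori p x w" for x w
    by (auto simp: rate_def weighted_rate_def intro!: divide_nonneg_nonneg sum_nonneg landing_nonneg)
  show "(\<Sum>w\<in>V. rate G ori p x w) = 1" for x
    using card_edges_pos by (simp add: rate_def weighted_rate_sum)
  show "rate G ori p x z \<le> rate G ori p (inc x w) z" if "z \<noteq> w" for x z w
    using that by (auto simp: rate_def weighted_rate_def intro!: divide_right_mono sum_mono landing_mono)
qed

lemma rate_le: "rate G ori p x w \<le> card {e \<in> E. w \<in> e} / card E"
proof -
  have "(\<Sum>e\<in>E. landing ori p e x w) \<le> (\<Sum>e\<in>E. of_bool (w \<in> e))"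
    by (intro sum_mono) (auto simp: landing_le_1 landing_outside)
  also have "\<dots> = card {e \<in> E. w \<in> e}"
    using finite_edges by (simp add: Int_def)
  finally show ?thesis
    by (simp add: rate_def weighted_rate_def divide_right_mono)
qed

lemma sum_rate: "(\<Sum>w\<in>V. weighted_rate G ori p \<phi> x w * h w) = (\<Sum>e\<in>E. \<phi> e * (\<Sum>w\<in>V. landing ori p e x w * h w)) / card E"
proof -
  have "(\<Sum>w\<in>V. weighted_rate G ori p \<phi> x w * h w) = (\<Sum>w\<in>V. \<Sum>e\<in>E. \<phi> e * (landing ori p e x w * h w)) / card E"
    by (simp add: weighted_rate_def sum_divide_distrib sum_distrib_right mult.assoc)
  also have "(\<Sum>w\<in>V. \<Sum>e\<in>E. \<phi> e * (landing ori p e x w * h w)) = (\<Sum>e\<in>E. \<Sum>w\<in>V. \<phi> e * (landing ori p e x w * h w))"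
    by (rule sum.swap)
  finally show ?thesis by (simp add: sum_distrib_left)
qed

text \<open>A ball can land at \<open>w\<close> only through edges at \<open>w\<close>, and an extra
  ball at \<open>w\<close> changes only the landing laws of edges at \<open>w\<close>. On these
  edges \<phi> is within \<eta> of \<open>f w\<close>, and the remaining factors are
  nonnegative.\<close>

lemma weighted_rate_close:
  assumes "\<And>e w. e \<in> E \<Longrightarrow> w \<in> e \<Longrightarrow> \<bar>\<phi> e - f w\<bar> \<le> \<eta>"
  shows "\<bar>weighted_rate G ori p \<phi> x w - f w * rate G ori p x w\<bar> \<le> \<eta> * rate G ori p x w"
    and "z \<noteq> w \<Longrightarrow> \<bar>(weighted_rate G ori p \<phi> (inc x w) z - weighted_rate G ori p \<phi> x z)
      - f w * (rate G ori p (inc x w) z - rate G ori p x z)\<bar> \<le> \<eta> * (rate G ori p (inc x w) z - rate G ori p x z)"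
proof -
  have *: "\<bar>(\<Sum>e\<in>E. (\<phi> e - c) * l e) / card E\<bar> \<le> \<eta> * ((\<Sum>e\<in>E. l e) / card E)"
    if "\<And>e. e \<in> E \<Longrightarrow> \<bar>(\<phi> e - c) * l e\<bar> \<le> \<eta> * l e" for c and l :: "'a set \<Rightarrow> real"
  proof -
    have "\<bar>\<Sum>e\<in>E. (\<phi> e - c) * l e\<bar> \<le> (\<Sum>e\<in>E. \<eta> * l e)"
      using that by (intro order.trans[OF sum_abs] sum_mono) auto
    then show ?thesis using card_edges_pos
      by (simp add: abs_divide divide_right_mono flip: sum_distrib_left)
  qed
  show "\<bar>weighted_rate G ori p \<phi> x w - f w * rate G ori p x w\<bar> \<le> \<eta> * rate G ori p x w"
  proof -
    have "\<bar>(\<phi> e - f w) * landing ori p e x w\<bar> \<le> \<eta> * landing ori p e x w" if "e \<in> E" for e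
      using assms[OF that, of w] landing_nonneg[OF that, of x w] landing_outside[OF that, of w x]
      by (cases "w \<in> e") (auto simp: abs_mult intro!: mult_right_mono)
    from *[OF this] show ?thesis
      by (simp add: rate_def weighted_rate_def left_diff_distrib sum_subtractf diff_divide_distrib flip: sum_distrib_left)
  qed
  show "\<bar>(weighted_rate G ori p \<phi> (inc x w) z - weighted_rate G ori p \<phi> x z)
      - f w * (rate G ori p (inc x w) z - rate G ori p x z)\<bar> \<le> \<eta> * (rate G ori p (inc x w) z - rate G ori p x z)"
    if "z \<noteq> w"
  proof -
    let ?l = "\<lambda>e. landing ori p e (inc x w) z - landing ori p e x z"
    have "\<bar>(\<phi> e - f w) * ?l e\<bar> \<le> \<eta> * ?l e" if "e \<in> E" for e
      using assms[OF that, of w] landing_mono[OF that \<open>z \<noteq> w\<close>, of x] landing_mono_inside[OF that \<open>z \<noteq> w\<close>, of x]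
      by (cases "w \<in> e") (auto simp: abs_mult intro!: mult_right_mono)
    from *[OF this] show ?thesis
      by (simp add: rate_def weighted_rate_def algebra_simps sum_subtractf sum.distrib diff_divide_distrib add_divide_distrib flip: sum_distrib_left)
  qed
qed

text \<open>The pairing starts near 1/2, is almost conserved, and bounds the energy from below by
  completing a square. The normalisation \<open>sum2\<close> makes the initial energy close to 1/2
  for every rule, because \<open>f\<close> hardly varies along an edge.\<close>

lemma linear_statistic_spread:
  fixes f :: "'a \<Rightarrow> real" and s pm \<eta> :: real
  assumes pm: "\<And>x w. w \<in> V \<Longrightarrow> rate G ori p x w \<le> pm"
    and f1: "\<And>v. v \<in> V \<Longrightarrow> \<bar>f v\<bar> \<le> 1"
    and lip: "\<And>u v. {u, v} \<in> E \<Longrightarrow> \<bar>f u - f v\<bar> \<le> 2 * \<eta>"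
    and sum0: "(\<Sum>e\<in>E. \<Sum>w\<in>e. f w) = 0"
    and sum2: "(\<Sum>e\<in>E. \<Sum>w\<in>e. (f w)\<^sup>2) = card E"
    and \<eta>: "0 \<le> \<eta>" "\<eta> \<le> 1/1000" and s: "0 < s" "\<eta> * (n * s * pm + 51/100 / s) \<le> 16/1000" and n: "2000 \<le> n"
  shows "14/100 \<le> (Q ^^ n) (\<lambda>y. of_bool (115/1000 * n \<le> (\<Sum>v\<in>V. f v * real_of_int (y v))\<^sup>2)) x"
proof -
  define F :: "('a \<Rightarrow> int) \<Rightarrow> real" where "F = (\<lambda>y. \<Sum>v\<in>V. f v * real_of_int (y v))"
  let ?m = "real (card E)"
  \<comment> \<open>The mean over the two endpoints differs from both values by half of the
    Lipschitz bound, that is by \<eta>, and has total zero by \<open>sum0\<close>.\<close>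
  define \<phi> where "\<phi> = (\<lambda>e. (\<Sum>w\<in>e. f w) / 2)"
  define a where "a = (\<lambda>e. (\<Sum>w\<in>e. (f w)\<^sup>2) / 2)"
  define \<Phi> where "\<Phi> = weighted_rate G ori p \<phi>"
  have m: "0 < ?m" using card_edges_pos by simp
  have diffF: "diff F y w = f w" if "w \<in> V" for y w
  proof -
    have "F (inc y w) = (\<Sum>v\<in>V. f v * real_of_int (y v) + (if v = w then f w else 0))"
      unfolding F_def by (intro sum.cong) (auto simp: inc_def algebra_simps)
    then show ?thesis
      using that finite_verts by (simp add: diff_def F_def sum.distrib)
  qed
  have edge: "\<bar>\<phi> e - f w\<bar> \<le> \<eta>" "a e - \<eta> - \<eta>\<^sup>2 \<le> \<phi> e * f w" "(f w)\<^sup>2 \<le> a e + 2 * \<eta>" "(\<phi> e)\<^sup>2 \<le> a e"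
    if e: "e \<in> E" "w \<in> e" for e w
  proof -
    obtain u' v' where uv: "e = {u', v'}" "u' \<noteq> v'" "u' \<in> V" "v' \<in> V"
      by (rule edge_cases[OF e(1)])
    define v where "v = (if w = u' then v' else u')"
    have v: "e = {w, v}" "w \<noteq> v" "w \<in> V" "v \<in> V"
      using uv e(2) by (auto simp: v_def)
    define \<delta> where "\<delta> = (f w - f v) / 2"
    have \<delta>: "\<bar>\<delta>\<bar> \<le> \<eta>" using lip[of w v] e v by (auto simp: \<delta>_def)
    have \<phi>e: "\<phi> e = (f w + f v) / 2" and ae: "a e = ((f w)\<^sup>2 + (f v)\<^sup>2) / 2"
      using v by (simp_all add: \<phi>_def a_def)
    have \<phi>1: "\<bar>\<phi> e\<bar> \<le> 1" using f1[OF v(3)] f1[OF v(4)] by (auto simp: \<phi>e abs_le_iff)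
    have fw: "f w = \<phi> e + \<delta>" and a': "a e = (\<phi> e)\<^sup>2 + \<delta>\<^sup>2"
      by (simp_all add: \<phi>e ae \<delta>_def power2_eq_square field_simps)
    have \<delta>2: "\<delta>\<^sup>2 \<le> \<eta>\<^sup>2" using \<delta> by (metis abs_le_square_iff abs_of_nonneg \<eta>(1))
    have \<phi>\<delta>: "\<bar>\<phi> e * \<delta>\<bar> \<le> \<eta>"
      using mult_mono[OF \<phi>1 \<delta>] by (simp add: abs_mult)
    show "\<bar>\<phi> e - f w\<bar> \<le> \<eta>" using \<delta> by (simp add: fw)
    show "a e - \<eta> - \<eta>\<^sup>2 \<le> \<phi> e * f w"
      using \<delta>2 \<phi>\<delta> by (simp add: fw a' algebra_simps power2_eq_square)
    show "(f w)\<^sup>2 \<le> a e + 2 * \<eta>"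
      using \<phi>\<delta> by (simp add: fw a' algebra_simps power2_eq_square)
    show "(\<phi> e)\<^sup>2 \<le> a e" by (simp add: a')
  qed
  have sum_a: "(\<Sum>e\<in>E. a e) = ?m / 2" and sum_\<phi>: "(\<Sum>e\<in>E. \<phi> e) = 0"
    using sum0 sum2 by (simp_all add: a_def \<phi>_def flip: sum_divide_distrib)
  have rate1: "(\<Sum>w\<in>V. rate G ori p y w * h w) = (\<Sum>e\<in>E. \<Sum>w\<in>V. landing ori p e y w * h w) / ?m" for y h
    unfolding rate_def sum_rate by simp
  have avg: "c e \<le> (\<Sum>w\<in>V. landing ori p e y w * h w)"
    if "e \<in> E" "\<And>w. w \<in> e \<Longrightarrow> c e \<le> h w" for c e h y
  proof -
    have "(\<Sum>w\<in>V. landing ori p e y w * c e) \<le> (\<Sum>w\<in>V. landing ori p e y w * h w)"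
      using that landing_nonneg[OF that(1)] landing_outside[OF that(1)]
      by (intro sum_mono) (metis mult_left_mono mult_zero_left order_refl)
    then show ?thesis using that by (simp add: sum_landing_1 flip: sum_distrib_right)
  qed
  have energy_F: "energy F y \<le> 51/100" for y
  proof -
    have "(\<Sum>w\<in>V. landing ori p e y w * (f w)\<^sup>2) \<le> a e + 2 * \<eta>" if "e \<in> E" for e
    proof -
      have "- (a e + 2 * \<eta>) \<le> - (f w)\<^sup>2" if "w \<in> e" for w
        using edge(3)[OF \<open>e \<in> E\<close> that] by simp
      from avg[of e "\<lambda>e. - (a e + 2 * \<eta>)" "\<lambda>w. - (f w)\<^sup>2" y, OF that this]
      show ?thesis by (simp add: sum_negf)
    qed
    then have "energy F y \<le> (\<Sum>e\<in>E. a e + 2 * \<eta>) / ?m"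
      unfolding energy_def using m by (simp add: diffF rate1 divide_right_mono sum_mono)
    also have "\<dots> = 1/2 + 2 * \<eta>" using m by (simp add: sum.distrib sum_a add_divide_distrib)
    finally show ?thesis using \<eta> by simp
  qed
  have pairing_F: "1/2 - \<eta> - \<eta>\<^sup>2 \<le> pairing \<Phi> F y" for y
  proof -
    have "a e - \<eta> - \<eta>\<^sup>2 \<le> \<phi> e * (\<Sum>w\<in>V. landing ori p e y w * f w)" if "e \<in> E" for e
      using avg[of e "\<lambda>e. a e - \<eta> - \<eta>\<^sup>2" "\<lambda>w. \<phi> e * f w" y] edge(2) that
      by (simp add: sum_distrib_left mult.left_commute)
    then have "(\<Sum>e\<in>E. a e - \<eta> - \<eta>\<^sup>2) / ?m \<le> pairing \<Phi> F y"
      unfolding pairing_def \<Phi>_def using m by (simp add: diffF sum_rate divide_right_mono sum_mono)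
    moreover have "(\<Sum>e\<in>E. a e - \<eta> - \<eta>\<^sup>2) / ?m = 1/2 - \<eta> - \<eta>\<^sup>2"
      using m by (simp add: sum_subtractf sum_a diff_divide_distrib)
    ultimately show ?thesis by simp
  qed
  \<comment> \<open>Expand the nonnegative sum of squares of \<open>\<phi> e - diff h y w\<close>.
    This turns a lower bound on the pairing into one on the energy with no loss when the gradient
    equals \<phi>.\<close>
  have pairing_le: "2 * pairing \<Phi> h y \<le> 1/2 + energy h y" for h y
  proof -
    have "2 * (\<phi> e * (\<Sum>w\<in>V. landing ori p e y w * diff h y w))
        \<le> a e + (\<Sum>w\<in>V. landing ori p e y w * (diff h y w)\<^sup>2)" if e: "e \<in> E" for e
    proof -
      obtain w0 where "w0 \<in> e" using edge_cases[OF e] by auto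
      then have \<phi>a: "(\<phi> e)\<^sup>2 \<le> a e" by (rule edge(4)[OF e])
      have "0 \<le> (\<Sum>w\<in>V. landing ori p e y w * (\<phi> e - diff h y w)\<^sup>2)"
        by (intro sum_nonneg mult_nonneg_nonneg landing_nonneg e) auto
      also have "\<dots> = (\<phi> e)\<^sup>2 * (\<Sum>w\<in>V. landing ori p e y w) - 2 * (\<phi> e * (\<Sum>w\<in>V. landing ori p e y w * diff h y w))
         + (\<Sum>w\<in>V. landing ori p e y w * (diff h y w)\<^sup>2)"
        by (simp add: power2_diff algebra_simps sum.distrib sum_subtractf sum_distrib_left)
      finally show ?thesis using \<phi>a e by (simp add: sum_landing_1)
    qed
    then have "(\<Sum>e\<in>E. 2 * (\<phi> e * (\<Sum>w\<in>V. landing ori p e y w * diff h y w))) / ?m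
      \<le> (\<Sum>e\<in>E. a e + (\<Sum>w\<in>V. landing ori p e y w * (diff h y w)\<^sup>2)) / ?m"
      by (intro divide_right_mono sum_mono) auto
    then show ?thesis
      unfolding pairing_def \<Phi>_def energy_def sum_rate rate1 using m
      by (simp add: sum.distrib sum_a add_divide_distrib flip: sum_distrib_left)
  qed
  have \<Phi>_sum: "(\<Sum>w\<in>V. \<Phi> y w) = 0" for y
    unfolding \<Phi>_def weighted_rate_sum by (simp add: sum_\<phi>)
  have close: "\<bar>\<Phi> y w - f w * rate G ori p y w\<bar> \<le> \<eta> * rate G ori p y w"
    "z \<noteq> w \<Longrightarrow> \<bar>(\<Phi> (inc y w) z - \<Phi> y z) - f w * (rate G ori p (inc y w) z - rate G ori p y z)\<bar>
      \<le> \<eta> * (rate G ori p (inc y w) z - rate G ori p y z)" for y w z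
    unfolding \<Phi>_def using weighted_rate_close[of \<phi> f \<eta>] edge(1) by auto
  \<comment> \<open>The drift is the mass of \<open>f w * rate G ori p y w\<close>; subtracting
    \<Phi>, of mass zero, leaves only the error \<eta>.\<close>
  have drift: "\<bar>Q F y - F y\<bar> \<le> \<eta>" for y
  proof -
    have "Q F y - F y = (\<Sum>w\<in>V. rate G ori p y w * diff F y w)"
      by (simp add: Q_def diff_def right_diff_distrib sum_subtractf rate_sum flip: sum_distrib_right)
    also have "\<dots> = (\<Sum>w\<in>V. f w * rate G ori p y w - \<Phi> y w)"
      by (simp add: diffF \<Phi>_sum sum_subtractf mult.commute)
    also have "\<bar>\<dots>\<bar> \<le> (\<Sum>w\<in>V. \<eta> * rate G ori p y w)"
      using close(1)[of y] by (intro order.trans[OF sum_abs] sum_mono) (auto simp: abs_minus_commute)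
    finally show ?thesis by (simp add: rate_sum flip: sum_distrib_left)
  qed
  show ?thesis
    unfolding F_def[symmetric, THEN fun_cong]
  proof (rule small_ball)
    show "\<bar>diff F y w\<bar> \<le> 1" if "w \<in> V" for y w
      using that f1 by (simp add: diffF)
    fix j y assume j: "j < n"
    have en: "(Q ^^ j) (energy F) y \<le> 51/100"
      using Qn_mono[of "energy F" "\<lambda>_. 51/100" j y] energy_F by simp
    show "energy ((Q ^^ j) F) y \<le> 51/100"
      using energy_Qn_le[of j F y] en by linarith
    have "\<eta> * (j * s * pm + ((Q ^^ j) (energy F) y - energy ((Q ^^ j) F) y) / s)
        \<le> \<eta> * (n * s * pm + 51/100 / s)"
    proof (intro mult_left_mono add_mono divide_right_mono mult_right_mono)
      obtain w where "w \<in> V" using V_nonempty by auto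
      then show "0 \<le> pm" using pm[of w y] rate_nonneg[of w y] by linarith
      show "(Q ^^ j) (energy F) y - energy ((Q ^^ j) F) y \<le> 51/100"
        using en energy_nonneg[of "(Q ^^ j) F" y] by linarith
    qed (use j s \<eta> in auto)
    moreover have "(Q ^^ j) (pairing \<Phi> F) y - \<eta> * (j * s * pm + ((Q ^^ j) (energy F) y - energy ((Q ^^ j) F) y) / s)
        \<le> pairing \<Phi> ((Q ^^ j) F) y"
      by (rule pairing_Qn_lower[where f = f and c = 0]) (use \<Phi>_sum close pm \<eta>(1) s(1) in auto)
    ultimately have "(Q ^^ j) (pairing \<Phi> F) y - 16/1000 \<le> pairing \<Phi> ((Q ^^ j) F) y"
      using s(2) by linarith
    moreover have "1/2 - \<eta> - \<eta>\<^sup>2 \<le> (Q ^^ j) (pairing \<Phi> F) y"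
      using Qn_mono[of "\<lambda>_. 1/2 - \<eta> - \<eta>\<^sup>2" "pairing \<Phi> F" j y] pairing_F by simp
    moreover have \<eta>2: "\<eta>\<^sup>2 \<le> 1/1000"
      using power_mono[OF \<eta>(2) \<eta>(1), of 2] by (simp add: power2_eq_square)
    \<comment> \<open>Twice the pairing minus 1/2: with \<eta> and its square at most 1/1000 this is
      at least 1/2 - 4/1000 - 32/1000.\<close>
    ultimately have low: "463/1000 \<le> energy ((Q ^^ j) F) y"
      using pairing_le[of "(Q ^^ j) F" y] \<eta> by linarith
    have "Q ((Q ^^ j) F) y - (Q ^^ j) F y = (Q ^^ j) (\<lambda>y. Q F y - F y) y"
      by (simp add: Qn_diff funpow_swap1)
    moreover have "(Q ^^ j) (\<lambda>y. Q F y - F y) y \<le> \<eta>" "- \<eta> \<le> (Q ^^ j) (\<lambda>y. Q F y - F y) y"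
    proof -
      have "Q F y - F y \<le> \<eta>" "- \<eta> \<le> Q F y - F y" for y
        using drift[of y] by linarith+
      then show "(Q ^^ j) (\<lambda>y. Q F y - F y) y \<le> \<eta>" "- \<eta> \<le> (Q ^^ j) (\<lambda>y. Q F y - F y) y"
        using Qn_mono[of "\<lambda>y. Q F y - F y" "\<lambda>_. \<eta>" j y] Qn_mono[of "\<lambda>_. - \<eta>" "\<lambda>y. Q F y - F y" j y]
        by simp_all
    qed
    ultimately have "(Q ((Q ^^ j) F) y - (Q ^^ j) F y)\<^sup>2 \<le> \<eta>\<^sup>2"
      by (intro abs_le_square_iff[THEN iffD1]) (auto simp: abs_le_iff)
    then show "46/100 \<le> energy ((Q ^^ j) F) y - (Q ((Q ^^ j) F) y - (Q ^^ j) F y)\<^sup>2"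
      using low \<eta>2 by linarith
  qed (rule n)
qed

end

section \<open>Rules on the torus\<close>

lemma card_incident_cycle:
  assumes "3 \<le> n" "i < n"
  shows "card {e \<in> edges (cycle_graph n). i \<in> e} = 2"
proof -
  define j where "j = (if i = 0 then n - 1 else i - 1)"
  have j: "j < n" "Suc j mod n = i" using assms by (auto simp: j_def)
  have uniq: "k = j" if "k < n" "Suc k mod n = i" for k
    using that j assms by (metis mod_Suc mod_less nat.inject nat.distinct(1))
  have Suc_mod: "Suc i mod n = (if Suc i = n then 0 else Suc i)" using assms by auto
  have "{e \<in> edges (cycle_graph n). i \<in> e} = (\<lambda>k. {k, Suc k mod n}) ` {k. k < n \<and> (i = k \<or> i = Suc k mod n)}"
    by (auto simp: cycle_graph_def)
  also have "{k. k < n \<and> (i = k \<or> i = Suc k mod n)} = {i, j}"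
    using assms(2) j uniq by blast
  also have "(\<lambda>k. {k, Suc k mod n}) ` {i, j} = {{i, Suc i mod n}, {j, i}}"
    using j by simp
  finally have "{e \<in> edges (cycle_graph n). i \<in> e} = {{i, Suc i mod n}, {j, i}}" .
  moreover have "{i, Suc i mod n} \<noteq> {j, i}"
    using assms by (auto simp: doubleton_eq_iff Suc_mod j_def split: if_splits)
  ultimately show ?thesis by simp
qed

lemma finite_edges_graph: "finite_simple_graph G \<Longrightarrow> finite (edges G)"
  by (rule finite_subset[of _ "Pow (verts G)"]) (auto simp: finite_simple_graph_def)

text \<open>The edges at \<open>(i, j)\<close> are the products \<open>e \<times> {j}\<close> and
  \<open>{i} \<times> e\<close>; the two families are disjoint because the first projection of
  \<open>e \<times> {j}\<close> has two elements.\<close>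

lemma card_incident_product:
  assumes G: "finite_simple_graph G" and H: "finite_simple_graph H" and ij: "i \<in> verts G" "j \<in> verts H"
  shows "card {e \<in> edges (G \<box> H). (i, j) \<in> e} =
    card {e \<in> edges G. i \<in> e} + card {e \<in> edges H. j \<in> e}"
proof -
  let ?A = "{e \<in> edges G. i \<in> e}" and ?B = "{e \<in> edges H. j \<in> e}"
  let ?f = "\<lambda>e. e \<times> {j}" and ?g = "\<lambda>e. {i} \<times> e"
  have G2: "\<exists>a a'. e = {a, a'}" "card e = 2" "e \<subseteq> verts G" if "e \<in> edges G" for e
    using G that unfolding finite_simple_graph_def card_2_iff by blast+
  have H2: "\<exists>b b'. e = {b, b'}" "card e = 2" "e \<subseteq> verts H" if "e \<in> edges H" for e
    using H that unfolding finite_simple_graph_def card_2_iff by blast+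
  have "{e \<in> edges (G \<box> H). (i, j) \<in> e} = ?f ` ?A \<union> ?g ` ?B"
  proof (intro set_eqI iffI)
    fix e assume "e \<in> {e \<in> edges (G \<box> H). (i, j) \<in> e}"
    then consider a a' b where "e = {(a, b), (a', b)}" "{a, a'} \<in> edges G" "(i, j) \<in> e"
      | a b b' where "e = {(a, b), (a, b')}" "{b, b'} \<in> edges H" "(i, j) \<in> e"
      by (auto simp: cartesian_product_def)
    then show "e \<in> ?f ` ?A \<union> ?g ` ?B"
    proof cases
      case 1
      then have "e = ?f {a, a'}" "i \<in> {a, a'}" by auto
      then show ?thesis using 1(2) by blast
    next
      case 2
      then have "e = ?g {b, b'}" "j \<in> {b, b'}" by auto
      then show ?thesis using 2(2) by blast
    qed
  next
    fix e assume "e \<in> ?f ` ?A \<union> ?g ` ?B"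
    then show "e \<in> {e \<in> edges (G \<box> H). (i, j) \<in> e}"
    proof (elim UnE imageE)
      fix c assume c: "e = ?f c" "c \<in> ?A"
      then obtain a a' where "c = {a, a'}" using G2(1) by blast
      then have "e = {(a, j), (a', j)}" "{a, a'} \<in> edges G" "(i, j) \<in> e" using c by auto
      then show ?thesis using ij unfolding cartesian_product_def by auto
    next
      fix c assume c: "e = ?g c" "c \<in> ?B"
      then obtain b b' where "c = {b, b'}" using H2(1) by blast
      then have "e = {(i, b), (i, b')}" "{b, b'} \<in> edges H" "(i, j) \<in> e" using c by auto
      then show ?thesis using ij unfolding cartesian_product_def by auto
    qed
  qed
  moreover have "?f ` ?A \<inter> ?g ` ?B = {}"
  proof -
    have "e \<times> {j} \<noteq> {i} \<times> e'" if "e \<in> edges G" "e' \<in> edges H" for e e'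
    proof
      assume "e \<times> {j} = {i} \<times> e'"
      then have "fst ` (e \<times> {j}) \<subseteq> {i}" by auto
      then have "e \<subseteq> {i}" by auto
      then show False using G2(2)[OF that(1)] by (metis card_mono finite.emptyI finite.insertI is_singletonI is_singleton_altdef numeral_le_one_iff semiring_norm(69))
    qed
    then show ?thesis by auto
  qed
  moreover have "finite ?A" "finite ?B"
    using G H by (simp_all add: finite_edges_graph)
  moreover have "inj_on ?f ?A" "inj_on ?g ?B"
    by (auto simp: inj_on_def)
  ultimately show ?thesis
    by (simp add: card_Un_disjoint card_image)
qed

lemma verts_torus: "verts (cycle_graph L \<box> cycle_graph K) = {..<L} \<times> {..<K}"
  by (simp add: cartesian_product_def cycle_graph_def)

lemma finite_simple_graph_cycle:
  assumes "3 \<le> n" shows "finite_simple_graph (cycle_graph n)"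
proof -
  have "Suc i mod n \<noteq> i" if "i < n" for i
    using that assms by (cases "Suc i = n") auto
  then show ?thesis
    using assms by (auto simp: finite_simple_graph_def cycle_graph_def card_insert_if) (metis)
qed

lemma card_incident_torus:
  assumes "3 \<le> L" "3 \<le> K" "w \<in> verts (cycle_graph L \<box> cycle_graph K)"
  shows "card {e \<in> edges (cycle_graph L \<box> cycle_graph K). w \<in> e} = 4"
  using assms card_incident_product[OF finite_simple_graph_cycle finite_simple_graph_cycle, of L K "fst w" "snd w"]
  by (auto simp: verts_torus card_incident_cycle) (auto simp: cycle_graph_def card_incident_cycle[unfolded cycle_graph_def])

text \<open>Double counting: every vertex has degree 4. It turns the edge normalisations of
  \<open>linear_statistic_spread\<close> into vertex sums.\<close>

lemma sum_edges_torus: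
  fixes h :: "nat \<times> nat \<Rightarrow> real"
  assumes "3 \<le> L" "3 \<le> K"
  defines "G \<equiv> cycle_graph L \<box> cycle_graph K"
  shows "(\<Sum>e\<in>edges G. \<Sum>w\<in>e. h w) = 4 * (\<Sum>w\<in>verts G. h w)"
proof -
  have G: "finite_simple_graph G" using assms finite_simple_graph_torus by simp
  then have fin: "finite (verts G)" "finite (edges G)"
    by (auto simp: finite_simple_graph_def finite_edges_graph)
  have "(\<Sum>e\<in>edges G. \<Sum>w\<in>e. h w) = (\<Sum>e\<in>edges G. \<Sum>w\<in>verts G. of_bool (w \<in> e) * h w)"
  proof (rule sum.cong[OF refl])
    fix e assume "e \<in> edges G"
    then have "e \<subseteq> verts G" using G by (auto simp: finite_simple_graph_def)
    then show "(\<Sum>w\<in>e. h w) = (\<Sum>w\<in>verts G. of_bool (w \<in> e) * h w)"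
      using fin by (intro sum.mono_neutral_cong_left) auto
  qed
  also have "\<dots> = (\<Sum>w\<in>verts G. \<Sum>e\<in>edges G. of_bool (w \<in> e) * h w)"
    by (rule sum.swap)
  also have "\<dots> = (\<Sum>w\<in>verts G. 4 * h w)"
  proof (intro sum.cong refl)
    fix w assume w: "w \<in> verts G"
    have "(\<Sum>e\<in>edges G. of_bool (w \<in> e) :: real) = card {e \<in> edges G. w \<in> e}"
      using fin by (simp add: Int_def)
    then show "(\<Sum>e\<in>edges G. of_bool (w \<in> e) * h w) = 4 * h w"
      using card_incident_torus[OF assms(1,2)] w by (simp add: G_def flip: sum_distrib_right)
  qed
  finally show ?thesis by (simp add: sum_distrib_left)
qed

lemma card_edges_torus:
  assumes "3 \<le> L" "3 \<le> K"
  shows "card (edges (cycle_graph L \<box> cycle_graph K)) = 2 * (L * K)"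
proof -
  let ?G = "cycle_graph L \<box> cycle_graph K"
  have "(\<Sum>e\<in>edges ?G. \<Sum>w\<in>e. 1::real) = (\<Sum>e\<in>edges ?G. 2)"
    using finite_simple_graph_torus[OF assms] by (intro sum.cong) (auto simp: finite_simple_graph_def)
  then have "real (2 * card (edges ?G)) = real (4 * (L * K))"
    using sum_edges_torus[OF assms, of "\<lambda>_. 1"] by (simp add: verts_torus)
  then show ?thesis by (simp only: of_nat_eq_iff)
qed

section \<open>The cosine mode and the size of the constant\<close>

lemma sum_cos_roots:
  fixes k L :: nat
  assumes "0 < k" "k < L"
  shows "(\<Sum>i<L. cos (2 * pi * k * i / L)) = 0"
proof -
  define \<theta> where "\<theta> = 2 * pi * k / L"
  \<comment> \<open>The factor \<open>2 * sin (\<theta> / 2)\<close> makes the sum telescope; the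
    endpoints agree after a full period.\<close>
  have "2 * sin (\<theta> / 2) * (\<Sum>i<n. cos (\<theta> * i)) = sin (\<theta> * n - \<theta> / 2) + sin (\<theta> / 2)" for n :: nat
  proof (induction n)
    case (Suc n)
    have "2 * sin (\<theta> / 2) * cos (\<theta> * n) = sin (\<theta> * n + \<theta> / 2) - sin (\<theta> * n - \<theta> / 2)"
      by (simp add: sin_add sin_diff)
    moreover have "\<theta> * Suc n - \<theta> / 2 = \<theta> * n + \<theta> / 2" by (simp add: algebra_simps)
    ultimately show ?case using Suc by (simp add: distrib_left add.commute)
  qed simp
  from this[of L] have "2 * sin (\<theta> / 2) * (\<Sum>i<L. cos (\<theta> * i)) = sin (\<theta> * L - \<theta> / 2) + sin (\<theta> / 2)" .
  also have "\<theta> * L = of_int (int k) * (2 * pi)" using assms by (simp add: \<theta>_def)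
  also have "sin (of_int (int k) * (2 * pi) - \<theta> / 2) = - sin (\<theta> / 2)"
    using sin.plus_of_int[of "- (\<theta> / 2)" "int k"] by (simp add: algebra_simps)
  finally have "sin (\<theta> / 2) * (\<Sum>i<L. cos (\<theta> * i)) = 0" by simp
  moreover have "0 < sin (\<theta> / 2)"
    using assms by (intro sin_gt_zero) (auto simp: \<theta>_def field_simps)
  ultimately show ?thesis by (simp add: \<theta>_def)
qed

lemma cos_diff_le: "\<bar>cos x - cos y\<bar> \<le> \<bar>x - y :: real\<bar>"
proof -
  have "\<bar>cos x - cos y\<bar> = 2 * \<bar>sin ((x + y) / 2)\<bar> * \<bar>sin ((y - x) / 2)\<bar>"
    by (simp add: cos_diff_cos abs_mult)
  also have "\<dots> \<le> 2 * 1 * \<bar>(y - x) / 2\<bar>"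
    by (intro mult_mono abs_sin_le_one abs_sin_x_le_abs_x) auto
  finally show ?thesis by simp
qed

lemma c2_bounds: "0 < c2" "c2 \<le> 1 / 23040"
proof -
  have s: "6 \<le> sqrt 42" by (rule real_le_rsqrt) simp
  have "1280 * 3 * 6 \<le> 1280 * pi * sqrt 42"
    using s pi_gt3 by (intro mult_mono) auto
  then show "c2 \<le> 1 / 23040" unfolding c2_def by (intro divide_left_mono) auto
  show "0 < c2" unfolding c2_def by simp
qed


locale rule_on_torus = rule_on_graph G ori p
  for G :: "(nat \<times> nat) ugraph" and ori p +
  fixes K L :: nat
  assumes K: "3 \<le> K" and KL: "K \<le> L" and torus: "G = cycle_graph L \<box> cycle_graph K"
begin

lemma L: "3 \<le> L"
  using K KL by simp

lemma card_verts: "card V = L * K"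
  by (simp add: torus verts_torus)

lemma rate_le_torus: "w \<in> V \<Longrightarrow> rate G ori p x w \<le> 2 / card V"
  using rate_le[of x w] card_incident_torus[OF L K, of w] card_edges_torus[OF L K] card_verts
  by (simp add: torus mult.commute)

text \<open>The mode depends on the long coordinate only. An edge in that direction changes the
  angle by \<open>2 * pi / L\<close>, hence \<eta> = \<open>pi / L\<close>, and the other edges do
  not change it. The threshold rises from 115/1000 to 46/100 because the gap controls
  \<open>F\<close> with a factor 1/2.\<close>

lemma torus_mode_spread:
  assumes n: "2000 \<le> n" "n \<le> real L ^ 3 * K / 1000000" and L: "5000 \<le> L"
  shows "14/100 \<le> (Q ^^ n) (\<lambda>y. of_bool (46/100 * n \<le> (card V * gap V y)\<^sup>2)) x"
proof -
  define f :: "nat \<times> nat \<Rightarrow> real" where "f = (\<lambda>v. cos (2 * pi * real (fst v) / L))"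
  have f1: "\<bar>f v\<bar> \<le> 1" for v by (simp add: f_def)
  have sum_f: "(\<Sum>v\<in>V. f v) = 0"
  proof -
    have "(\<Sum>v\<in>V. f v) = (\<Sum>i<L. \<Sum>j<K. cos (2 * pi * i / L))"
      unfolding torus verts_torus f_def sum.cartesian_product by (intro sum.cong) auto
    then show ?thesis
      using sum_cos_roots[of 1 L] L by (simp flip: sum_distrib_left)
  qed
  have sum_f2: "(\<Sum>v\<in>V. (f v)\<^sup>2) = L * K / 2"
  proof -
    have "(f (i, j))\<^sup>2 = 1/2 + 1/2 * cos (2 * pi * real 2 * i / L)" for i j
      using cos_double_cos[of "2 * pi * i / L"] by (simp add: f_def mult.assoc diff_divide_distrib)
    then have "(\<Sum>v\<in>V. (f v)\<^sup>2) = (\<Sum>i<L. \<Sum>j<K. 1/2 + 1/2 * cos (2 * pi * real 2 * i / L))"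
      unfolding torus verts_torus sum.cartesian_product by (intro sum.cong) auto
    also have "\<dots> = K * (L / 2 + 1/2 * (\<Sum>i<L. cos (2 * pi * real 2 * i / L)))"
      by (simp add: sum.distrib algebra_simps flip: sum_distrib_left sum_divide_distrib)
    finally show ?thesis
      using sum_cos_roots[of 2 L] L by simp
  qed
  have lip: "\<bar>f u - f v\<bar> \<le> 2 * (pi / L)" if "{u, v} \<in> E" for u v
  proof -
    have step: "\<bar>cos (2 * pi * (Suc i mod L) / L) - cos (2 * pi * i / L)\<bar> \<le> 2 * pi / L" if "i < L" for i
    proof -
      have "cos (2 * pi * (Suc i mod L) / L) = cos (2 * pi * Suc i / L)"
        using that by (cases "Suc i = L") auto
      moreover have "\<bar>2 * pi * Suc i / L - 2 * pi * i / L\<bar> = 2 * pi / L"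
        using that by (simp add: field_simps)
      ultimately show ?thesis
        using cos_diff_le[of "2 * pi * Suc i / L" "2 * pi * i / L"] by simp
    qed
    from that consider a a' b where "{u, v} = {(a, b), (a', b)}" "{a, a'} \<in> edges (cycle_graph L)"
      | a b b' where "{u, v} = {(a, b), (a, b')}"
      by (auto simp: torus cartesian_product_def)
    then show ?thesis
    proof cases
      case 1
      then obtain i where "i < L" "{a, a'} = {i, Suc i mod L}" by (auto simp: cycle_graph_def)
      then have "\<bar>cos (2 * pi * a / L) - cos (2 * pi * a' / L)\<bar> \<le> 2 * pi / L"
        using step[of i] by (auto simp: doubleton_eq_iff abs_minus_commute)
      then show ?thesis
        using 1(1) by (auto simp: doubleton_eq_iff f_def abs_minus_commute)
    next
      case 2
      then show ?thesis by (auto simp: doubleton_eq_iff f_def)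
    qed
  qed
  have "14/100 \<le> (Q ^^ n) (\<lambda>y. of_bool (115/1000 * n \<le> (\<Sum>v\<in>V. f v * real_of_int (y v))\<^sup>2)) x"
  proof (rule linear_statistic_spread[where pm = "2 / card V" and \<eta> = "pi / L" and s = "500 / L"])
    show "(\<Sum>e\<in>E. \<Sum>w\<in>e. f w) = 0"
      unfolding torus using sum_edges_torus[OF _ K, of L f] sum_f L by (simp add: torus)
    show "(\<Sum>e\<in>E. \<Sum>w\<in>e. (f w)\<^sup>2) = card E"
      unfolding torus using sum_edges_torus[OF _ K, of L "\<lambda>w. (f w)\<^sup>2"] sum_f2 L card_edges_torus[OF _ K, of L]
      by (simp add: torus mult.commute)
    show "pi / L \<le> 1/1000" using L pi_less_4 by (simp add: field_simps)
    \<comment> \<open>With s = 500/L the two costs nearly balance: at most L/1000 from the steps and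
      102 L/100000 from the dissipation. Times \<open>pi / L\<close> they stay below
      16/1000.\<close>
    have "n * (500 / L) * (2 / card V) \<le> (real L ^ 3 * K / 1000000) * (500 / L) * (2 / card V)"
      using n(2) by (intro mult_right_mono) auto
    also have "\<dots> = L / 1000"
      using L K by (simp add: card_verts power3_eq_cube)
    finally have "n * (500 / L) * (2 / card V) + 51/100 / (500 / L) \<le> 202/100000 * L"
      by simp
    then have "pi / L * (n * (500 / L) * (2 / card V) + 51/100 / (500 / L)) \<le> pi / L * (202/100000 * L)"
      by (intro mult_left_mono) auto
    also have "\<dots> \<le> 16/1000" using L pi_less_4 by simp
    finally show "pi / L * (n * (500 / L) * (2 / card V) + 51/100 / (500 / L)) \<le> 16/1000" .
  qed (use f1 lip rate_le_torus n L in auto)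
  also have "\<dots> \<le> (Q ^^ n) (\<lambda>y. of_bool (46/100 * n \<le> (card V * gap V y)\<^sup>2)) x"
  proof (intro Qn_mono)
    fix y
    have "\<bar>\<Sum>v\<in>V. f v * real_of_int (y v)\<bar> \<le> card V * gap V y / 2"
      using sum_f f1 finite_V V_nonempty by (intro linear_statistic_le_gap) auto
    then have "(\<Sum>v\<in>V. f v * real_of_int (y v))\<^sup>2 \<le> (card V * gap V y / 2)\<^sup>2"
      by (intro abs_le_square_iff[THEN iffD1]) linarith
    then show "of_bool (115/1000 * n \<le> (\<Sum>v\<in>V. f v * real_of_int (y v))\<^sup>2)
        \<le> (of_bool (46/100 * n \<le> (card V * gap V y)\<^sup>2) :: real)"
      by (auto simp: power_divide)
  qed
  finally show ?thesis .
qed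

text \<open>The bound on \<open>n\<close> is a quarter of the mean number of rings at time L^2, and
  49/50 is the Poisson loss to come. The level \<open>b\<close> lies above \<open>a\<close> because
  the mean is estimated by \<open>b\<close> times the probability. For \<open>a\<close> at most 1/2
  a single ball suffices; otherwise the larger of L/K and ln K is huge and its mechanism
  applies.\<close>

lemma gap_spread:
  defines "a \<equiv> c2 * sqrt (real L / K + ln K)"
  shows "\<exists>(n::nat) (b::real) q. n \<le> real L ^ 3 * K / 2 \<and> a \<le> b \<and> a \<le> b * (q * (49/50)) \<and> 1/8 \<le> q * (49/50)
    \<and> (\<forall>x. q \<le> (Q ^^ n) (\<lambda>y. of_bool (b \<le> gap V y)) x)"
proof -
  let ?R = "real L / K + ln K"
  have lnK: "0 \<le> ln K" and R: "0 \<le> ?R" using K by auto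
  have L0: "0 < real L" "0 < real K" "real K \<le> real L" "3 \<le> real K" using K KL by auto
  have LK: "9 \<le> real L * K"
    using mult_mono[of 3 "real L" 3 "real K"] L0 by simp
  have a0: "0 \<le> a" using c2_bounds R by (simp add: a_def)
  have a_le: "a \<le> sqrt ?R / 23040"
    using mult_right_mono[OF c2_bounds(2), of "sqrt ?R"] R by (simp add: a_def)
  have a2: "a\<^sup>2 \<le> ?R / 23040\<^sup>2"
    using power_mono[OF a_le a0, of 2] R by (simp add: power_divide)
  consider "a \<le> 1/2" | "1/2 < a" "ln K \<le> L / K" | "1/2 < a" "L / K < ln K" by linarith
  then show ?thesis
  proof cases
    case 1
    have "7/9 \<le> (Q ^^ 1) (\<lambda>y. of_bool (1 \<le> gap V y)) x" for x
    proof -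
      have "2 / card V \<le> 2/9" using LK unfolding card_verts by (intro divide_left_mono) auto
      then show ?thesis
        using Q_gap_positive[of x "2 / card V"] rate_le_torus by simp
    qed
    then have *: "\<forall>x. 7/9 \<le> (Q ^^ 1) (\<lambda>y. of_bool (1 \<le> real_of_int (gap V y))) x" by simp
    have "1 \<le> real L ^ 3 * K / 2"
    proof -
      have "1 \<le> (real L)\<^sup>2" using L0 by simp
      then have "9 * 1 \<le> (real L * K) * (real L)\<^sup>2" using LK by (intro mult_mono) auto
      then show ?thesis by (simp add: power2_eq_square power3_eq_cube mult_ac)
    qed
    then show ?thesis
      using 1 * by (intro exI[of _ "1::nat"] exI[of _ "1::real"] exI[of _ "7/9::real"]) auto
  next
    case 2
    \<comment> \<open>Since \<open>a\<close> exceeds 1/2 and its square is at most 2 (L/K) /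
      23040^2, L/K is at least 23040^2 / 8, above 60000000. So all rounding errors below are
      harmless.\<close>
    have "(1/2)\<^sup>2 \<le> a\<^sup>2" using 2(1) by (intro power_mono) auto
    then have "60000000 \<le> real L / K" using a2 2(2) by (simp add: power2_eq_square)
    then have "60000000 * real K \<le> L" using L0 by (simp add: field_simps)
    then have L8: "100000000 \<le> real L" using L0 by simp
    define n where "n = nat \<lfloor>real L ^ 3 * K / 1000000\<rfloor>"
    have n1: "real n \<le> real L ^ 3 * K / 1000000" unfolding n_def by (intro of_nat_floor) simp
    have n2: "real L ^ 3 * K / 1000000 - 1 \<le> real n" unfolding n_def by linarith
    have big: "1000000000000000000000000 \<le> real L ^ 3 * K"
      using mult_mono[OF power_mono[OF L8, of 3], of 1 "real K"] L0 by simp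
    have n3: "99/100 * (real L ^ 3 * K / 1000000) \<le> real n" using n2 big by simp
    have "14/100 \<le> (Q ^^ n) (\<lambda>y. of_bool (8 * a \<le> gap V y)) x" for x
    proof -
      have "14/100 \<le> (Q ^^ n) (\<lambda>y. of_bool (46/100 * n \<le> (card V * gap V y)\<^sup>2)) x"
      proof (rule torus_mode_spread)
        have "2000 \<le> real n" using n3 big by linarith
        then show "2000 \<le> n" by linarith
        have "5000 \<le> real L" using L8 by simp
        then show "5000 \<le> L" by linarith
      qed (rule n1)
      also have "\<dots> \<le> (Q ^^ n) (\<lambda>y. of_bool (8 * a \<le> gap V y)) x"
      proof (intro Qn_mono)
        fix y
        have g0: "0 \<le> gap V y" using finite_V V_nonempty by (rule gap_nonneg)
        have "8 * a \<le> gap V y" if "46/100 * n \<le> (card V * gap V y)\<^sup>2"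
        proof -
          have "(8 * a)\<^sup>2 * (real L * K)\<^sup>2 \<le> (64 * (2 * (L / K) / 23040\<^sup>2)) * (real L * K)\<^sup>2"
            using a2 2(2) by (intro mult_right_mono) (auto simp: power_mult_distrib)
          also have "\<dots> = 128 / 23040\<^sup>2 * (real L ^ 3 * K)"
            using L0 by (simp add: power2_eq_square power3_eq_cube)
          also have "\<dots> \<le> 46/100 * (99/100 * (real L ^ 3 * K / 1000000))"
            using L0 by (simp add: field_simps)
          also have "\<dots> \<le> 46/100 * n" by (intro mult_left_mono n3) simp
          also have "\<dots> \<le> (real_of_int (gap V y))\<^sup>2 * (real L * K)\<^sup>2"
            using that by (simp add: card_verts power_mult_distrib mult.commute)
          finally have "(8 * a)\<^sup>2 \<le> (real_of_int (gap V y))\<^sup>2"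
            using L0 by (subst (asm) mult_le_cancel_right) simp
          moreover have "0 \<le> real_of_int (gap V y)" using g0 by simp
          ultimately show ?thesis by (rule power2_le_imp_le)
        qed
        then show "of_bool (46/100 * n \<le> (card V * gap V y)\<^sup>2) \<le> (of_bool (8 * a \<le> gap V y) :: real)"
          by auto
      qed
      finally show ?thesis .
    qed
    moreover have "real n \<le> real L ^ 3 * K / 2" using n1 big by linarith
    ultimately show ?thesis
      using a0 by (intro exI[of _ n] exI[of _ "8 * a"] exI[of _ "14/100::real"]) auto
  next
    case 3
    have "(1/2)\<^sup>2 \<le> a\<^sup>2" using 3(1) by (intro power_mono) auto
    then have lnK_big: "60000000 \<le> ln K" using a2 3(2) by (simp add: power2_eq_square)
    have "ln (real K) \<le> K" using ln_le_minus_one[of "real K"] L0 by linarith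
    then have Kbig: "60000000 \<le> real K" using lnK_big by linarith
    \<comment> \<open>Half of \<open>T\<close> must reach 8 times \<open>a\<close>. The number
      \<open>K\<close> serves as \<open>M\<close>: it is at most a fortieth of all sites, and it
      exceeds 5 exp (2 T) as \<open>T\<close> is a tiny multiple of ln K.\<close>
    define T where "T = nat \<lceil>16 * a\<rceil>"
    have T: "16 * a \<le> T" "T \<le> 16 * a + 1" "1 \<le> T"
      using 3(1) unfolding T_def by linarith+
    have "sqrt ?R \<le> 2 * ln K"
    proof (rule real_le_lsqrt)
      have "1 * (2 * ln (real K)) \<le> (2 * ln K) * (2 * ln K)"
        using lnK_big by (intro mult_right_mono) auto
      then show "?R \<le> (2 * ln K)\<^sup>2" using 3(2) by (simp add: power2_eq_square)
    qed (use lnK in simp)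
    then have aln: "a \<le> ln K / 11520" using a_le by simp
    have "5 * exp (2 * real T) \<le> K"
    proof -
      have "ln 5 \<le> (4::real)" using ln_le_minus_one[of "5::real"] by simp
      then have "ln 5 + 2 * real T \<le> ln K" using T(2) aln lnK_big by linarith
      then have "exp (ln 5 + 2 * real T) \<le> exp (ln (real K))" by simp
      then show ?thesis using L0 by (simp add: exp_add)
    qed
    moreover have "40 * K \<le> card V" using Kbig L0 by (simp add: card_verts)
    ultimately have U: "8/10 \<le> (Q ^^ (T * card V)) (\<lambda>y. of_bool (T / 2 \<le> gap V y)) x" for x
      using rate_le_torus T(3) by (intro Qn_gap_large_of_untouched) auto
    have "8/10 \<le> (Q ^^ (T * card V)) (\<lambda>y. of_bool (8 * a \<le> gap V y)) x" for x
    proof -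
      have "(Q ^^ (T * card V)) (\<lambda>y. of_bool (T / 2 \<le> gap V y)) x \<le> (Q ^^ (T * card V)) (\<lambda>y. of_bool (8 * a \<le> gap V y)) x"
        using T(1) by (intro Qn_mono) auto
      with U[of x] show ?thesis by linarith
    qed
    moreover have "real (T * card V) \<le> real L ^ 3 * K / 2"
    proof -
      have "real T \<le> real L" using T(2) aln \<open>ln (real K) \<le> K\<close> L0 lnK_big by linarith
      also have "2 * real L \<le> real L * real L" using L0 by (intro mult_right_mono) auto
      finally have "real T \<le> real L * real L / 2" by simp
      then have "real T * (real L * K) \<le> (real L * real L / 2) * (real L * K)"
        using L0 by (intro mult_right_mono) auto
      then show ?thesis by (simp add: card_verts power3_eq_cube mult_ac)
    qed
    ultimately show ?thesis
      using a0 by (intro exI[of _ "T * card V"] exI[of _ "8 * a"] exI[of _ "8/10::real"]) auto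
  qed
qed

end

section \<open>Waiting times and marks\<close>

text \<open>A coordinate may be replaced by an independent copy. One ring can thus be integrated out
  with all others fixed, without splitting the index set each time.\<close>

lemma nn_integral_PiM_resample:
  assumes M: "\<And>j. j \<in> I \<Longrightarrow> prob_space (M j)" and i: "i \<in> I"
    and f [measurable]: "f \<in> borel_measurable (PiM I M)"
  shows "(\<integral>\<^sup>+x. f x \<partial>PiM I M) = (\<integral>\<^sup>+x. \<integral>\<^sup>+y. f (x(i := y)) \<partial>M i \<partial>PiM I M)"
proof -
  let ?J = "I - {i}"
  have I: "insert i ?J = I" using i by auto
  interpret Mi: prob_space "M i" using M i by auto
  interpret J: prob_space "PiM ?J M" using M by (intro prob_space_PiM) auto
  interpret pair_sigma_finite "M i" "PiM ?J M" ..
  have upd [measurable]: "(\<lambda>(x, X). X(i := x)) \<in> measurable (M i \<Otimes>\<^sub>M PiM ?J M) (PiM I M)"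
    using measurable_compose[OF measurable_pair_swap' measurable_add_dim[of i ?J M]] I
    by (simp add: split_beta')
  have split: "(\<integral>\<^sup>+x. g x \<partial>PiM I M) = (\<integral>\<^sup>+X. \<integral>\<^sup>+x. g (X(i := x)) \<partial>M i \<partial>PiM ?J M)"
    if [measurable]: "g \<in> borel_measurable (PiM I M)" for g
  proof -
    have "PiM I M = distr (M i \<Otimes>\<^sub>M PiM ?J M) (PiM I M) (\<lambda>(x, X). X(i := x))"
      using distr_pair_PiM_eq_PiM[of ?J M i] M i unfolding I by simp
    then have "(\<integral>\<^sup>+x. g x \<partial>PiM I M) = (\<integral>\<^sup>+x. g x \<partial>distr (M i \<Otimes>\<^sub>M PiM ?J M) (PiM I M) (\<lambda>(x, X). X(i := x)))"
      by simp
    also have "\<dots> = (\<integral>\<^sup>+z. g (case z of (x, X) \<Rightarrow> X(i := x)) \<partial>(M i \<Otimes>\<^sub>M PiM ?J M))"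
      by (intro nn_integral_distr) auto
    also have "\<dots> = (\<integral>\<^sup>+X. \<integral>\<^sup>+x. g (X(i := x)) \<partial>M i \<partial>PiM ?J M)"
      by (subst nn_integral_snd[symmetric]) auto
    finally show ?thesis .
  qed
  have upd2 [measurable]: "(\<lambda>(X, y). X(i := y)) \<in> measurable (PiM I M \<Otimes>\<^sub>M M i) (PiM I M)"
    using measurable_add_dim[of i I M] i by (simp add: insert_absorb)
  have "(\<lambda>x. \<integral>\<^sup>+y. f (x(i := y)) \<partial>M i) \<in> borel_measurable (PiM I M)"
    using measurable_compose[OF upd2 f] by (intro Mi.borel_measurable_nn_integral) (simp add: split_beta')
  from split[OF this] have "(\<integral>\<^sup>+x. \<integral>\<^sup>+y. f (x(i := y)) \<partial>M i \<partial>PiM I M)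
      = (\<integral>\<^sup>+X. \<integral>\<^sup>+x. \<integral>\<^sup>+y. f (X(i := y)) \<partial>M i \<partial>M i \<partial>PiM ?J M)"
    by simp
  also have "\<dots> = (\<integral>\<^sup>+X. \<integral>\<^sup>+y. f (X(i := y)) \<partial>M i \<partial>PiM ?J M)"
    by (simp add: Mi.emeasure_space_1)
  also have "\<dots> = (\<integral>\<^sup>+x. f x \<partial>PiM I M)"
    by (rule split[symmetric]) simp
  finally show ?thesis ..
qed

abbreviation waiting_time :: "real measure" where
  "waiting_time \<equiv> density lborel (exponential_density 1)"

abbreviation mark :: "real measure" where
  "mark \<equiv> uniform_measure lborel {0<..<1}"

lemma prob_space_mark: "prob_space mark"
  by (intro prob_space_uniform_measure) auto

lemma prob_space_waiting_time: "prob_space waiting_time"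
  by (intro prob_space_exponential_density) simp

lemma prob_space_clock: "prob_space (waiting_time \<Otimes>\<^sub>M mark)"
proof -
  interpret waiting_time: prob_space waiting_time by (rule prob_space_waiting_time)
  interpret mark: prob_space mark by (rule prob_space_mark)
  interpret pair_prob_space waiting_time mark ..
  show ?thesis by (rule P.prob_space_axioms)
qed

lemma nn_integral_clock:
  assumes [measurable]: "f \<in> borel_measurable borel" "g \<in> borel_measurable borel"
  shows "(\<integral>\<^sup>+y. f (fst y) * g (snd y) \<partial>(waiting_time \<Otimes>\<^sub>M mark)) = (\<integral>\<^sup>+a. f a \<partial>waiting_time) * (\<integral>\<^sup>+U. g U \<partial>mark)"
proof -
  interpret waiting_time: prob_space waiting_time by (rule prob_space_waiting_time)
  interpret mark: prob_space mark by (rule prob_space_mark)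
  interpret pair_prob_space waiting_time mark ..
  have "(\<integral>\<^sup>+y. f (fst y) * g (snd y) \<partial>(waiting_time \<Otimes>\<^sub>M mark)) = (\<integral>\<^sup>+a. \<integral>\<^sup>+U. f a * g U \<partial>mark \<partial>waiting_time)"
    by (subst mark.nn_integral_fst[symmetric]) auto
  also have "\<dots> = (\<integral>\<^sup>+a. f a * (\<integral>\<^sup>+U. g U \<partial>mark) \<partial>waiting_time)"
    by (simp add: nn_integral_cmult)
  also have "\<dots> = (\<integral>\<^sup>+a. f a \<partial>waiting_time) * (\<integral>\<^sup>+U. g U \<partial>mark)"
    by (rule nn_integral_multc) simp
  finally show ?thesis .
qed

lemma nn_integral_mark:
  assumes "0 \<le> q" "q \<le> 1"
  shows "(\<integral>\<^sup>+U. (if U \<le> q then A else B) \<partial>mark) = ennreal q * A + ennreal (1 - q) * B"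
proof -
  interpret mark: prob_space mark by (rule prob_space_mark)
  have q: "emeasure mark {..q} = ennreal q"
  proof -
    have "{0<..<1} \<inter> {..q} = (if q = 1 then {0<..<1} else {0<..q})" using assms by auto
    then have "emeasure lborel ({0<..<1} \<inter> {..q}) = ennreal q" using assms by auto
    then show ?thesis using assms by (simp add: emeasure_uniform_measure divide_ennreal flip: ennreal_1)
  qed
  have "{q<..} = space mark - {..q}" by auto
  then have "emeasure mark {q<..} = 1 - ennreal q"
    using emeasure_compl[of "{..q}" mark] q mark.emeasure_space_1 by simp
  then have q': "emeasure mark {q<..} = ennreal (1 - q)"
    using assms by (simp add: ennreal_minus flip: ennreal_1)
  have "(\<integral>\<^sup>+U. (if U \<le> q then A else B) \<partial>mark) = (\<integral>\<^sup>+U. A * indicator {..q} U + B * indicator {q<..} U \<partial>mark)"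
    by (intro nn_integral_cong) (auto simp: indicator_def)
  also have "\<dots> = A * emeasure mark {..q} + B * emeasure mark {q<..}"
    by (subst nn_integral_add) (auto simp: nn_integral_cmult_indicator)
  finally show ?thesis by (simp add: q q' mult.commute)
qed

text \<open>One step of the volume computation for a simplex of ordered times. The exponential
  density cancels \<open>exp a\<close>, so only a power is integrated; the excluded endpoint
  \<open>c\<close> is a null set.\<close>

lemma nn_integral_waiting_time_window:
  assumes "0 \<le> c" "c \<le> s"
  shows "(\<integral>\<^sup>+a. (if c < a \<and> a \<le> s then ennreal (exp (a - s) * ((s - a) ^ k / fact k)) else 0) \<partial>waiting_time)
    = ennreal (exp (- s) * ((s - c) ^ Suc k / fact (Suc k)))"
proof -
  have "(\<integral>\<^sup>+a. (if c < a \<and> a \<le> s then ennreal (exp (a - s) * ((s - a) ^ k / fact k)) else 0) \<partial>waiting_time)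
     = (\<integral>\<^sup>+a. ennreal (exponential_density 1 a) * (if c < a \<and> a \<le> s then ennreal (exp (a - s) * ((s - a) ^ k / fact k)) else 0) \<partial>lborel)"
    by (subst nn_integral_density) auto
  also have "\<dots> = (\<integral>\<^sup>+a. ennreal (exp (- s) * ((s - a) ^ k / fact k)) * indicator {c..s} a \<partial>lborel)"
  proof (intro nn_integral_cong_AE)
    have "AE a in lborel. a \<noteq> c" by (rule AE_lborel_singleton)
    then show "AE a in lborel. ennreal (exponential_density 1 a) * (if c < a \<and> a \<le> s then ennreal (exp (a - s) * ((s - a) ^ k / fact k)) else 0)
      = ennreal (exp (- s) * ((s - a) ^ k / fact k)) * indicator {c..s} a"
    proof eventually_elim
      case (elim a)
      have "exponential_density 1 a * (exp (a - s) * ((s - a) ^ k / fact k)) = exp (- s) * ((s - a) ^ k / fact k)" if "c < a"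
        using that assms by (simp add: exponential_density_def flip: mult.assoc exp_add)
      then show ?case
        using elim assms
        by (auto simp: indicator_def ennreal_mult[symmetric] exponential_density_nonneg simp del: ennreal_mult)
    qed
  qed
  also have "\<dots> = ennreal (- exp (- s) * ((s - s) ^ Suc k / fact (Suc k)) - - exp (- s) * ((s - c) ^ Suc k / fact (Suc k)))"
  proof (rule nn_integral_FTC_Icc)
    fix x :: real assume x: "x \<in> {c..s}"
    have "real (Suc k) / fact (Suc k) = 1 / fact k" by (simp del: of_nat_Suc)
    moreover have "- exp (- s) * (real (Suc k) * (s - x) ^ k * (-1)) / fact (Suc k)
        = exp (- s) * (s - x) ^ k * (real (Suc k) / fact (Suc k))"
      by (simp del: fact_Suc of_nat_Suc)
    ultimately have "- exp (- s) * (real (Suc k) * (s - x) ^ k * (-1)) / fact (Suc k) = exp (- s) * ((s - x) ^ k / fact k)"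
      by (simp del: fact_Suc of_nat_Suc)
    then show "DERIV (\<lambda>x. - exp (- s) * ((s - x) ^ Suc k / fact (Suc k))) x :> exp (- s) * ((s - x) ^ k / fact k)"
      by (auto intro!: derivative_eq_intros simp del: power_Suc fact_Suc simp: mult_ac)
    show "0 \<le> exp (- s) * ((s - x) ^ k / fact k)" using x by simp
  qed (use assms in auto)
  finally show ?thesis by simp
qed

lemma emeasure_waiting_time_gt:
  assumes "0 \<le> c"
  shows "emeasure waiting_time {c<..} = ennreal (exp (- c))"
proof -
  interpret prob_space waiting_time by (rule prob_space_waiting_time)
  have "distributed waiting_time lborel (\<lambda>x. x) (exponential_density 1)"
    by (auto simp: distributed_def exponential_density_nonneg distr_id2)
  from exponential_distributedD_gt[OF this assms] show ?thesis
    by (simp add: emeasure_eq_measure greaterThan_def)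
qed

section \<open>The driving randomness and the chain\<close>

text \<open>The discrete skeleton of a clock configuration: given the order in which edges ring, the
  ring numbers are forced, so configurations can be classified by words in the edges.\<close>

definition word_rings :: "'a list \<Rightarrow> ('a \<times> nat) list" where
  "word_rings w = map (\<lambda>i. (w ! i, count_list (take i w) (w ! i))) [0..<length w]"

lemma word_rings_Nil [simp]: "word_rings [] = []"
  by (simp add: word_rings_def)

lemma word_rings_snoc [simp]: "word_rings (w @ [e]) = word_rings w @ [(e, count_list w e)]"
  by (auto simp: word_rings_def nth_append)

lemma map_fst_word_rings: "map fst (word_rings w) = w"
  by (induction w rule: rev_induct) auto

lemma set_word_rings: "set (word_rings w) = {(e, k). k < count_list w e}"
  by (induction w rule: rev_induct) (auto split: if_splits)

lemma count_list_pos_iff: "0 < count_list w e \<longleftrightarrow> e \<in> set w"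
  by (induction w) auto

lemma word_rings_subset: "set w \<subseteq> E \<Longrightarrow> set (word_rings w) \<subseteq> E \<times> UNIV"
  using count_list_pos_iff[of w] by (force simp: set_word_rings)

text \<open>The leading 0 gives the empty word the starting time 0, and in \<open>in_order\<close>
  it also forces the first ring to come after time 0.\<close>

definition last_ring :: "('a set \<times> nat \<Rightarrow> real \<times> real) \<Rightarrow> 'a set list \<Rightarrow> real" where
  "last_ring \<omega> w = last (0 # map (ring_time \<omega>) (word_rings w))"

definition in_order :: "('a set \<times> nat \<Rightarrow> real \<times> real) \<Rightarrow> 'a set list \<Rightarrow> bool" where
  "in_order \<omega> w \<longleftrightarrow> sorted_wrt (<) (0 # map (ring_time \<omega>) (word_rings w))"

definition run ::
    "('a set \<Rightarrow> 'a \<times> 'a) \<Rightarrow> ('a set \<Rightarrow> int \<Rightarrow> real) \<Rightarrow> ('a set \<times> nat \<Rightarrow> real \<times> real) \<Rightarrow> ('a set \<times> nat) list \<Rightarrow>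
     ('a \<Rightarrow> int) \<Rightarrow> ('a \<Rightarrow> int)" where
  "run ori p \<omega> is = fold (\<lambda>i. add_ball ori p (fst i) (snd (\<omega> i))) is"

lemma run_simps [simp]:
  "run ori p \<omega> [] x = x"
  "run ori p \<omega> (is @ [i]) x = add_ball ori p (fst i) (snd (\<omega> i)) (run ori p \<omega> is x)"
  by (simp_all add: run_def)

lemma last_ring_simps [simp]:
  "last_ring \<omega> [] = 0"
  "last_ring \<omega> (w @ [e]) = ring_time \<omega> (e, count_list w e)"
  by (simp_all add: last_ring_def)

lemma in_order_Nil [simp]: "in_order \<omega> []"
  by (simp add: in_order_def)

lemma in_order_le_last:
  assumes "in_order \<omega> w" "y \<in> set (0 # map (ring_time \<omega>) (word_rings w))"
  shows "y \<le> last_ring \<omega> w"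
  using assms unfolding in_order_def last_ring_def
  by (cases "0 # map (ring_time \<omega>) (word_rings w)" rule: rev_cases) (auto simp: sorted_wrt_append)

lemma in_order_snoc [simp]:
  "in_order \<omega> (w @ [e]) \<longleftrightarrow> in_order \<omega> w \<and> last_ring \<omega> w < ring_time \<omega> (e, count_list w e)"
proof
  assume "in_order \<omega> (w @ [e])"
  then have "sorted_wrt (<) ((0 # map (ring_time \<omega>) (word_rings w)) @ [ring_time \<omega> (e, count_list w e)])"
    by (simp add: in_order_def)
  then show "in_order \<omega> w \<and> last_ring \<omega> w < ring_time \<omega> (e, count_list w e)"
    unfolding sorted_wrt_append in_order_def last_ring_def by (metis last_in_set list.distinct(1) list.set_intros(1))
next
  assume "in_order \<omega> w \<and> last_ring \<omega> w < ring_time \<omega> (e, count_list w e)"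
  then have "in_order \<omega> w" "y < ring_time \<omega> (e, count_list w e)"
    if "y \<in> set (0 # map (ring_time \<omega>) (word_rings w))" for y
    using in_order_le_last[OF _ that] by (auto intro: le_less_trans)
  then have "sorted_wrt (<) ((0 # map (ring_time \<omega>) (word_rings w)) @ [ring_time \<omega> (e, count_list w e)])"
    unfolding sorted_wrt_append in_order_def by (metis list.set_intros(1) singletonD set_simps(1) set_simps(2) sorted_wrt1)
  then show "in_order \<omega> (w @ [e])"
    by (simp add: in_order_def)
qed

lemma ring_time_Suc: "ring_time \<omega> (e, k) = (\<Sum>j<k. fst (\<omega> (e, j))) + fst (\<omega> (e, k))"
  by (simp add: ring_time_def lessThan_Suc_atMost[symmetric])

text \<open>The sum is the latest ring of \<open>e\<close> within the word, or 0 if there is none.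
  Hence the wait for the next ring of \<open>e\<close> began no later than \<open>last_ring\<close>,
  and the window for it has a nonnegative left end.\<close>

lemma previous_ring_le_last:
  assumes "in_order \<omega> w"
  shows "(\<Sum>j<count_list w e. fst (\<omega> (e, j))) \<le> last_ring \<omega> w"
proof (cases "count_list w e")
  case 0
  then show ?thesis using in_order_le_last[OF assms, of 0] by simp
next
  case (Suc k)
  then have "(e, k) \<in> set (word_rings w)" by (simp add: set_word_rings)
  moreover have "(\<Sum>j<count_list w e. fst (\<omega> (e, j))) = ring_time \<omega> (e, k)"
    by (simp add: Suc ring_time_def lessThan_Suc_atMost)
  ultimately show ?thesis using in_order_le_last[OF assms] by auto
qed

lemma ring_time_cong:
  "(\<And>j. j \<le> k \<Longrightarrow> \<omega> (e, j) = \<omega>' (e, j)) \<Longrightarrow> ring_time \<omega> (e, k) = ring_time \<omega>' (e, k)"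
  by (simp add: ring_time_def)

text \<open>Everything about a word depends only on the rings it contains, so resampling a later
  ring leaves it unchanged.\<close>

lemma word_cong:
  assumes "\<And>e k. k < count_list w e \<Longrightarrow> \<omega> (e, k) = \<omega>' (e, k)"
  shows "in_order \<omega> w = in_order \<omega>' w" "last_ring \<omega> w = last_ring \<omega>' w"
    "run ori p \<omega> (word_rings w) = run ori p \<omega>' (word_rings w)"
proof -
  have "map (ring_time \<omega>) (word_rings w) = map (ring_time \<omega>') (word_rings w)"
    using assms by (auto simp: set_word_rings intro!: ring_time_cong)
  then show "in_order \<omega> w = in_order \<omega>' w" "last_ring \<omega> w = last_ring \<omega>' w"
    by (simp_all only: in_order_def last_ring_def)
  show "run ori p \<omega> (word_rings w) = run ori p \<omega>' (word_rings w)"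
    unfolding run_def using assms by (intro ext fold_cong refl) (auto simp: set_word_rings)
qed

context rule_on_graph
begin

abbreviation "M \<equiv> clocks_marks G"

definition step :: "'a set \<Rightarrow> (('a \<Rightarrow> int) \<Rightarrow> ennreal) \<Rightarrow> ('a \<Rightarrow> int) \<Rightarrow> ennreal" where
  "step e H x = (let (u, v) = ori e; q = p e (x u - x v) in
     ennreal q * H (inc x u) + ennreal (1 - q) * H (inc x v))"

lemma measurable_clock [measurable]:
  "e \<in> E \<Longrightarrow> (\<lambda>\<omega>. \<omega> (e, k)) \<in> measurable M (waiting_time \<Otimes>\<^sub>M mark)"
  unfolding clocks_marks_def by (rule measurable_component_singleton) simp

lemma measurable_clock_components [measurable]:
  assumes "e \<in> E"
  shows "(\<lambda>\<omega>. fst (\<omega> (e, k))) \<in> borel_measurable M" "(\<lambda>\<omega>. snd (\<omega> (e, k))) \<in> borel_measurable M"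
  using measurable_compose[OF measurable_clock[OF assms, of k] measurable_fst]
    measurable_compose[OF measurable_clock[OF assms, of k] measurable_snd]
  by (simp_all cong: measurable_cong_sets)

lemma measurable_ring_time [measurable]: "e \<in> E \<Longrightarrow> (\<lambda>\<omega>. ring_time \<omega> (e, k)) \<in> borel_measurable M"
  unfolding ring_time_def by simp

lemma measurable_last_ring [measurable]:
  "set w \<subseteq> E \<Longrightarrow> (\<lambda>\<omega>. last_ring \<omega> w) \<in> borel_measurable M"
  by (cases w rule: rev_cases) auto

lemma measurable_in_order [measurable]:
  "set w \<subseteq> E \<Longrightarrow> Measurable.pred M (\<lambda>\<omega>. in_order \<omega> w)"
  by (induction w rule: rev_induct) auto

lemma measurable_run [measurable]:
  "set is \<subseteq> E \<times> UNIV \<Longrightarrow> (\<lambda>\<omega>. run ori p \<omega> is x) \<in> measurable M (count_space UNIV)"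
proof (induction "is" rule: rev_induct)
  case (snoc i "is")
  obtain e k u v where i: "i = (e, k)" "e \<in> E" "ori e = (u, v)"
    using snoc.prems by (cases i; cases "ori (fst i)") auto
  have "set is \<subseteq> E \<times> UNIV" using snoc.prems by auto
  from snoc.IH[OF this] have [measurable]: "(\<lambda>\<omega>. run ori p \<omega> is x) \<in> measurable M (count_space UNIV)" .
  have [measurable]: "(\<lambda>\<omega>. inc (run ori p \<omega> is x) z) \<in> measurable M (count_space UNIV)" for z
    by (rule measurable_compose[OF snoc.IH[OF \<open>set is \<subseteq> E \<times> UNIV\<close>]]) simp
  have [measurable]: "(\<lambda>\<omega>. p e (run ori p \<omega> is x u - run ori p \<omega> is x v)) \<in> borel_measurable M"
    by (rule measurable_compose[OF snoc.IH[OF \<open>set is \<subseteq> E \<times> UNIV\<close>]]) simp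
  have [measurable]: "(\<lambda>\<omega>. snd (\<omega> (e, k))) \<in> borel_measurable M"
    using i by measurable
  have "(\<lambda>\<omega>. (\<lambda>y. if snd (\<omega> (e, k)) \<le> p e (y u - y v) then inc y u else inc y v) (run ori p \<omega> is x))
      \<in> measurable M (count_space UNIV)" by measurable
  then show ?case
    by (simp add: i add_ball_def inc_def cong: if_cong)
qed simp

lemma run_add_ball:
  assumes "e \<in> E"
  shows "(\<integral>\<^sup>+U. H (add_ball ori p e U x) \<partial>mark) = step e H x"
proof -
  obtain u v where uv: "ori e = (u, v)" by (cases "ori e")
  have "(\<integral>\<^sup>+U. H (add_ball ori p e U x) \<partial>mark)
      = (\<integral>\<^sup>+U. (if U \<le> p e (x u - x v) then H (inc x u) else H (inc x v)) \<partial>mark)"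
    by (intro nn_integral_cong) (simp add: add_ball_def uv inc_def)
  also have "\<dots> = step e H x"
    using p_bounds[OF assms] by (simp add: nn_integral_mark step_def uv Let_def)
  finally show ?thesis .
qed

lemma nn_integral_resample:
  assumes "e \<in> E" "f \<in> borel_measurable M"
  shows "(\<integral>\<^sup>+\<omega>. f \<omega> \<partial>M) = (\<integral>\<^sup>+\<omega>. \<integral>\<^sup>+y. f (fun_upd \<omega> (e, k) y) \<partial>(waiting_time \<Otimes>\<^sub>M mark) \<partial>M)"
  using assms prob_space_clock unfolding clocks_marks_def
  by (intro nn_integral_PiM_resample) auto

text \<open>Only the next ring of each edge is compared with \<open>t\<close>; further rings come
  later still, as the waiting times are almost surely positive.\<close>

definition word_event :: "real \<Rightarrow> 'a set list \<Rightarrow> ('a set \<times> nat \<Rightarrow> real \<times> real) \<Rightarrow> bool" where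
  "word_event t w \<omega> \<longleftrightarrow> in_order \<omega> w \<and> last_ring \<omega> w \<le> t \<and> (\<forall>e\<in>E. t < ring_time \<omega> (e, count_list w e))"

text \<open>The edges of the first \<open>length w\<close> rings are \<open>w\<close>, and no other ring occurs before \<open>t\<close>. The factor
  \<open>(t - last_ring \<omega> w) ^ k / fact k\<close> is what remains of \<open>k\<close> further rings once their waiting
  times have been integrated out.\<close>

definition word_integral where
  "word_integral t w k H x = (\<integral>\<^sup>+\<omega>. (if word_event t w \<omega>
     then ennreal ((t - last_ring \<omega> w) ^ k / fact k) * H (run ori p \<omega> (word_rings w) x) else 0) \<partial>M)"

lemma measurable_word_event [measurable]:
  "set w \<subseteq> E \<Longrightarrow> Measurable.pred M (word_event t w)"
  using finite_edges unfolding word_event_def by measurable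

text \<open>The ring number \<open>count_list w e\<close> of \<open>e\<close> is the last one of \<open>w @ [e]\<close> but the first one after \<open>t\<close>
  for \<open>w\<close>. Resampling it, and on the left its successor too, turns both sides into the same
  integral.\<close>

lemma word_integral_snoc:
  assumes e: "e \<in> E" and w: "set w \<subseteq> E"
  shows "word_integral t (w @ [e]) k H x = word_integral t w (Suc k) (step e H) x"
proof -
  define k0 where "k0 = count_list w e"
  \<comment> \<open>The time from which the ring \<open>k0\<close> of \<open>e\<close> is awaited;
    it does not involve the coordinate \<open>(e, k0)\<close>.\<close>
  define r0 where "r0 = (\<lambda>\<omega>::'a set \<times> nat \<Rightarrow> real \<times> real. \<Sum>j<k0. fst (\<omega> (e, j)))"
  define D where "D = (\<lambda>\<omega>. \<forall>e'\<in>E - {e}. t < ring_time \<omega> (e', count_list w e'))"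
  define R where "R = (\<lambda>\<omega>. run ori p \<omega> (word_rings w) x)"
  have [measurable]: "Measurable.pred M D"
    unfolding D_def using finite_edges by (intro pred_intros_finite) auto
  have [measurable]: "R \<in> measurable M (count_space UNIV)"
    unfolding R_def by (rule measurable_run[OF word_rings_subset[OF w]])
  have [measurable]: "r0 \<in> borel_measurable M" "(\<lambda>\<omega>. fst (\<omega> (e, j))) \<in> borel_measurable M" for j
    unfolding r0_def using e by measurable
  have [measurable]: "Measurable.pred M (\<lambda>\<omega>. in_order \<omega> w)" "(\<lambda>\<omega>. last_ring \<omega> w) \<in> borel_measurable M"
    using w by measurable
  have [measurable]: "(\<lambda>\<omega>. step e H (R \<omega>)) \<in> borel_measurable M"
    by (rule measurable_compose[where f = R and N = "count_space UNIV"]) auto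
  have local: "in_order (fun_upd \<omega> (e, j) y) w = in_order \<omega> w" "last_ring (fun_upd \<omega> (e, j) y) w = last_ring \<omega> w"
    "R (fun_upd \<omega> (e, j) y) = R \<omega>" "D (fun_upd \<omega> (e, j) y) = D \<omega>" "r0 (fun_upd \<omega> (e, j) y) = r0 \<omega>"
    if "k0 \<le> j" for \<omega> j y
  proof -
    have agree: "(fun_upd \<omega> (e, j) y) (e', i) = \<omega> (e', i)" if "i < count_list w e'" for e' i
      using that \<open>k0 \<le> j\<close> by (auto simp: k0_def)
    show "in_order (fun_upd \<omega> (e, j) y) w = in_order \<omega> w" "last_ring (fun_upd \<omega> (e, j) y) w = last_ring \<omega> w"
      by (intro word_cong agree; assumption)+
    have "run ori p (fun_upd \<omega> (e, j) y) (word_rings w) = run ori p \<omega> (word_rings w)"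
      by (intro word_cong agree; assumption)
    then show "R (fun_upd \<omega> (e, j) y) = R \<omega>"
      by (simp add: R_def)
    have "ring_time (fun_upd \<omega> (e, j) y) (e', i) = ring_time \<omega> (e', i)" if "e' \<noteq> e" for e' i
      using that by (intro ring_time_cong) auto
    then show "D (fun_upd \<omega> (e, j) y) = D \<omega>" by (simp add: D_def)
    show "r0 (fun_upd \<omega> (e, j) y) = r0 \<omega>" using that by (simp add: r0_def)
  qed
  have ring: "ring_time \<omega> (e, k0) = r0 \<omega> + fst (\<omega> (e, k0))"
    "ring_time \<omega> (e, Suc k0) = r0 \<omega> + fst (\<omega> (e, k0)) + fst (\<omega> (e, Suc k0))" for \<omega>
    by (simp_all add: ring_time_Suc r0_def)
  have event_snoc: "word_event t (w @ [e]) \<omega> \<longleftrightarrow> in_order \<omega> w \<and> D \<omega> \<and> last_ring \<omega> w < r0 \<omega> + fst (\<omega> (e, k0))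
      \<and> r0 \<omega> + fst (\<omega> (e, k0)) \<le> t \<and> t < r0 \<omega> + fst (\<omega> (e, k0)) + fst (\<omega> (e, Suc k0))" for \<omega>
    using e by (auto simp: word_event_def D_def k0_def[symmetric] ring)
  have event: "word_event t w \<omega> \<longleftrightarrow> in_order \<omega> w \<and> D \<omega> \<and> last_ring \<omega> w \<le> t \<and> t < r0 \<omega> + fst (\<omega> (e, k0))" for \<omega>
    using e by (auto simp: word_event_def D_def k0_def[symmetric] ring)
  have tail: "(\<integral>\<^sup>+y. (if c < fst y then A else 0) \<partial>(waiting_time \<Otimes>\<^sub>M mark)) = A * ennreal (exp (- c))"
    if "0 \<le> c" for A c
  proof -
    have "(\<integral>\<^sup>+y. (if c < fst y then A else 0) \<partial>(waiting_time \<Otimes>\<^sub>M mark))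
        = (\<integral>\<^sup>+y. A * indicator {c<..} (fst y) * 1 \<partial>(waiting_time \<Otimes>\<^sub>M mark))"
      by (intro nn_integral_cong) (auto simp: indicator_def)
    also have "\<dots> = A * ennreal (exp (- c))"
      using prob_space.emeasure_space_1[OF prob_space_mark]
      by (subst nn_integral_clock) (auto simp: nn_integral_cmult_indicator emeasure_waiting_time_gt[OF that])
    finally show ?thesis .
  qed
  \<comment> \<open>The left integrand once the successor of the last ring is integrated out: its
    wait must exceed what remains until \<open>t\<close>, which has an exponential
    probability.\<close>
  define F1 where "F1 = (\<lambda>\<omega>. if in_order \<omega> w \<and> D \<omega> \<and> last_ring \<omega> w < r0 \<omega> + fst (\<omega> (e, k0)) \<and> r0 \<omega> + fst (\<omega> (e, k0)) \<le> t
     then ennreal ((t - (r0 \<omega> + fst (\<omega> (e, k0)))) ^ k / fact k) * H (add_ball ori p e (snd (\<omega> (e, k0))) (R \<omega>))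
       * ennreal (exp (- (t - (r0 \<omega> + fst (\<omega> (e, k0)))))) else 0)"
  \<comment> \<open>The common value of both sides after ring \<open>k0\<close> has been integrated
    out as well: on the left it lies in a window before \<open>t\<close>, on the right beyond
    \<open>t\<close>.\<close>
  define F2 where "F2 = (\<lambda>\<omega>. if in_order \<omega> w \<and> D \<omega> \<and> last_ring \<omega> w \<le> t
     then ennreal ((t - last_ring \<omega> w) ^ Suc k / fact (Suc k)) * step e H (R \<omega>) * ennreal (exp (- (t - r0 \<omega>))) else 0)"
  have "set (word_rings (w @ [e])) \<subseteq> E \<times> UNIV" using e w by (intro word_rings_subset) auto
  from measurable_run[OF this, of x]
  have "(\<lambda>\<omega>. add_ball ori p e (snd (\<omega> (e, k0))) (R \<omega>)) \<in> measurable M (count_space UNIV)"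
    by (simp add: R_def k0_def)
  from measurable_compose[OF this, of H borel]
  have [measurable]: "(\<lambda>\<omega>. H (add_ball ori p e (snd (\<omega> (e, k0))) (R \<omega>))) \<in> borel_measurable M"
    by simp
  have "word_integral t (w @ [e]) k H x = (\<integral>\<^sup>+\<omega>. F1 \<omega> \<partial>M)"
  proof -
    define F where "F = (\<lambda>\<omega>. if word_event t (w @ [e]) \<omega>
       then ennreal ((t - (r0 \<omega> + fst (\<omega> (e, k0)))) ^ k / fact k) * H (add_ball ori p e (snd (\<omega> (e, k0))) (R \<omega>)) else 0)"
    have [measurable]: "F \<in> borel_measurable M"
      unfolding F_def event_snoc by measurable
    have "word_integral t (w @ [e]) k H x = (\<integral>\<^sup>+\<omega>. F \<omega> \<partial>M)"
      unfolding word_integral_def F_def by (intro nn_integral_cong) (simp add: R_def k0_def[symmetric] ring)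
    also have "\<dots> = (\<integral>\<^sup>+\<omega>. \<integral>\<^sup>+y. F (fun_upd \<omega> (e, Suc k0) y) \<partial>(waiting_time \<Otimes>\<^sub>M mark) \<partial>M)"
      by (rule nn_integral_resample) (use e in auto)
    also have "(\<lambda>\<omega>. \<integral>\<^sup>+y. F (fun_upd \<omega> (e, Suc k0) y) \<partial>(waiting_time \<Otimes>\<^sub>M mark)) = F1"
    proof
      fix \<omega>
      let ?r = "r0 \<omega> + fst (\<omega> (e, k0))"
      show "(\<integral>\<^sup>+y. F (fun_upd \<omega> (e, Suc k0) y) \<partial>(waiting_time \<Otimes>\<^sub>M mark)) = F1 \<omega>"
      proof (cases "in_order \<omega> w \<and> D \<omega> \<and> last_ring \<omega> w < ?r \<and> ?r \<le> t")
        case True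
        then have "F (fun_upd \<omega> (e, Suc k0) y) = (if t - ?r < fst y
          then ennreal ((t - ?r) ^ k / fact k) * H (add_ball ori p e (snd (\<omega> (e, k0))) (R \<omega>)) else 0)" for y
          by (auto simp: F_def event_snoc local algebra_simps)
        then show ?thesis using True by (simp add: tail F1_def)
      next
        case False
        then show ?thesis by (auto simp: F_def event_snoc local F1_def)
      qed
    qed
    finally show ?thesis .
  qed
  also have "\<dots> = (\<integral>\<^sup>+\<omega>. F2 \<omega> \<partial>M)"
  proof -
    have [measurable]: "F1 \<in> borel_measurable M"
      unfolding F1_def by measurable
    have "(\<integral>\<^sup>+\<omega>. F1 \<omega> \<partial>M) = (\<integral>\<^sup>+\<omega>. \<integral>\<^sup>+y. F1 (fun_upd \<omega> (e, k0) y) \<partial>(waiting_time \<Otimes>\<^sub>M mark) \<partial>M)"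
      by (rule nn_integral_resample) (use e in auto)
    also have "(\<lambda>\<omega>. \<integral>\<^sup>+y. F1 (fun_upd \<omega> (e, k0) y) \<partial>(waiting_time \<Otimes>\<^sub>M mark)) = F2"
    proof
      fix \<omega>
      show "(\<integral>\<^sup>+y. F1 (fun_upd \<omega> (e, k0) y) \<partial>(waiting_time \<Otimes>\<^sub>M mark)) = F2 \<omega>"
      proof (cases "in_order \<omega> w \<and> D \<omega> \<and> last_ring \<omega> w \<le> t")
        case True
        \<comment> \<open>The window for the waiting time itself: after the last ring of
          \<open>w\<close> and up to \<open>t\<close>, both measured from \<open>r0\<close>.\<close>
        define c s where "c = last_ring \<omega> w - r0 \<omega>" and "s = t - r0 \<omega>"
        have cs: "0 \<le> c" "c \<le> s"
          using True previous_ring_le_last[of \<omega> w e] by (auto simp: c_def s_def r0_def k0_def)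
        have "F1 (fun_upd \<omega> (e, k0) y) = (if c < fst y \<and> fst y \<le> s then ennreal (exp (fst y - s) * ((s - fst y) ^ k / fact k)) else 0)
           * H (add_ball ori p e (snd y) (R \<omega>))" for y
        proof (cases "c < fst y \<and> fst y \<le> s")
          case win: True
          then have "last_ring \<omega> w < r0 \<omega> + fst y" "r0 \<omega> + fst y \<le> t" by (auto simp: c_def s_def)
          moreover have "t - (r0 \<omega> + fst y) = s - fst y" by (simp add: s_def)
          then have "ennreal ((t - (r0 \<omega> + fst y)) ^ k / fact k) * A * ennreal (exp (- (t - (r0 \<omega> + fst y))))
              = ennreal (exp (fst y - s) * ((s - fst y) ^ k / fact k)) * A" for A
            using win by (simp only: minus_diff_eq) (simp add: ennreal_mult mult_ac del: times_divide_eq_right times_divide_eq_left)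
          ultimately show ?thesis
            using True win by (simp add: F1_def local)
        next
          case False
          then have "\<not> (last_ring \<omega> w < r0 \<omega> + fst y \<and> r0 \<omega> + fst y \<le> t)" by (auto simp: c_def s_def)
          then show ?thesis using False by (auto simp: F1_def local)
        qed
        moreover have "(\<lambda>U. H (add_ball ori p e U (R \<omega>))) \<in> borel_measurable borel"
        proof -
          obtain u v where "ori e = (u, v)" by (cases "ori e")
          then show ?thesis by (simp add: add_ball_def if_distrib[of H])
        qed
        ultimately have "(\<integral>\<^sup>+y. F1 (fun_upd \<omega> (e, k0) y) \<partial>(waiting_time \<Otimes>\<^sub>M mark))
          = (\<integral>\<^sup>+a. (if c < a \<and> a \<le> s then ennreal (exp (a - s) * ((s - a) ^ k / fact k)) else 0) \<partial>waiting_time)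
            * (\<integral>\<^sup>+U. H (add_ball ori p e U (R \<omega>)) \<partial>mark)"
          by (simp only:) (rule nn_integral_clock; measurable)
        also have "\<dots> = ennreal (exp (- s) * ((s - c) ^ Suc k / fact (Suc k))) * step e H (R \<omega>)"
          by (simp only: nn_integral_waiting_time_window[OF cs] run_add_ball[OF e])
        also have "\<dots> = F2 \<omega>"
          using True cs by (simp add: F2_def ennreal_mult c_def s_def mult_ac
            del: fact_Suc power_Suc times_divide_eq_right times_divide_eq_left)
        finally show ?thesis .
      next
        case False
        then have "F1 (fun_upd \<omega> (e, k0) y) = 0" for y by (auto simp: F1_def local)
        then show ?thesis using False by (auto simp: F2_def)
      qed
    qed
    finally show ?thesis .
  qed
  also have "\<dots> = word_integral t w (Suc k) (step e H) x"
  proof -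
    define F where "F = (\<lambda>\<omega>. if word_event t w \<omega>
       then ennreal ((t - last_ring \<omega> w) ^ Suc k / fact (Suc k)) * step e H (R \<omega>) else 0)"
    have [measurable]: "F \<in> borel_measurable M"
      using w unfolding F_def by measurable
    have "word_integral t w (Suc k) (step e H) x = (\<integral>\<^sup>+\<omega>. F \<omega> \<partial>M)"
      unfolding word_integral_def F_def R_def ..
    also have "\<dots> = (\<integral>\<^sup>+\<omega>. \<integral>\<^sup>+y. F (fun_upd \<omega> (e, k0) y) \<partial>(waiting_time \<Otimes>\<^sub>M mark) \<partial>M)"
      by (rule nn_integral_resample) (use e in auto)
    also have "(\<lambda>\<omega>. \<integral>\<^sup>+y. F (fun_upd \<omega> (e, k0) y) \<partial>(waiting_time \<Otimes>\<^sub>M mark)) = F2"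
    proof
      fix \<omega>
      show "(\<integral>\<^sup>+y. F (fun_upd \<omega> (e, k0) y) \<partial>(waiting_time \<Otimes>\<^sub>M mark)) = F2 \<omega>"
      proof (cases "in_order \<omega> w \<and> D \<omega> \<and> last_ring \<omega> w \<le> t")
        case True
        have "0 \<le> t - r0 \<omega>"
          using True previous_ring_le_last[of \<omega> w e] by (auto simp: r0_def k0_def)
        moreover have "F (fun_upd \<omega> (e, k0) y) = (if t - r0 \<omega> < fst y
          then ennreal ((t - last_ring \<omega> w) ^ Suc k / fact (Suc k)) * step e H (R \<omega>) else 0)" for y
          using True by (auto simp: F_def event local algebra_simps)
        ultimately show ?thesis using True by (simp add: tail F2_def del: fact_Suc power_Suc)
      next
        case False
        then show ?thesis by (auto simp: F_def event local F2_def)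
      qed
    qed
    finally show ?thesis ..
  qed
  finally show ?thesis .
qed

lemma emeasure_no_ring:
  fixes t :: real
  assumes "0 \<le> t"
  shows "emeasure M {\<omega> \<in> space M. \<forall>e\<in>E. t < fst (\<omega> (e, 0))} = ennreal (exp (- (card E * t)))"
proof -
  let ?C = "waiting_time \<Otimes>\<^sub>M mark"
  interpret waiting_time: prob_space waiting_time by (rule prob_space_waiting_time)
  interpret mark: prob_space mark by (rule prob_space_mark)
  interpret prob_space ?C by (rule prob_space_clock)
  interpret product_prob_space "\<lambda>_. ?C" "E \<times> UNIV" ..
  have "{\<omega> \<in> space M. \<forall>e\<in>E. t < fst (\<omega> (e, 0))}
      = {\<omega> \<in> space (PiM (E \<times> UNIV) (\<lambda>_. ?C)). \<forall>i\<in>E \<times> {0}. \<omega> i \<in> {t<..} \<times> UNIV}"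
    by (auto simp: clocks_marks_def mem_Times_iff)
  then have "emeasure M {\<omega> \<in> space M. \<forall>e\<in>E. t < fst (\<omega> (e, 0))} = (\<Prod>i\<in>E \<times> {0::nat}. emeasure ?C ({t<..} \<times> UNIV))"
    using finite_edges emeasure_PiM_Collect[of "E \<times> {0}" "\<lambda>_. {t<..} \<times> UNIV"]
    by (simp add: clocks_marks_def Sigma_mono)
  also have "emeasure ?C ({t<..} \<times> UNIV) = ennreal (exp (- t))"
    using mark.emeasure_pair_measure_Times[of "{t<..}" waiting_time UNIV] mark.emeasure_space_1
    by (simp add: emeasure_waiting_time_gt[OF assms])
  finally show ?thesis
    by (simp add: ennreal_power card_cartesian_product flip: exp_of_nat_mult)
qed

text \<open>Removing letters from the end moves each of them into \<open>H\<close> as a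
  \<open>step\<close> and raises \<open>k\<close> by one. The clock factor depends on the word only
  through its length: the edges are uniform and independent of their Poisson number.\<close>

lemma word_integral_eq:
  fixes t :: real
  assumes "set w \<subseteq> E" "0 \<le> t"
  shows "word_integral t w k H x
    = ennreal (exp (- (card E * t)) * t ^ (length w + k) / fact (length w + k)) * foldr step w H x"
  using assms
proof (induction w arbitrary: k H rule: rev_induct)
  case Nil
  have [measurable]: "Measurable.pred M (\<lambda>\<omega>. \<forall>e\<in>E. t < fst (\<omega> (e, 0)))"
    using finite_edges by measurable
  have "word_integral t [] k H x
      = (\<integral>\<^sup>+\<omega>. ennreal (t ^ k / fact k) * H x * indicator {\<omega> \<in> space M. \<forall>e\<in>E. t < fst (\<omega> (e, 0))} \<omega> \<partial>M)"
    unfolding word_integral_def using \<open>0 \<le> t\<close>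
    by (intro nn_integral_cong) (auto simp: word_event_def ring_time_def indicator_def)
  also have "\<dots> = ennreal (t ^ k / fact k) * H x * ennreal (exp (- (card E * t)))"
    using \<open>0 \<le> t\<close> by (subst nn_integral_cmult_indicator) (auto simp: emeasure_no_ring)
  also have "\<dots> = ennreal (exp (- (card E * t)) * (t ^ k / fact k)) * H x"
    using \<open>0 \<le> t\<close> by (simp add: ennreal_mult mult_ac del: times_divide_eq_right times_divide_eq_left)
  finally show ?case by simp
next
  case (snoc e w)
  then show ?case by (simp add: word_integral_snoc)
qed

lemma step_sum_eq: "(\<Sum>i\<in>I. step e (h i) x) = step e (\<lambda>y. \<Sum>i\<in>I. h i y) x"
  by (cases "ori e") (simp add: step_def Let_def sum.distrib sum_distrib_left)

lemma sum_step:
  assumes "\<And>y. 0 \<le> h y"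
  shows "(\<Sum>e\<in>E. step e (\<lambda>y. ennreal (h y)) x) = ennreal (card E * Q h x)"
proof -
  have "step e (\<lambda>y. ennreal (h y)) x = ennreal (\<Sum>w\<in>V. landing ori p e x w * h (inc x w))" if e: "e \<in> E" for e
  proof -
    obtain u v where uv: "ori e = (u, v)" by (cases "ori e")
    then show ?thesis
      using p_bounds[OF e] assms by (simp add: sum_landing[OF e uv] step_def Let_def ennreal_mult ennreal_plus)
  qed
  then have "(\<Sum>e\<in>E. step e (\<lambda>y. ennreal (h y)) x)
      = ennreal (\<Sum>e\<in>E. \<Sum>w\<in>V. landing ori p e x w * h (inc x w))"
    using assms by (simp add: sum_ennreal sum_nonneg landing_nonneg)
  also have "(\<Sum>e\<in>E. \<Sum>w\<in>V. landing ori p e x w * h (inc x w)) = card E * Q h x"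
    using card_edges_pos by (simp add: Q_def sum_rate[of "\<lambda>_. 1", folded rate_def])
  finally show ?thesis .
qed

text \<open>By \<open>sum_step\<close>, summing over one letter gives \<open>card E\<close> times
  \<open>Q\<close>; the first letter is the outermost step, matching the order of the chain.\<close>

lemma sum_words:
  assumes "\<And>y. 0 \<le> h y"
  shows "(\<Sum>w | set w \<subseteq> E \<and> length w = n. foldr step w (\<lambda>y. ennreal (h y)) x) = ennreal (card E ^ n * (Q ^^ n) h x)"
proof (induction n arbitrary: x)
  case 0
  have "{w. set w \<subseteq> E \<and> length w = 0} = {[]}" by auto
  then show ?case by simp
next
  case (Suc n)
  let ?W = "{w. set w \<subseteq> E \<and> length w = n}"
  have nonneg: "0 \<le> (Q ^^ n) h y" for y
    using Qn_mono[of "\<lambda>_. 0" h n y] assms by simp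
  have "{w. set w \<subseteq> E \<and> length w = Suc n} = (\<lambda>(e, w). e # w) ` (E \<times> ?W)"
    by (force simp: length_Suc_conv)
  then have "(\<Sum>w | set w \<subseteq> E \<and> length w = Suc n. foldr step w (\<lambda>y. ennreal (h y)) x)
     = (\<Sum>(e, w)\<in>E \<times> ?W. step e (foldr step w (\<lambda>y. ennreal (h y))) x)"
    by (simp only:) (subst sum.reindex; auto simp: inj_on_def intro!: sum.cong)
  also have "\<dots> = (\<Sum>e\<in>E. \<Sum>w\<in>?W. step e (foldr step w (\<lambda>y. ennreal (h y))) x)"
    by (rule sum.cartesian_product[symmetric])
  also have "\<dots> = (\<Sum>e\<in>E. step e (\<lambda>y. ennreal (card E ^ n * (Q ^^ n) h y)) x)"
    by (simp add: step_sum_eq Suc.IH)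
  also have "\<dots> = ennreal (card E ^ Suc n * (Q ^^ Suc n) h x)"
    using nonneg by (subst sum_step) (auto simp: Q_cmult mult_ac)
  finally show ?case .
qed

end

section \<open>The load vector at a fixed time\<close>

lemma (in linorder) sorted_key_list_of_set_iff:
  assumes "finite A" "inj_on f A"
  shows "sorted_key_list_of_set f A = l \<longleftrightarrow> sorted_wrt (<) (map f l) \<and> set l = A"
proof -
  interpret folding_insort_key less_eq less A f
    by unfold_locales (rule assms(2))
  have "length l = card A" if "sorted_wrt (<) (map f l)" "set l = A"
    using that distinct_card[of l] by (auto simp: strict_sorted_iff distinct_map)
  then show ?thesis
    using sorted_key_list_of_set_unique[OF subset_refl assms(1), of l] by blast
qed

lemma inj_on_of_strict_sorted: "sorted_wrt (<) (map f l) \<Longrightarrow> inj_on f (set l)" for f :: "'b \<Rightarrow> 'c :: linorder"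
  by (simp add: strict_sorted_iff distinct_map)

text \<open>The value \<open>[]\<close> on the exceptional event reproduces the convention of
  \<open>load_at\<close>, so that the load is always a \<open>run\<close> along this list.\<close>

definition ring_list :: "'a ugraph \<Rightarrow> ('a set \<times> nat \<Rightarrow> real \<times> real) \<Rightarrow> real \<Rightarrow> ('a set \<times> nat) list" where
  "ring_list G \<omega> t = (if finite (rings_upto G \<omega> t) \<and> inj_on (ring_time \<omega>) (rings_upto G \<omega> t)
     then sorted_key_list_of_set (ring_time \<omega>) (rings_upto G \<omega> t) else [])"

lemma load_at_run: "load_at G ori p t (x, \<omega>) = run ori p \<omega> (ring_list G \<omega> t) x"
  by (simp add: load_at_def run_def ring_list_def)

lemma ring_list_eq_iff:
  assumes "l \<noteq> []"
  shows "ring_list G \<omega> t = l \<longleftrightarrow> sorted_wrt (<) (map (ring_time \<omega>) l) \<and> set l = rings_upto G \<omega> t"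
proof (cases "finite (rings_upto G \<omega> t) \<and> inj_on (ring_time \<omega>) (rings_upto G \<omega> t)")
  case True
  then show ?thesis by (simp add: ring_list_def sorted_key_list_of_set_iff)
next
  case False
  moreover have "\<not> (sorted_wrt (<) (map (ring_time \<omega>) l) \<and> set l = rings_upto G \<omega> t)"
    using False inj_on_of_strict_sorted[of "ring_time \<omega>" l] by (metis List.finite_set)
  ultimately show ?thesis using assms by (auto simp: ring_list_def)
qed

lemma ring_list_subset: "set (ring_list G \<omega> t) \<subseteq> edges G \<times> UNIV"
proof (cases "ring_list G \<omega> t = []")
  case False
  then have "set (ring_list G \<omega> t) = rings_upto G \<omega> t" using ring_list_eq_iff by blast
  then show ?thesis by (auto simp: rings_upto_def)
qed simp

context rule_on_graph
begin

lemma measurable_ring_list: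
  "(\<lambda>\<omega>. ring_list G \<omega> t) \<in> measurable M (count_space (lists (E \<times> UNIV)))"
proof -
  have countable: "countable (lists (E \<times> (UNIV :: nat set)))"
    using finite_edges by (intro countable_lists countable_SIGMA) (auto intro: countable_finite)
  have nonempty: "(\<lambda>\<omega>. ring_list G \<omega> t) -` {l} \<inter> space M \<in> sets M" if l: "l \<in> lists (E \<times> UNIV)" "l \<noteq> []" for l
  proof -
    have [measurable]: "(\<lambda>\<omega>. ring_time \<omega> (l ! i)) \<in> borel_measurable M" if "i < length l" for i
    proof -
      have "l ! i \<in> E \<times> UNIV" using l(1) that by auto
      then show ?thesis by (cases "l ! i") auto
    qed
    have "Measurable.pred M (\<lambda>\<omega>. \<forall>j\<in>{..<length l}. \<forall>i\<in>{..<j}. ring_time \<omega> (l ! i) < ring_time \<omega> (l ! j))"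
      by (intro pred_intros_finite) auto
    moreover have "Measurable.pred M (\<lambda>\<omega>. \<forall>e\<in>E. \<forall>k. (ring_time \<omega> (e, k) \<le> t) = ((e, k) \<in> set l))"
      using finite_edges by (intro pred_intros_finite pred_intros_countable) auto
    ultimately have "Measurable.pred M (\<lambda>\<omega>. (\<forall>j\<in>{..<length l}. \<forall>i\<in>{..<j}. ring_time \<omega> (l ! i) < ring_time \<omega> (l ! j))
        \<and> (\<forall>e\<in>E. \<forall>k. (ring_time \<omega> (e, k) \<le> t) = ((e, k) \<in> set l)))"
      by simp
    moreover have "ring_list G \<omega> t = l \<longleftrightarrow> (\<forall>j\<in>{..<length l}. \<forall>i\<in>{..<j}. ring_time \<omega> (l ! i) < ring_time \<omega> (l ! j))
        \<and> (\<forall>e\<in>E. \<forall>k. (ring_time \<omega> (e, k) \<le> t) = ((e, k) \<in> set l))" for \<omega>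
    proof -
      have "sorted_wrt (<) (map (ring_time \<omega>) l)
          \<longleftrightarrow> (\<forall>j\<in>{..<length l}. \<forall>i\<in>{..<j}. ring_time \<omega> (l ! i) < ring_time \<omega> (l ! j))"
        by (auto simp: sorted_wrt_iff_nth_less)
      moreover have "set l = rings_upto G \<omega> t \<longleftrightarrow> (\<forall>e\<in>E. \<forall>k. (ring_time \<omega> (e, k) \<le> t) = ((e, k) \<in> set l))"
        using l(1) by (auto simp: rings_upto_def)
      ultimately show ?thesis by (simp add: ring_list_eq_iff[OF l(2)])
    qed
    ultimately show ?thesis by (simp add: vimage_def Int_def pred_def conj_commute)
  qed
  \<comment> \<open>The empty list arises both from an absence of rings and from the exceptional
    event, so its preimage is obtained as a complement, over countably many lists.\<close>
  have "(\<lambda>\<omega>. ring_list G \<omega> t) -` {[]} \<inter> space M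
      = space M - (\<Union>l\<in>lists (E \<times> UNIV) - {[]}. (\<lambda>\<omega>. ring_list G \<omega> t) -` {l} \<inter> space M)"
    using ring_list_subset[of G _ t] by (auto simp: in_lists_conv_set) blast
  also have "\<dots> \<in> sets M"
    using nonempty countable by (intro sets.Diff sets.countable_UN'') auto
  finally show ?thesis
    using nonempty ring_list_subset[of G _ t] unfolding measurable_count_space_eq_countable[OF countable]
    by (auto simp: in_lists_conv_set)
qed

lemma measurable_load_at: "(\<lambda>\<omega>. load_at G ori p t (x, \<omega>)) \<in> measurable M (count_space UNIV)"
proof -
  have "(\<lambda>\<omega>. run ori p \<omega> (ring_list G \<omega> t) x) \<in> measurable M (count_space UNIV)"
  proof (rule measurable_compose_countable'[OF _ measurable_ring_list])
    show "(\<lambda>\<omega>. run ori p \<omega> l x) \<in> measurable M (count_space UNIV)" if "l \<in> lists (E \<times> UNIV)" for l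
      using that by (intro measurable_run) auto
    show "countable (lists (E \<times> (UNIV :: nat set)))"
      using finite_edges by (intro countable_lists countable_SIGMA) (auto intro: countable_finite)
  qed
  then show ?thesis by (simp add: load_at_run)
qed

lemma prob_space_clocks_marks: "prob_space M"
  unfolding clocks_marks_def by (intro prob_space_PiM prob_space_clock)

lemma AE_waiting_times_pos: "AE \<omega> in M. \<forall>e\<in>E. \<forall>k. 0 < fst (\<omega> (e, k))"
proof -
  have *: "AE \<omega> in M. 0 < fst (\<omega> (e, k))" if e: "e \<in> E" for e k
  proof -
    interpret waiting_time: prob_space waiting_time by (rule prob_space_waiting_time)
    interpret mark: prob_space mark by (rule prob_space_mark)
    interpret C: prob_space "waiting_time \<Otimes>\<^sub>M mark" by (rule prob_space_clock)
    have "emeasure (waiting_time \<Otimes>\<^sub>M mark) ({0<..} \<times> UNIV) = 1"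
      using mark.emeasure_pair_measure_Times[of "{0<..}" waiting_time UNIV] mark.emeasure_space_1
        emeasure_waiting_time_gt[of 0] by simp
    then have "AE y in waiting_time \<Otimes>\<^sub>M mark. y \<in> {0<..} \<times> UNIV"
      by (subst C.AE_in_set_eq_1) (auto simp: C.emeasure_eq_measure)
    then have "AE y in waiting_time \<Otimes>\<^sub>M mark. 0 < fst y" by eventually_elim auto
    then show ?thesis
      unfolding clocks_marks_def using e prob_space_clock by (intro AE_PiM_component) auto
  qed
  then have "AE \<omega> in M. \<forall>k. 0 < fst (\<omega> (e, k))" if "e \<in> E" for e
    using that by (simp add: AE_all_countable)
  then show ?thesis
    using finite_edges by (simp add: AE_finite_all)
qed

text \<open>Positive waiting times make the rings of an edge increase, so a next ring after
  \<open>t\<close> excludes all later ones.\<close>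

lemma ring_list_word:
  assumes pos: "\<And>e k. e \<in> E \<Longrightarrow> 0 < fst (\<omega> (e, k))" and w: "set w \<subseteq> E" and event: "word_event t w \<omega>"
  shows "ring_list G \<omega> t = word_rings w"
proof -
  have mono: "ring_time \<omega> (e, j) \<le> ring_time \<omega> (e, k)" if "e \<in> E" "j \<le> k" for e j k
    unfolding ring_time_def prod.case using that by (intro sum_mono2) (auto intro: less_imp_le pos)
  have "rings_upto G \<omega> t = set (word_rings w)"
  proof (intro set_eqI iffI)
    fix i assume "i \<in> rings_upto G \<omega> t"
    then obtain e k where i: "i = (e, k)" "e \<in> E" "ring_time \<omega> (e, k) \<le> t" by (auto simp: rings_upto_def)
    then have "\<not> count_list w e \<le> k"
      using mono[of e "count_list w e" k] event by (force simp: word_event_def)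
    then show "i \<in> set (word_rings w)" by (simp add: i set_word_rings)
  next
    fix i assume i: "i \<in> set (word_rings w)"
    then have "ring_time \<omega> i \<le> last_ring \<omega> w"
      using event by (intro in_order_le_last) (auto simp: word_event_def)
    then show "i \<in> rings_upto G \<omega> t"
      using i event word_rings_subset[OF w] by (auto simp: rings_upto_def word_event_def)
  qed
  moreover have sorted: "sorted_wrt (<) (map (ring_time \<omega>) (word_rings w))"
    using event by (simp add: word_event_def in_order_def)
  ultimately show ?thesis
    using inj_on_of_strict_sorted[OF sorted]
    by (simp add: ring_list_def sorted_key_list_of_set_iff)
qed

text \<open>The configurations are split by their words of length below \<open>N\<close>, and the
  rest is dropped. Summed over words of length \<open>n\<close>, the integrals are the Poisson
  weight times the chain after \<open>n\<close> steps.\<close>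

lemma nn_integral_load_at_ge:
  fixes t :: real
  assumes h: "\<And>y. 0 \<le> h y" and t: "0 \<le> t"
  shows "(\<Sum>n<N. ennreal (exp (- (card E * t)) * (card E * t) ^ n / fact n * (Q ^^ n) h x))
    \<le> (\<integral>\<^sup>+\<omega>. ennreal (h (load_at G ori p t (x, \<omega>))) \<partial>M)"
proof -
  define W where "W = (\<lambda>n. {w. set w \<subseteq> E \<and> length w = n})"
  have fin: "finite (W n)" for n
    using finite_edges by (simp add: W_def finite_lists_length_eq)
  have Qpos: "0 \<le> (Q ^^ n) h y" for n y
    using Qn_mono[of "\<lambda>_. 0" h n y] h by simp
  have "(\<Sum>w\<in>W n. word_integral t w 0 (\<lambda>y. ennreal (h y)) x)
      = ennreal (exp (- (card E * t)) * (card E * t) ^ n / fact n * (Q ^^ n) h x)" for n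
  proof -
    have "(\<Sum>w\<in>W n. word_integral t w 0 (\<lambda>y. ennreal (h y)) x)
       = (\<Sum>w\<in>W n. ennreal (exp (- (card E * t)) * t ^ n / fact n) * foldr step w (\<lambda>y. ennreal (h y)) x)"
      using t by (intro sum.cong) (auto simp: W_def word_integral_eq)
    also have "\<dots> = ennreal (exp (- (card E * t)) * t ^ n / fact n) * ennreal (card E ^ n * (Q ^^ n) h x)"
      by (simp add: W_def sum_words[OF h] flip: sum_distrib_left)
    also have "\<dots> = ennreal (exp (- (card E * t)) * t ^ n / fact n * (card E ^ n * (Q ^^ n) h x))"
      using t Qpos by (intro ennreal_mult[symmetric]) auto
    finally show ?thesis by (simp add: power_mult_distrib mult_ac)
  qed
  then have "(\<Sum>n<N. ennreal (exp (- (card E * t)) * (card E * t) ^ n / fact n * (Q ^^ n) h x))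
      = (\<Sum>n<N. \<Sum>w\<in>W n. word_integral t w 0 (\<lambda>y. ennreal (h y)) x)" by simp
  also have "\<dots> = (\<Sum>w\<in>(\<Union>n<N. W n). word_integral t w 0 (\<lambda>y. ennreal (h y)) x)"
    using fin by (subst sum.UNION_disjoint) (auto simp: W_def)
  also have "\<dots> = (\<integral>\<^sup>+\<omega>. (\<Sum>w\<in>(\<Union>n<N. W n). if word_event t w \<omega> then ennreal (h (run ori p \<omega> (word_rings w) x)) else 0) \<partial>M)"
  proof -
    have "(\<lambda>\<omega>. if word_event t w \<omega> then ennreal (h (run ori p \<omega> (word_rings w) x)) else 0) \<in> borel_measurable M"
      if "w \<in> (\<Union>n<N. W n)" for w
    proof -
      have w: "set w \<subseteq> E" using that by (auto simp: W_def)
      have [measurable]: "(\<lambda>\<omega>. ennreal (h (run ori p \<omega> (word_rings w) x))) \<in> borel_measurable M"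
        by (rule measurable_compose[OF measurable_run[OF word_rings_subset[OF w]]]) simp
      show ?thesis using w by measurable
    qed
    then show ?thesis
      by (subst nn_integral_sum) (auto simp: word_integral_def cong: if_cong)
  qed
  also have "\<dots> \<le> (\<integral>\<^sup>+\<omega>. ennreal (h (load_at G ori p t (x, \<omega>))) \<partial>M)"
  proof (rule nn_integral_mono_AE)
    show "AE \<omega> in M. (\<Sum>w\<in>(\<Union>n<N. W n). if word_event t w \<omega> then ennreal (h (run ori p \<omega> (word_rings w) x)) else 0)
        \<le> ennreal (h (load_at G ori p t (x, \<omega>)))"
      using AE_waiting_times_pos
    proof eventually_elim
      case (elim \<omega>)
      have list: "ring_list G \<omega> t = word_rings w" if "w \<in> (\<Union>n<N. W n)" "word_event t w \<omega>" for w
        using elim that by (intro ring_list_word) (auto simp: W_def)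
      \<comment> \<open>The word can be read off the list of rings, so at most one word contributes
        for almost every outcome.\<close>
      define w0 where "w0 = map fst (ring_list G \<omega> t)"
      have "word_rings w = ring_list G \<omega> t" "w = w0" if "w \<in> (\<Union>n<N. W n)" "word_event t w \<omega>" for w
        using list[OF that] by (simp_all add: w0_def map_fst_word_rings)
      then have "(\<Sum>w\<in>(\<Union>n<N. W n). if word_event t w \<omega> then ennreal (h (run ori p \<omega> (word_rings w) x)) else 0)
          \<le> (\<Sum>w\<in>(\<Union>n<N. W n). if w = w0 then ennreal (h (load_at G ori p t (x, \<omega>))) else 0)"
        unfolding load_at_run by (intro sum_mono) (metis (full_types) order_refl zero_le)
      also have "\<dots> \<le> ennreal (h (load_at G ori p t (x, \<omega>)))"
        using fin by (simp add: sum.delta)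
      finally show ?case .
    qed
  qed
  finally show ?thesis .
qed

text \<open>A Chernoff bound by comparison with rate r/2: for n below \<open>n0\<close>, r^n is at
  most 2^n0 (r/2)^n, with 2^n0 at most exp (r/4) and the series at most exp (r/2). What is left is
  exp (-r/4), at most exp (-40).\<close>

lemma poisson_tail:
  fixes r :: real
  assumes "real n0 \<le> r / 4" "160 \<le> r"
  shows "(\<Sum>n<n0. exp (- r) * r ^ n / fact n) \<le> 1 / 50"
proof -
  have "(\<Sum>n<n0. exp (- r) * r ^ n / fact n) \<le> (\<Sum>n<n0. exp (- r) * 2 ^ n0 * ((r / 2) ^ n / fact n))"
  proof (rule sum_mono)
    fix n assume "n \<in> {..<n0}"
    then have "(2::real) ^ n \<le> 2 ^ n0" by (intro power_increasing) auto
    moreover have "r ^ n = 2 ^ n * (r / 2) ^ n" by (simp add: power_mult_distrib[symmetric])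
    ultimately have "r ^ n \<le> 2 ^ n0 * (r / 2) ^ n"
      using assms by (simp add: mult_right_mono)
    then show "exp (- r) * r ^ n / fact n \<le> exp (- r) * 2 ^ n0 * ((r / 2) ^ n / fact n)"
      by (simp add: divide_right_mono mult_left_mono mult.assoc)
  qed
  also have "\<dots> = exp (- r) * 2 ^ n0 * (\<Sum>n<n0. (r / 2) ^ n / fact n)"
    by (simp add: sum_distrib_left)
  also have "\<dots> \<le> exp (- r) * exp (r / 4) * exp (r / 2)"
  proof (intro mult_mono order.refl)
    have "(2::real) ^ n0 \<le> exp 1 ^ n0" using exp_ge_add_one_self[of 1] by (intro power_mono) auto
    also have "\<dots> = exp (real n0)" by (metis exp_of_nat_mult mult_1_right)
    also have "\<dots> \<le> exp (r / 4)" using assms by simp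
    finally show "(2::real) ^ n0 \<le> exp (r / 4)" .
    have "(r / 2) ^ n / fact n = (r / 2) ^ n /\<^sub>R fact n" for n
      by (simp only: divide_inverse real_scaleR_def mult.commute)
    then show "(\<Sum>n<n0. (r / 2) ^ n / fact n) \<le> exp (r / 2)"
      unfolding exp_def using assms by (simp only:) (intro sum_le_suminf summable_exp_generic; simp)
  qed (use assms in \<open>auto intro!: sum_nonneg\<close>)
  also have "exp (- r) * exp (r / 4) * exp (r / 2) = exp (- r / 4)"
    by (simp flip: exp_add)
  also have "exp (- r / 4) \<le> exp (- 40)" using assms by simp
  also have "exp (- 40) \<le> (1 / 50 :: real)"
  proof -
    have "(21::real)\<^sup>2 \<le> exp 20 ^ 2" using exp_ge_add_one_self[of 20] by (intro power_mono) auto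
    then have "50 \<le> exp (40::real)" using exp_double[of "20::real"] by simp
    then show ?thesis by (simp add: exp_minus field_simps)
  qed
  finally show ?thesis .
qed

text \<open>By \<open>Qn_lower\<close> every number of rings from \<open>n0\<close> on is good with
  probability \<open>q\<close>; the Poisson weight below \<open>n0\<close> is at most 1/50. The
  partial sums are then completed in the limit.\<close>

lemma prob_load_at_ge:
  fixes t q :: real
  assumes q: "\<And>y. q \<le> (Q ^^ n0) (\<lambda>y. of_bool (A y)) y"
    and n0: "real n0 \<le> card E * t / 4" "160 \<le> card E * t"
  shows "ennreal (q * (49 / 50)) \<le> emeasure M {\<omega> \<in> space M. A (load_at G ori p t (x, \<omega>))}"
proof (cases "0 \<le> q")
  case True
  let ?r = "card E * t"
  let ?c = "\<lambda>n. exp (- ?r) * ?r ^ n / fact n"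
  have t: "0 \<le> t" using n0(2) card_edges_pos zero_less_mult_iff[of "real (card E)" t] by simp
  interpret prob_space M by (rule prob_space_clocks_marks)
  have sets: "{\<omega> \<in> space M. A (load_at G ori p t (x, \<omega>))} \<in> sets M"
    using measurable_sets[OF measurable_load_at[of t x], of "Collect A"] by (simp add: vimage_def Int_def conj_commute)
  define P where "P = prob {\<omega> \<in> space M. A (load_at G ori p t (x, \<omega>))}"
  have P: "(\<integral>\<^sup>+\<omega>. ennreal (of_bool (A (load_at G ori p t (x, \<omega>)))) \<partial>M) = ennreal P"
  proof -
    have "(\<integral>\<^sup>+\<omega>. ennreal (of_bool (A (load_at G ori p t (x, \<omega>)))) \<partial>M)
        = (\<integral>\<^sup>+\<omega>. indicator {\<omega> \<in> space M. A (load_at G ori p t (x, \<omega>))} \<omega> \<partial>M)"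
      by (intro nn_integral_cong) (auto simp: indicator_def)
    then show ?thesis using sets by (simp add: P_def emeasure_eq_measure)
  qed
  have "q * ((\<Sum>n<N. ?c n) - 1 / 50) \<le> P" for N
  proof -
    have Q0: "0 \<le> (Q ^^ n) (\<lambda>y. of_bool (A y)) x" for n
      using Qn_mono[of "\<lambda>_. 0" "\<lambda>y. of_bool (A y)" n x] by simp
    have "q * ((\<Sum>n<N. ?c n) - 1 / 50) \<le> q * ((\<Sum>n<N. ?c n) - (\<Sum>n<n0. ?c n))"
      using poisson_tail[OF n0] True by (intro mult_left_mono) auto
    also have "\<dots> \<le> q * (\<Sum>n\<in>{..<N} - {..<n0}. ?c n)"
    proof -
      have "(\<Sum>n<N. ?c n) = (\<Sum>n\<in>{..<N} - {..<n0}. ?c n) + (\<Sum>n\<in>{..<N} \<inter> {..<n0}. ?c n)"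
        by (subst sum.Int_Diff[of "{..<N}" _ "{..<n0}"]) auto
      moreover have "(\<Sum>n\<in>{..<N} \<inter> {..<n0}. ?c n) \<le> (\<Sum>n<n0. ?c n)"
        using t by (intro sum_mono2) auto
      ultimately show ?thesis using True by (intro mult_left_mono) auto
    qed
    also have "\<dots> = (\<Sum>n\<in>{..<N} - {..<n0}. ?c n * q)"
      by (simp add: sum_distrib_left mult.commute)
    also have "\<dots> \<le> (\<Sum>n\<in>{..<N} - {..<n0}. ?c n * (Q ^^ n) (\<lambda>y. of_bool (A y)) x)"
      using t by (intro sum_mono mult_left_mono Qn_lower[OF q]) (simp_all add: not_less)
    also have "\<dots> \<le> (\<Sum>n<N. ?c n * (Q ^^ n) (\<lambda>y. of_bool (A y)) x)"
      using t Q0 by (intro sum_mono2) auto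
    finally have "ennreal (q * ((\<Sum>n<N. ?c n) - 1 / 50)) \<le> ennreal (\<Sum>n<N. ?c n * (Q ^^ n) (\<lambda>y. of_bool (A y)) x)"
      by (rule ennreal_leI)
    also have "\<dots> = (\<Sum>n<N. ennreal (?c n * (Q ^^ n) (\<lambda>y. of_bool (A y)) x))"
      using t Q0 by (intro sum_ennreal[symmetric]) auto
    also have "\<dots> \<le> ennreal P"
      using nn_integral_load_at_ge[where h = "\<lambda>y. of_bool (A y)" and t = t and N = N and x = x] t unfolding P by simp
    finally show ?thesis by (simp add: P_def)
  qed
  moreover have "(\<lambda>N. q * ((\<Sum>n<N. ?c n) - 1 / 50)) \<longlonglongrightarrow> q * (1 - 1 / 50)"
  proof -
    have "(\<lambda>n. exp (- ?r) * (?r ^ n /\<^sub>R fact n)) sums (exp (- ?r) * exp ?r)"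
      by (intro sums_mult exp_converges)
    moreover have "exp (- ?r) * (?r ^ n /\<^sub>R fact n) = ?c n" for n
      by (simp only: divide_inverse real_scaleR_def mult_ac)
    ultimately have "?c sums 1" by (simp flip: exp_add)
    then show ?thesis
      unfolding sums_def by (intro tendsto_intros)
  qed
  ultimately have "q * (1 - 1 / 50) \<le> P"
    by (intro LIMSEQ_le_const2) auto
  then show ?thesis
    using sets by (simp add: emeasure_eq_measure P_def[symmetric] ennreal_leI)
next
  case False
  then have "ennreal (q * (49 / 50)) = 0" by (intro ennreal_neg) auto
  then show ?thesis by simp
qed

end

section \<open>Invariance under translations\<close>

text \<open>Values outside \<open>V\<close> are kept, so that a shifted load vector is still
  \<open>undefined\<close> there and stays in \<open>loads V\<close>.\<close>

definition shift :: "'a set \<Rightarrow> int \<Rightarrow> ('a \<Rightarrow> int) \<Rightarrow> ('a \<Rightarrow> int)" where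
  "shift V c x = (\<lambda>v. if v \<in> V then x v + c else x v)"

lemma translation_rel_Image:
  assumes "x \<in> loads V"
  shows "translation_rel V `` {x} = range (\<lambda>c. shift V c x)"
proof (intro set_eqI iffI)
  fix y assume "y \<in> translation_rel V `` {x}"
  then obtain c where y: "y \<in> loads V" "\<forall>v\<in>V. y v = x v + c" by (auto simp: translation_rel_def)
  have "y = shift V c x"
    by (rule PiE_ext[OF y(1)]) (use assms y(2) in \<open>auto simp: shift_def PiE_iff extensional_def\<close>)
  then show "y \<in> range (\<lambda>c. shift V c x)" by auto
next
  fix y assume "y \<in> range (\<lambda>c. shift V c x)"
  then show "y \<in> translation_rel V `` {x}"
    using assms by (auto simp: shift_def translation_rel_def PiE_iff extensional_def)
qed

lemma gap_shift:
  assumes "finite V" "V \<noteq> {}"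
  shows "gap V (shift V c x) = gap V x"
proof -
  have "shift V c x ` V = (\<lambda>v. x v + c) ` V" by (auto simp: shift_def)
  then show ?thesis using assms by (simp add: gap_def Max_add_commute Min_add_commute)
qed

lemma normalized_gap_class:
  assumes "finite V" "V \<noteq> {}" "x \<in> loads V"
  shows "normalized_gap V (translation_rel V `` {x}) = gap V x"
proof -
  have "gap V ` range (\<lambda>c. shift V c x) = {gap V x}"
    using assms by (auto simp: gap_shift image_image)
  then show ?thesis using assms by (simp add: normalized_gap_def translation_rel_Image)
qed

lemma countable_loads: "finite V \<Longrightarrow> countable (loads V)"
  by (intro countable_PiE) auto

lemma countable_normalized_loads: "finite V \<Longrightarrow> countable (normalized_loads V)"
  using countable_loads[of V]
  by (auto simp: normalized_loads_def quotient_def)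

lemma emeasure_pair_ge:
  assumes "prob_space \<mu>" "prob_space N" "A \<in> sets (\<mu> \<Otimes>\<^sub>M N)"
    and "\<And>x. x \<in> space \<mu> \<Longrightarrow> q \<le> emeasure N {\<omega> \<in> space N. (x, \<omega>) \<in> A}"
  shows "q \<le> emeasure (\<mu> \<Otimes>\<^sub>M N) A"
proof -
  interpret \<mu>: prob_space \<mu> by fact
  interpret N: prob_space N by fact
  have "q = (\<integral>\<^sup>+x. q \<partial>\<mu>)" by (simp add: \<mu>.emeasure_space_1)
  also have "\<dots> \<le> (\<integral>\<^sup>+x. emeasure N (Pair x -` A) \<partial>\<mu>)"
  proof (rule nn_integral_mono)
    fix x assume "x \<in> space \<mu>"
    moreover have "Pair x -` A = {\<omega> \<in> space N. (x, \<omega>) \<in> A}"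
      using sets.sets_into_space[OF assms(3)] by (auto simp: space_pair_measure)
    ultimately show "q \<le> emeasure N (Pair x -` A)" using assms(4) by simp
  qed
  also have "\<dots> = emeasure (\<mu> \<Otimes>\<^sub>M N) A"
    using assms(3) by (rule N.emeasure_pair_measure_alt[symmetric])
  finally show ?thesis .
qed

text \<open>The mean uses the higher level \<open>b\<close>, reached with probability
  \<open>q\<close>, through \<open>a \<le> b * q\<close>; the probability uses only that
  \<open>a\<close> is below \<open>b\<close>.\<close>

lemma mean_and_prob_bounds:
  fixes Y :: "'b \<Rightarrow> int" and a b q :: real
  assumes "prob_space P" and Y: "Y \<in> measurable P (count_space UNIV)"
    and q: "ennreal q \<le> emeasure P {\<xi> \<in> space P. b \<le> Y \<xi>}"
    and a: "0 \<le> a" "a \<le> b" "a \<le> b * q" "1 / 8 \<le> q"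
  shows "ennreal a \<le> (\<integral>\<^sup>+\<xi>. ennreal (Y \<xi>) \<partial>P)" "1 / 8 \<le> measure P {\<xi> \<in> space P. a \<le> Y \<xi>}"
proof -
  interpret prob_space P by fact
  have sets: "{\<xi> \<in> space P. c \<le> Y \<xi>} \<in> sets P" for c :: real
    using measurable_sets[OF Y, of "{k. c \<le> real_of_int k}"] by (simp add: vimage_def Int_def conj_commute)
  have "ennreal a \<le> ennreal b * ennreal q"
    using a by (simp add: ennreal_leI flip: ennreal_mult)
  also have "\<dots> \<le> ennreal b * emeasure P {\<xi> \<in> space P. b \<le> Y \<xi>}"
    using q by (rule mult_left_mono) simp
  also have "\<dots> = (\<integral>\<^sup>+\<xi>. ennreal b * indicator {\<xi> \<in> space P. b \<le> Y \<xi>} \<xi> \<partial>P)"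
    using sets by (simp add: nn_integral_cmult_indicator)
  also have "\<dots> \<le> (\<integral>\<^sup>+\<xi>. ennreal (Y \<xi>) \<partial>P)"
    by (intro nn_integral_mono) (auto simp: indicator_def ennreal_leI)
  finally show "ennreal a \<le> (\<integral>\<^sup>+\<xi>. ennreal (Y \<xi>) \<partial>P)" .
  have "q \<le> measure P {\<xi> \<in> space P. b \<le> Y \<xi>}"
    using q by (simp add: emeasure_eq_measure)
  also have "\<dots> \<le> measure P {\<xi> \<in> space P. a \<le> Y \<xi>}"
    using sets a by (intro finite_measure_mono) auto
  finally show "1 / 8 \<le> measure P {\<xi> \<in> space P. a \<le> Y \<xi>}" using a by simp
qed

context rule_on_graph
begin

text \<open>A ring looks only at the load difference of two vertices of \<open>V\<close>, which a
  common shift preserves.\<close>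

lemma run_shift:
  "set l \<subseteq> E \<times> UNIV \<Longrightarrow> run ori p \<omega> l (shift V c x) = shift V c (run ori p \<omega> l x)"
proof (induction l rule: rev_induct)
  case (snoc i l)
  then obtain e k where i: "i = (e, k)" "e \<in> E" by (cases i) auto
  obtain u v where uv: "ori e = (u, v)" "u \<in> V" "v \<in> V" by (rule edge_cases[OF i(2)])
  have "add_ball ori p e U (shift V c y) = shift V c (add_ball ori p e U y)" for U y
    using uv by (auto simp: add_ball_def shift_def fun_eq_iff)
  then show ?case using snoc by (simp add: i)
qed simp

lemma run_loads: "set l \<subseteq> E \<times> UNIV \<Longrightarrow> x \<in> loads V \<Longrightarrow> run ori p \<omega> l x \<in> loads V"
proof (induction l rule: rev_induct)
  case (snoc i l)
  then obtain e k where i: "i = (e, k)" "e \<in> E" by (cases i) auto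
  obtain u v where uv: "ori e = (u, v)" "u \<in> V" "v \<in> V" by (rule edge_cases[OF i(2)])
  have "add_ball ori p e U y \<in> loads V" if "y \<in> loads V" for U y
    using that uv by (auto simp: add_ball_def PiE_iff extensional_def)
  then show ?case using snoc by (simp add: i)
qed simp

lemma load_at_loads: "x \<in> loads V \<Longrightarrow> load_at G ori p t (x, \<omega>) \<in> loads V"
  unfolding load_at_run by (intro run_loads ring_list_subset)

lemma normalized_load_at_class:
  assumes "x \<in> loads V"
  shows "normalized_load_at G ori p t (translation_rel V `` {x}, \<omega>) = translation_rel V `` {load_at G ori p t (x, \<omega>)}"
proof -
  have "normalized_load_at G ori p t (translation_rel V `` {x}, \<omega>)
      = range (\<lambda>c. load_at G ori p t (shift V c x, \<omega>))"
    by (simp add: normalized_load_at_def translation_rel_Image[OF assms] image_image)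
  also have "\<dots> = range (\<lambda>c. shift V c (load_at G ori p t (x, \<omega>)))"
    by (simp add: load_at_run run_shift[OF ring_list_subset])
  finally show ?thesis
    by (simp add: translation_rel_Image[OF load_at_loads[OF assms]])
qed

text \<open>With a countable first factor carrying all subsets, joint measurability reduces to
  measurability of the sections.\<close>

lemma measurable_process:
  assumes "law_on S \<mu>" "countable S" "\<And>x. x \<in> S \<Longrightarrow> (\<lambda>\<omega>. f (x, \<omega>)) \<in> measurable M N"
  shows "f \<in> measurable (process_space G \<mu>) N"
proof -
  have "sets (process_space G \<mu>) = sets (count_space S \<Otimes>\<^sub>M M)"
    using assms(1) by (intro sets_pair_measure_cong) (auto simp: law_on_def)
  then show ?thesis
    using measurable_pair_measure_countable1[OF assms(2,3)] by (simp cong: measurable_cong_sets)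
qed

lemma law_on_space: "law_on S \<mu> \<Longrightarrow> space \<mu> = S"
  using sets.top[of \<mu>] sets.sets_into_space[of S \<mu>] by (auto simp: law_on_def)

lemma initial_law_bounds:
  fixes a b q :: real
  assumes \<mu>: "law_on (loads V) \<mu>"
    and q: "\<And>x. ennreal q \<le> emeasure M {\<omega> \<in> space M. b \<le> gap V (load_at G ori p t (x, \<omega>))}"
    and a: "0 \<le> a" "a \<le> b" "a \<le> b * q" "1 / 8 \<le> q"
  shows "ennreal a \<le> (\<integral>\<^sup>+\<xi>. ennreal (gap V (load_at G ori p t \<xi>)) \<partial>process_space G \<mu>)"
    "1 / 8 \<le> measure (process_space G \<mu>) {\<xi> \<in> space (process_space G \<mu>). a \<le> gap V (load_at G ori p t \<xi>)}"
proof -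
  interpret \<mu>: prob_space \<mu> using \<mu> by (simp add: law_on_def)
  interpret M: prob_space M by (rule prob_space_clocks_marks)
  interpret pair_prob_space \<mu> M ..
  have "load_at G ori p t \<in> measurable (process_space G \<mu>) (count_space UNIV)"
    using \<mu> countable_loads[OF finite_verts] measurable_load_at by (rule measurable_process)
  then have Y: "(\<lambda>\<xi>. gap V (load_at G ori p t \<xi>)) \<in> measurable (process_space G \<mu>) (count_space UNIV)"
    by (rule measurable_compose) simp
  have "ennreal q \<le> emeasure (process_space G \<mu>) {\<xi> \<in> space (process_space G \<mu>). b \<le> gap V (load_at G ori p t \<xi>)}"
  proof (rule emeasure_pair_ge[OF \<mu>.prob_space_axioms M.prob_space_axioms])
    show "{\<xi> \<in> space (process_space G \<mu>). b \<le> gap V (load_at G ori p t \<xi>)} \<in> sets (process_space G \<mu>)"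
      using measurable_sets[OF Y, of "{k. b \<le> real_of_int k}"] by (simp add: vimage_def Int_def conj_commute)
    fix x assume "x \<in> space \<mu>"
    then show "ennreal q \<le> emeasure M {\<omega> \<in> space M. (x, \<omega>) \<in> {\<xi> \<in> space (process_space G \<mu>). b \<le> gap V (load_at G ori p t \<xi>)}}"
      using q[of x] by (simp add: space_pair_measure conj_ac cong: conj_cong)
  qed
  from mean_and_prob_bounds[OF P.prob_space_axioms Y this a]
  show "ennreal a \<le> (\<integral>\<^sup>+\<xi>. ennreal (gap V (load_at G ori p t \<xi>)) \<partial>process_space G \<mu>)"
    "1 / 8 \<le> measure (process_space G \<mu>) {\<xi> \<in> space (process_space G \<mu>). a \<le> gap V (load_at G ori p t \<xi>)}" .
qed

lemma invariant_law_bounds: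
  fixes a b q :: real
  assumes \<nu>: "invariant_normalized_law G ori p \<nu>" and t: "0 \<le> t"
    and q: "\<And>x. ennreal q \<le> emeasure M {\<omega> \<in> space M. b \<le> gap V (load_at G ori p t (x, \<omega>))}"
    and a: "0 \<le> a" "a \<le> b" "a \<le> b * q" "1 / 8 \<le> q"
  shows "ennreal a \<le> (\<integral>\<^sup>+C. ennreal (normalized_gap V C) \<partial>\<nu>)"
    "1 / 8 \<le> measure \<nu> {C \<in> space \<nu>. a \<le> normalized_gap V C}"
proof -
  have law: "law_on (normalized_loads V) \<nu>"
    and inv: "distr (process_space G \<nu>) \<nu> (normalized_load_at G ori p t) = \<nu>"
    using \<nu> t by (auto simp: invariant_normalized_law_def)
  interpret \<nu>: prob_space \<nu> using law by (simp add: law_on_def)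
  have space: "space \<nu> = normalized_loads V" and sets: "sets \<nu> = Pow (normalized_loads V)"
    using law law_on_space by (auto simp: law_on_def)
  have reps: "\<exists>x\<in>loads V. C = translation_rel V `` {x}" if "C \<in> normalized_loads V" for C
    using that by (auto simp: normalized_loads_def quotient_def)
  have meas: "normalized_load_at G ori p t \<in> measurable (process_space G \<nu>) \<nu>"
  proof (rule measurable_process[OF law countable_normalized_loads[OF finite_verts]])
    fix C assume "C \<in> normalized_loads V"
    then obtain x where x: "x \<in> loads V" "C = translation_rel V `` {x}" using reps by blast
    have "(\<lambda>\<omega>. translation_rel V `` {load_at G ori p t (x, \<omega>)}) \<in> measurable M (count_space (normalized_loads V))"
    proof (rule measurable_compose[where f = "\<lambda>\<omega>. load_at G ori p t (x, \<omega>)" and N = "count_space (loads V)"])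
      show "(\<lambda>\<omega>. load_at G ori p t (x, \<omega>)) \<in> measurable M (count_space (loads V))"
        using measurable_sets[OF measurable_load_at[of t x]] load_at_loads[OF x(1)]
        by (intro measurableI) auto
      show "(\<lambda>y. translation_rel V `` {y}) \<in> measurable (count_space (loads V)) (count_space (normalized_loads V))"
        by (auto simp: normalized_loads_def quotient_def)
    qed
    moreover have "measurable M \<nu> = measurable M (count_space (normalized_loads V))"
      using sets by (intro measurable_cong_sets) auto
    ultimately show "(\<lambda>\<omega>. normalized_load_at G ori p t (C, \<omega>)) \<in> measurable M \<nu>"
      by (simp add: x normalized_load_at_class)
  qed
  have Y: "normalized_gap V \<in> measurable \<nu> (count_space UNIV)"
    by (intro measurableI) (auto simp: sets space)
  let ?B = "{C \<in> space \<nu>. b \<le> normalized_gap V C}"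
  have B: "?B \<in> sets \<nu>" by (auto simp: sets space)
  have "ennreal q \<le> emeasure (process_space G \<nu>) (normalized_load_at G ori p t -` ?B \<inter> space (process_space G \<nu>))"
  proof (rule emeasure_pair_ge[OF \<nu>.prob_space_axioms prob_space_clocks_marks])
    show "normalized_load_at G ori p t -` ?B \<inter> space (process_space G \<nu>) \<in> sets (process_space G \<nu>)"
      using meas B by (rule measurable_sets)
    fix C assume C: "C \<in> space \<nu>"
    then obtain x where x: "x \<in> loads V" "C = translation_rel V `` {x}" using reps space by blast
    have "(C, \<omega>) \<in> normalized_load_at G ori p t -` ?B \<inter> space (process_space G \<nu>)
      \<longleftrightarrow> b \<le> gap V (load_at G ori p t (x, \<omega>))" if "\<omega> \<in> space M" for \<omega>
    proof -
      have "(C, \<omega>) \<in> space (process_space G \<nu>)" using C that by (simp add: space_pair_measure)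
      moreover from measurable_space[OF meas this]
      have "normalized_load_at G ori p t (C, \<omega>) \<in> space \<nu>" .
      moreover have "normalized_gap V (normalized_load_at G ori p t (C, \<omega>)) = gap V (load_at G ori p t (x, \<omega>))"
        using x load_at_loads[OF x(1)] by (simp add: normalized_load_at_class normalized_gap_class finite_verts V_nonempty)
      ultimately show ?thesis by simp
    qed
    then show "ennreal q \<le> emeasure M {\<omega> \<in> space M. (C, \<omega>) \<in> normalized_load_at G ori p t -` ?B \<inter> space (process_space G \<nu>)}"
      using q[of x] by (simp cong: conj_cong)
  qed
  also have "\<dots> = emeasure (distr (process_space G \<nu>) \<nu> (normalized_load_at G ori p t)) ?B"
    using meas B by (simp add: emeasure_distr)
  \<comment> \<open>Invariance at the single time \<open>t\<close> carries the bound from the gap at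
    time \<open>t\<close> over to \<nu> itself.\<close>
  finally have "ennreal q \<le> emeasure \<nu> ?B" by (simp only: inv)
  from mean_and_prob_bounds[OF \<nu>.prob_space_axioms Y this a]
  show "ennreal a \<le> (\<integral>\<^sup>+C. ennreal (normalized_gap V C) \<partial>\<nu>)"
    "1 / 8 \<le> measure \<nu> {C \<in> space \<nu>. a \<le> normalized_gap V C}" .
qed

end

theorem theorem7p3:
  fixes K L :: nat
    and G :: "(nat \<times> nat) ugraph"
    and ori :: "(nat \<times> nat) set \<Rightarrow> (nat \<times> nat) \<times> (nat \<times> nat)"
    and p :: "(nat \<times> nat) set \<Rightarrow> int \<Rightarrow> real"
    and a :: real
  assumes "3 \<le> K" and "K \<le> L"
    and G: "G = cycle_graph L \<box> cycle_graph K"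
    and a: "a = c2 * sqrt (real L / real K + ln (real K))"
    and rule: "endpoint_local_monotone_rule G ori p"
  shows
    "(\<forall>\<mu> t. law_on (loads (verts G)) \<mu> \<and> (real L)\<^sup>2 \<le> t \<longrightarrow>
        ennreal a \<le> (\<integral>\<^sup>+ \<xi>. ennreal (gap (verts G) (load_at G ori p t \<xi>)) \<partial>process_space G \<mu>) \<and>
        1 / 8 \<le> measure (process_space G \<mu>)
          {\<xi> \<in> space (process_space G \<mu>). a \<le> gap (verts G) (load_at G ori p t \<xi>)}) \<and>
     (\<forall>\<nu>. invariant_normalized_law G ori p \<nu> \<longrightarrow>
        ennreal a \<le> (\<integral>\<^sup>+ C. ennreal (normalized_gap (verts G) C) \<partial>\<nu>) \<and>
        1 / 8 \<le> measure \<nu> {C \<in> space \<nu>. a \<le> normalized_gap (verts G) C})"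
proof -
  have card: "card (edges G) = 2 * (L * K)"
    unfolding G using assms(1,2) by (intro card_edges_torus) auto
  have "edges G \<noteq> {}" using card assms(1,2) by auto
  then interpret rule_on_torus G ori p K L
    using assms finite_simple_graph_torus[of L K] by unfold_locales auto
  obtain n :: nat and b q :: real where n: "n \<le> real L ^ 3 * K / 2" and ab: "a \<le> b" "a \<le> b * (q * (49 / 50))" "1 / 8 \<le> q * (49 / 50)"
    and q: "\<And>x. q \<le> (Q ^^ n) (\<lambda>y. of_bool (b \<le> gap V y)) x"
    using gap_spread unfolding a by blast
  have a0: "0 \<le> a" using c2_bounds assms(1) by (simp add: a)
  have spread: "ennreal (q * (49 / 50)) \<le> emeasure M {\<omega> \<in> space M. b \<le> gap V (load_at G ori p t (x, \<omega>))}"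
    if t: "(real L)\<^sup>2 \<le> t" for t x
  proof (rule prob_load_at_ge)
    \<comment> \<open>The mean number of rings at time L^2, four times the bound on
      \<open>n\<close>. For K = L = 3 it is 162, just above the 160 of the tail estimate.\<close>
    have "real L ^ 3 * K * 2 = card E * (real L)\<^sup>2"
      by (simp add: card power2_eq_square power3_eq_cube)
    also have "\<dots> \<le> card E * t" using t by (intro mult_left_mono) auto
    finally have m: "real L ^ 3 * K * 2 \<le> card E * t" .
    then show "real n \<le> card E * t / 4" using n by simp
    have "160 \<le> (3::real) ^ 3 * 3 * 2" by simp
    also have "\<dots> \<le> real L ^ 3 * K * 2"
      using assms(1,2) by (intro mult_mono power_mono) auto
    also note m
    finally show "160 \<le> card E * t" .
  qed (rule q)
  show ?thesis
    using initial_law_bounds[OF _ spread a0 ab] invariant_law_bounds[OF _ _ spread[OF order.refl] a0 ab]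
    by auto
qed

end
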